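(* Let $\chi:\mathbb{R}^{2d}\to\mathbb{R}^{2d}$ be a tame canonical transformation satisfying the vertical nonrefocusing condition, and let $A\in FIO(\chi)$. Then, for all compact subsets $E,F\subset\mathbb{R}^d$, the operator $\mathbf{1}_E\,A\,\mathbf{1}_F$ is compact on $L^2(\mathbb{R}^d)$.
   Context: A tame canonical transformation is a smooth map $\chi:\mathbb{R}^{2d}\to\mathbb{R}^{2d}$ such that (i) for every multi-index $\alpha$ with $|\alpha|\ge 1$ there is a constant $C_\alpha$ with $|\partial^\alpha\chi(z)|\le C_\alpha$ for all $z\in\mathbb{R}^{2d}$; (ii) $\chi$ is canonical (symplectic): if $(x,\xi)=\chi(y,\eta)$ then $dy\wedge d\eta=dx\wedge d\xi$. (Such a map is a globally bi-Lipschitz diffeomorphism of $\mathbb{R}^{2d}$.) Vertical nonrefocusing condition for $\chi$: there exist an open conic neighborhood $\Gamma\subset\mathbb{R}^{2d}\setminus\{0\}$ of $\{0\}\times(\mathbb{R}^d\setminus\{0\})$ and $R>0$ such that, for $\eta\in\mathbb{R}^d$, $|\eta|>R$ implies $\chi(0,\eta)\notin\Gamma$. (Conic means invariant under multiplication by positive scalars.) For $z=(x,\xi)\in\mathbb{R}^{2d}$, $\pi(z)$ is the phase space shift $\pi(x,\xi)g(y)=e^{iy\cdot\xi}g(y-x)$. $\langle\cdot,\cdot\rangle$ is the $L^2(\mathbb{R}^d)$ inner product, linear in the first argument, extended to the pairing of $\mathcal{S}'(\mathbb{R}^d)$ with $\mathcal{S}(\mathbb{R}^d)$. $FIO(\chi)$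 is the class of continuous linear operators $A:\mathcal{S}(\mathbb{R}^d)\to\mathcal{S}'(\mathbb{R}^d)$ such that, for some (equivalently, any) $g\in\mathcal{S}(\mathbb{R}^d)\setminus\{0\}$, for every $N>0$ there is $C_N>0$ with $|\langle A\,\pi(z)g,\pi(w)g\rangle|\le C_N(1+|w-\chi(z)|)^{-N}$ for all $z,w\in\mathbb{R}^{2d}$. Every $A\in FIO(\chi)$ extends to a continuous linear operator on $L^2(\mathbb{R}^d)$, and $\mathbf{1}_E$, $\mathbf{1}_F$ denote multiplication by the indicator functions of $E$, $F$. *)

theory Defs
  imports "HOL-Analysis.Analysis"
begin

section \<open>Partial derivatives and smooth maps\<close>

text \<open>
  A multi-index of order \<open>k\<close> is encoded as a list of \<open>k\<close> elements of \<^term>\<open>Basis\<close>, naming the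
  coordinates of the successive partial derivatives. For smooth maps the order of
  differentiation is irrelevant, so the lists of length \<open>k\<close> yield exactly the derivatives
  \<open>\<partial>\<^sup>\<alpha>\<close> with \<open>|\<alpha>| = k\<close>.
\<close>

primrec iter_deriv ::
  "'a::euclidean_space list \<Rightarrow> ('a \<Rightarrow> 'b::real_normed_vector) \<Rightarrow> 'a \<Rightarrow> 'b" where
  "iter_deriv [] f = f"
| "iter_deriv (v # vs) f = (\<lambda>x. frechet_derivative (iter_deriv vs f) (at x) v)"

definition smooth :: "('a::euclidean_space \<Rightarrow> 'b::real_normed_vector) \<Rightarrow> bool" where
  "smooth f \<longleftrightarrow> (\<forall>vs \<in> lists Basis. \<forall>x. iter_deriv vs f differentiable (at x))"


section \<open>Tame canonical transformations\<close>

text \<open>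
  Phase space \<open>\<real>\<^sup>2\<^sup>d\<close> is the product of two copies of \<open>\<real>\<^sup>d\<close>, whose norm is the Euclidean one.
\<close>

type_synonym 'n phase = "(real ^ 'n) \<times> (real ^ 'n)"

text \<open>
  The two-form \<open>dx \<and> d\<xi> = \<Sum>\<^sub>j dx\<^sub>j \<and> d\<xi>\<^sub>j\<close>, evaluated on a pair of tangent vectors.
\<close>

definition symplectic_form :: "'n::finite phase \<Rightarrow> 'n phase \<Rightarrow> real" where
  "symplectic_form u v = fst u \<bullet> snd v - snd u \<bullet> fst v"

text \<open>
  Invariance of the two-form under pullback by \<open>\<kappa>\<close>.
\<close>

definition canonical :: "('n::finite phase \<Rightarrow> 'n phase) \<Rightarrow> bool" where
  "canonical \<kappa> \<longleftrightarrow> (\<forall>z u v.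
     symplectic_form (frechet_derivative \<kappa> (at z) u) (frechet_derivative \<kappa> (at z) v)
       = symplectic_form u v)"

definition tame_canonical :: "('n::finite phase \<Rightarrow> 'n phase) \<Rightarrow> bool" where
  "tame_canonical \<kappa> \<longleftrightarrow>
     smooth \<kappa> \<and>
     (\<forall>vs \<in> lists Basis. length vs \<ge> 1 \<longrightarrow> (\<exists>C. \<forall>z. norm (iter_deriv vs \<kappa> z) \<le> C)) \<and>
     canonical \<kappa>"

definition conic :: "'a::real_vector set \<Rightarrow> bool" where
  "conic \<Gamma> \<longleftrightarrow> (\<forall>t>0. \<forall>z\<in>\<Gamma>. t *\<^sub>R z \<in> \<Gamma>)"

definition vertical_nonrefocusing :: "('n::finite phase \<Rightarrow> 'n phase) \<Rightarrow> bool" where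
  "vertical_nonrefocusing \<kappa> \<longleftrightarrow>
     (\<exists>\<Gamma> R. open \<Gamma> \<and> conic \<Gamma> \<and> \<Gamma> \<subseteq> UNIV - {0} \<and> {0} \<times> (UNIV - {0}) \<subseteq> \<Gamma> \<and> R > 0 \<and>
        (\<forall>\<eta>. norm \<eta> > R \<longrightarrow> \<kappa> (0, \<eta>) \<notin> \<Gamma>))"


section \<open>Schwartz functions and tempered distributions\<close>

definition schwartz :: "(real ^ 'n::finite \<Rightarrow> complex) set" where
  "schwartz = {f. smooth f \<and>
     (\<forall>k. \<forall>vs \<in> lists Basis. \<exists>C. \<forall>x. (1 + norm x) ^ k * norm (iter_deriv vs f x) \<le> C)}"

definition schwartz_seminorm ::
  "nat \<Rightarrow> (real ^ 'n) list \<Rightarrow> (real ^ 'n::finite \<Rightarrow> complex) \<Rightarrow> real" where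
  "schwartz_seminorm k vs f = (SUP x. (1 + norm x) ^ k * norm (iter_deriv vs f x))"

definition schwartz_topology :: "(real ^ 'n::finite \<Rightarrow> complex) topology" where
  "schwartz_topology = topology_generated_by
     {{f \<in> schwartz. schwartz_seminorm k vs (\<lambda>x. f x - h x) < e} | h k vs e.
        h \<in> schwartz \<and> vs \<in> lists Basis \<and> e > 0}"

text \<open>
  Distributions are linear (not antilinear) functionals. Only their values on
  \<^term>\<open>schwartz\<close> are meaningful.
\<close>

definition tempered :: "((real ^ 'n::finite \<Rightarrow> complex) \<Rightarrow> complex) set" where
  "tempered = {T.
     (\<forall>\<phi>\<in>schwartz. \<forall>\<psi>\<in>schwartz. \<forall>a b. T (\<lambda>x. a * \<phi> x + b * \<psi> x) = a * T \<phi> + b * T \<psi>) \<and>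
     continuous_map schwartz_topology euclidean T}"

text \<open>
  The weak-* topology. For linear maps from the Frechet space of Schwartz functions,
  continuity into this topology and into the strong dual topology coincide.
\<close>

definition tempered_topology :: "((real ^ 'n::finite \<Rightarrow> complex) \<Rightarrow> complex) topology" where
  "tempered_topology = topology_generated_by
     {{T \<in> tempered. T \<psi> \<in> U} | \<psi> U. \<psi> \<in> schwartz \<and> open U}"

type_synonym 'n distr_op =
  "(real ^ 'n \<Rightarrow> complex) \<Rightarrow> (real ^ 'n \<Rightarrow> complex) \<Rightarrow> complex"

definition continuous_linear_S_S' :: "'n::finite distr_op \<Rightarrow> bool" where
  "continuous_linear_S_S' A \<longleftrightarrow>
     (\<forall>\<phi>\<in>schwartz. \<forall>\<psi>\<in>schwartz. \<forall>\<theta>\<in>schwartz. \<forall>a b.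
        A (\<lambda>x. a * \<phi> x + b * \<psi> x) \<theta> = a * A \<phi> \<theta> + b * A \<psi> \<theta>) \<and>
     continuous_map schwartz_topology tempered_topology A"

text \<open>
  The sesquilinear pairing extending \<open>\<langle>f, \<psi>\<rangle> = \<integral> f(x) cnj(\<psi>(x)) dx\<close>.
\<close>

definition pairing ::
  "((real ^ 'n::finite \<Rightarrow> complex) \<Rightarrow> complex) \<Rightarrow> (real ^ 'n \<Rightarrow> complex) \<Rightarrow> complex" where
  "pairing T \<psi> = T (\<lambda>x. cnj (\<psi> x))"


section \<open>The class FIO\<close>

definition phase_shift ::
  "'n::finite phase \<Rightarrow> (real ^ 'n \<Rightarrow> complex) \<Rightarrow> real ^ 'n \<Rightarrow> complex" where
  "phase_shift z g = (\<lambda>y. exp (\<i> * complex_of_real (y \<bullet> snd z)) * g (y - fst z))"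

definition FIO :: "('n::finite phase \<Rightarrow> 'n phase) \<Rightarrow> 'n distr_op set" where
  "FIO \<kappa> = {A. continuous_linear_S_S' A \<and>
     (\<exists>g \<in> schwartz - {\<lambda>x. 0}. \<forall>N::real. N > 0 \<longrightarrow> (\<exists>C>0. \<forall>z w.
        norm (pairing (A (phase_shift z g)) (phase_shift w g))
          \<le> C * (1 + norm (w - \<kappa> z)) powr (- N)))}"


section \<open>Operators on \<open>L\<^sup>2\<close>\<close>

text \<open>
  Elements of \<open>L\<^sup>2\<close> are represented by Borel functions, so that operators on \<open>L\<^sup>2\<close> are linear
  up to null sets. Boundedness then makes them respect equality almost everywhere.
\<close>

definition L2 :: "(real ^ 'n::finite \<Rightarrow> complex) set" where
  "L2 = {f \<in> borel_measurable lborel. integrable lborel (\<lambda>x. (norm (f x))\<^sup>2)}"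

definition L2_norm :: "(real ^ 'n::finite \<Rightarrow> complex) \<Rightarrow> real" where
  "L2_norm f = sqrt (\<integral>x. (norm (f x))\<^sup>2 \<partial>lborel)"

type_synonym 'n fun_op = "(real ^ 'n \<Rightarrow> complex) \<Rightarrow> (real ^ 'n \<Rightarrow> complex)"

definition continuous_linear_L2 :: "'n::finite fun_op \<Rightarrow> bool" where
  "continuous_linear_L2 B \<longleftrightarrow>
     (\<forall>f\<in>L2. B f \<in> L2) \<and>
     (\<forall>f\<in>L2. \<forall>g\<in>L2. \<forall>a b.
        AE x in lborel. B (\<lambda>x. a * f x + b * g x) x = a * B f x + b * B g x) \<and>
     (\<exists>C. \<forall>f\<in>L2. L2_norm (B f) \<le> C * L2_norm f)"

text \<open>
  Every bounded sequence is mapped to a sequence with a convergent subsequence.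
\<close>

definition compact_operator_L2 :: "'n::finite fun_op \<Rightarrow> bool" where
  "compact_operator_L2 B \<longleftrightarrow>
     continuous_linear_L2 B \<and>
     (\<forall>f. (\<forall>n::nat. f n \<in> L2) \<and> bounded (range (\<lambda>n. L2_norm (f n))) \<longrightarrow>
        (\<exists>r h. strict_mono r \<and> h \<in> L2 \<and>
           (\<lambda>n. L2_norm (\<lambda>x. B (f (r n)) x - h x)) \<longlonglongrightarrow> 0))"

text \<open>
  A function \<open>f\<close> in \<open>L\<^sup>2\<close> is identified with the distribution \<open>\<psi> \<mapsto> \<integral> f(x) \<psi>(x) dx\<close>.
\<close>

definition is_L2_extension :: "'n::finite distr_op \<Rightarrow> 'n fun_op \<Rightarrow> bool" where
  "is_L2_extension A B \<longleftrightarrow>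
     continuous_linear_L2 B \<and>
     (\<forall>\<phi>\<in>schwartz. \<forall>\<psi>\<in>schwartz. A \<phi> \<psi> = (\<integral>x. B \<phi> x * \<psi> x \<partial>lborel))"

text \<open>
  By density of the Schwartz functions, the extension is unique up to equality almost
  everywhere of its values. It exists whenever \<open>A\<close> lies in \<open>FIO \<kappa>\<close> with \<open>\<kappa>\<close> tame
  canonical; when no extension exists, the value is arbitrary.
\<close>

definition L2_extension :: "'n::finite distr_op \<Rightarrow> 'n fun_op" where
  "L2_extension A = (SOME B. is_L2_extension A B)"

definition mult_indicator :: "(real ^ 'n::finite) set \<Rightarrow> 'n fun_op" where
  "mult_indicator E f = (\<lambda>x. indicator E x * f x)"

end

theory Submission
  imports Defs "HOL-Complex_Analysis.Great_Picard"
begin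

text \<open>
  Write \<open>\<pi>(z)g\<close> for the phase space shifts of a window \<open>g\<close> that witnesses \<open>A \<in> FIO \<kappa>\<close>. The
  short-time Fourier transform \<open>V f z = \<langle>f, \<pi>(z)g\<rangle>\<close> resolves a function into its positions and
  frequencies, and up to a constant factor \<open>f\<close> is the superposition \<open>\<integral> V f z \<pi>(z)g dz\<close>
  (\<open>stft_inversion\<close>). In these coordinates \<open>A\<close> has the kernel \<open>\<langle>A \<pi>(z)g, \<pi>(w)g\<rangle>\<close>, which decays
  faster than any power of \<open>|w - \<kappa> z|\<close>.

  Suppose that \<open>f\<close> is supported in \<open>F\<close> and that the output is only examined on \<open>E\<close>. Then \<open>V f\<close>
  decays in the position of \<open>z\<close>, and the shifts \<open>\<pi>(w)g\<close> are small on \<open>E\<close> unless the position of \<open>w\<close> is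
  bounded. What remains are high frequencies \<open>\<eta>\<close> of \<open>z\<close>. Here the nonrefocusing condition enters: the
  position of \<open>\<kappa>(0, \<eta>)\<close> grows linearly with \<open>|\<eta>|\<close>, so that \<open>w\<close>, whose position is bounded, is far
  from \<open>\<kappa> z\<close> and the kernel is small (\<open>nonrefocusing_bound\<close>, \<open>triple_weight\<close>). Thus the localized
  kernel decays in all directions of phase space. Consequently \<open>A f\<close> is given on \<open>E\<close> by an absolutely
  convergent integral and is bounded and Lipschitz with constants proportional to the \<open>L\<^sup>2\<close> norm of
  \<open>f\<close> (\<open>kernel_image_regularity\<close>). By the Arzela-Ascoli theorem bounded sequences have images with
  subsequences that converge uniformly on \<open>E\<close>, hence in \<open>L\<^sup>2\<close> (\<open>compact_localization\<close>).

  For this argument \<open>A\<close> has to be recovered from its kernel, which rests on three facts. A continuous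
  functional on Schwartz space passes under integrals of rapidly decreasing families
  (\<open>schwartz_functional_integral\<close>), so that the kernel determines \<open>A\<close>. The map \<open>\<kappa>\<close> is a bijection with
  Lipschitz inverse: its derivative is invertible with uniform bounds because it is symplectic, the
  uniform inverse function theorem makes \<open>\<kappa>\<close> a covering, and phase space is simply connected
  (\<open>tame_canonical_bi_Lipschitz\<close>). Therefore the kernel passes the Schur test, and \<open>A\<close> has a bounded
  extension (\<open>H_L2_bound\<close>, \<open>L2_extension_exists\<close>). Finally Schwartz functions are dense in \<open>L\<^sup>2\<close>
  (\<open>rapid_dense_L2\<close>), so that identities for the extension can be checked on them
  (\<open>extension_pairing\<close>).
\<close>

section \<open>Rapidly decreasing functions\<close>

definition dird :: "'a::euclidean_space \<Rightarrow> ('a \<Rightarrow> 'b::real_normed_vector) \<Rightarrow> 'a \<Rightarrow> 'b" where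
  "dird v f x = frechet_derivative f (at x) v"

text \<open>The decay weight \<open>(1 + |x|)\<^sup>-\<^sup>k\<close>, written as a factor so that a bound
  \<open>norm (f x) \<le> C * wt k x\<close> can be multiplied by others and integrated.\<close>

definition wt :: "nat \<Rightarrow> 'a::real_normed_vector \<Rightarrow> real" where
  "wt k x = inverse ((1 + norm x) ^ k)"

text \<open>The Schwartz condition on an arbitrary Euclidean space. Besides functions of the position it has to
  cover functions on phase space (short-time Fourier transforms) and on products of phase space with
  position space (families of phase space shifts).\<close>

definition rapid :: "('a::euclidean_space \<Rightarrow> complex) \<Rightarrow> bool" where
  "rapid f \<longleftrightarrow> smooth f \<and>
     (\<forall>k. \<forall>vs \<in> lists Basis. \<exists>C. \<forall>x. (1 + norm x) ^ k * norm (iter_deriv vs f x) \<le> C)"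

lemma schwartz_iff_rapid: "f \<in> schwartz \<longleftrightarrow> rapid f"
  by (simp add: schwartz_def rapid_def)

lemma one_plus_norm_pos [simp]: "0 < 1 + norm x" "1 + norm x \<noteq> 0" "0 \<le> 1 + norm x"
  by (smt (verit) norm_ge_zero)+

lemma wt_pos [simp]: "0 < wt k x" "0 \<le> wt k x"
  by (simp_all add: wt_def)

lemma wt_le_1 [simp]: "wt k x \<le> 1"
  by (simp add: wt_def inverse_le_1_iff)

lemma wt_0 [simp]: "wt 0 x = 1"
  by (simp add: wt_def)

lemma wt_add: "wt (k + l) x = wt k x * wt l x"
  by (simp add: wt_def power_add)

lemma wt_mono: "norm x \<le> norm y \<Longrightarrow> wt k y \<le> wt k x"
  by (simp add: wt_def le_imp_inverse_le power_mono)

lemma wt_antimono: "k \<le> l \<Longrightarrow> wt l x \<le> wt k x"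
  by (simp add: wt_def le_imp_inverse_le power_increasing)

lemma wt_cancel [simp]: "(1 + norm x) ^ k * wt k x = 1" "wt k x * (1 + norm x) ^ k = 1"
  by (simp_all add: wt_def)

lemma borel_measurable_wt [measurable]: "wt k \<in> borel_measurable borel"
  unfolding wt_def by measurable

lemma wt_minus [simp]: "wt k (- x) = wt k x" "wt k (x - y) = wt k (y - x)"
  by (simp_all add: wt_def norm_minus_commute)

lemma one_plus_norm_add: "1 + norm (x + y) \<le> (1 + norm x) * (1 + norm y)"
  using norm_triangle_ineq[of x y] mult_nonneg_nonneg[of "norm x" "norm y"] by (simp add: algebra_simps del: mult_nonneg_nonneg)

lemma wt_shift: "wt k x \<le> (1 + norm y) ^ k * wt k (x + y)"
proof -
  have "(1 + norm (x + y)) ^ k \<le> (1 + norm x) ^ k * (1 + norm y) ^ k"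
    using power_mono[OF one_plus_norm_add] by (metis norm_ge_zero add_nonneg_nonneg power_mult_distrib zero_le_one)
  then show ?thesis
    by (simp add: wt_def field_simps)
qed

lemma le_wt_iff: "norm a \<le> C * wt k x \<longleftrightarrow> (1 + norm x) ^ k * norm a \<le> C"
  by (simp add: wt_def field_simps)

lemma wt_prod_le: "wt k x * wt k y \<le> wt k (x, y)"
proof -
  have "1 + norm (x, y) \<le> (1 + norm x) * (1 + norm y)"
    using norm_Pair_le[of x y] mult_nonneg_nonneg[of "norm x" "norm y"] by (simp add: algebra_simps del: mult_nonneg_nonneg)
  then have "(1 + norm (x, y)) ^ k \<le> ((1 + norm x) * (1 + norm y)) ^ k"
    by (intro power_mono) auto
  then show ?thesis
    by (simp add: wt_def power_mult_distrib le_imp_inverse_le flip: inverse_mult_distrib)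
qed

lemma wt_Pair_le: "wt k (x, y) \<le> wt k x" "wt k (x, y) \<le> wt k y"
  by (auto intro!: wt_mono simp: norm_Pair real_le_rsqrt real_sqrt_sum_squares_ge1)

lemma wt_Pair_le_prod: "wt (k + l) (x, y) \<le> wt k x * wt l y"
  unfolding wt_add by (intro mult_mono wt_Pair_le) auto

text \<open>All derivatives are controlled at once by exhibiting a class of functions that is closed under
  differentiation and whose members decay. The closure properties below are instances, the class being
  the functions of the shape in question.\<close>

lemma rapidI:
  assumes "Q f"
    and "\<And>f. Q f \<Longrightarrow> \<exists>D. (\<forall>x. (f has_derivative D x) (at x)) \<and> (\<forall>b\<in>Basis. Q (\<lambda>x. D x b))"
    and "\<And>f k. Q f \<Longrightarrow> \<exists>C. \<forall>x. (1 + norm x) ^ k * norm (f x) \<le> C"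
  shows "rapid f"
proof -
  have it: "Q (iter_deriv vs f)" if "vs \<in> lists Basis" for vs
    using that
  proof (induction vs)
    case Nil then show ?case using assms(1) by simp
  next
    case (Cons b vs)
    then obtain D where D: "\<forall>x. (iter_deriv vs f has_derivative D x) (at x)" "\<forall>b\<in>Basis. Q (\<lambda>x. D x b)"
      using assms(2) by blast
    have "iter_deriv (b # vs) f = (\<lambda>x. D x b)"
    proof
      fix x
      have "D x = frechet_derivative (iter_deriv vs f) (at x)" using D(1) by (intro frechet_derivative_at) auto
      then show "iter_deriv (b # vs) f x = D x b" by simp
    qed
    then show ?case using D Cons by auto
  qed
  show ?thesis
    unfolding rapid_def smooth_def differentiable_def
    using it assms(2,3) by metis
qed

lemma iter_deriv_append: "iter_deriv (vs @ ws) f = iter_deriv vs (iter_deriv ws f)"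
  by (induction vs) auto

lemma rapid_iter_deriv: "rapid f \<Longrightarrow> vs \<in> lists Basis \<Longrightarrow> rapid (iter_deriv vs f)"
  unfolding rapid_def smooth_def by (simp flip: iter_deriv_append)

lemma rapid_differentiable: "rapid f \<Longrightarrow> f differentiable (at x)"
  unfolding rapid_def smooth_def by (metis iter_deriv.simps(1) lists.Nil)

lemma rapid_has_derivative: "rapid f \<Longrightarrow> (f has_derivative (\<lambda>v. dird v f x)) (at x)"
  unfolding dird_def using rapid_differentiable frechet_derivative_works by (metis eta_contract_eq)

lemma dird_eq: "(f has_derivative D) (at x) \<Longrightarrow> dird v f x = D v"
  unfolding dird_def by (metis frechet_derivative_at)

lemma rapid_bound:
  assumes "rapid f"
  obtains C where "C > 0" "\<And>x. norm (f x) \<le> C * wt k x"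
proof -
  obtain C where "\<And>x. (1 + norm x) ^ k * norm (f x) \<le> C"
    using assms unfolding rapid_def by (metis iter_deriv.simps(1) lists.Nil)
  then show ?thesis
    by (intro that[of "max C 1"]) (auto simp: le_wt_iff max.coboundedI1)
qed

lemma rapid_step:
  assumes "rapid f"
  shows "\<exists>D. (\<forall>x. (f has_derivative D x) (at x)) \<and> (\<forall>b\<in>Basis. rapid (\<lambda>x. D x b))"
proof -
  have "rapid (dird b f)" if "b \<in> Basis" for b
  proof -
    have "dird b f = iter_deriv [b] f" by (auto simp: dird_def)
    then show ?thesis using rapid_iter_deriv[OF assms, of "[b]"] that by simp
  qed
  then show ?thesis using rapid_has_derivative[OF assms]
    by (intro exI[of _ "\<lambda>x v. dird v f x"]) simp
qed

lemma rapid_continuous_on [continuous_intros]: "rapid f \<Longrightarrow> continuous_on A f"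
  by (meson continuous_at_imp_continuous_on differentiable_imp_continuous_within rapid_differentiable)

lemma rapid_borel [measurable_dest]: "rapid f \<Longrightarrow> f \<in> borel_measurable borel"
  by (simp add: borel_measurable_continuous_onI rapid_continuous_on)

lemma rapid_zero [simp]: "rapid (\<lambda>x. 0)"
  by (rule rapidI[where Q = "\<lambda>f. f = (\<lambda>x. 0)"]) (auto intro!: exI[of _ "\<lambda>x v. 0"])

lemma rapid_add:
  assumes "rapid f" "rapid g"
  shows "rapid (\<lambda>x. f x + g x)"
proof (rule rapidI[where Q = "\<lambda>h. \<exists>f g. rapid f \<and> rapid g \<and> h = (\<lambda>x. f x + g x)"], goal_cases)
  case 1 then show ?case using assms by blast
next
  case (2 h)
  then obtain f g where fg: "rapid f" "rapid g" "h = (\<lambda>x. f x + g x)" by blast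
  obtain Df Dg where "\<forall>x. (f has_derivative Df x) (at x)" "\<forall>b\<in>Basis. rapid (\<lambda>x. Df x b)"
    "\<forall>x. (g has_derivative Dg x) (at x)" "\<forall>b\<in>Basis. rapid (\<lambda>x. Dg x b)"
    using rapid_step[OF fg(1)] rapid_step[OF fg(2)] by blast
  then show ?case
    unfolding fg by (intro exI[of _ "\<lambda>x v. Df x v + Dg x v"]) (blast intro: has_derivative_add)
next
  case (3 h k)
  then obtain f g where fg: "rapid f" "rapid g" "h = (\<lambda>x. f x + g x)" by blast
  obtain C D where "\<And>x. norm (f x) \<le> C * wt k x" "\<And>x. norm (g x) \<le> D * wt k x"
    using rapid_bound[OF fg(1), of k] rapid_bound[OF fg(2), of k] by metis
  then have "norm (f x + g x) \<le> (C + D) * wt k x" for x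
    by (metis add_mono distrib_right norm_triangle_le)
  then show ?case unfolding fg le_wt_iff by blast
qed

text \<open>Applied to complex multiples and to conjugation.\<close>

lemma rapid_bounded_linear:
  assumes "bounded_linear T" "rapid f"
  shows "rapid (\<lambda>x. T (f x))"
proof (rule rapidI[where Q = "\<lambda>h. \<exists>f. rapid f \<and> h = (\<lambda>x. T (f x))"], goal_cases)
  case 1 then show ?case using assms by blast
next
  case (2 h)
  then obtain f where fg: "rapid f" "h = (\<lambda>x. T (f x))" by blast
  obtain Df where "\<forall>x. (f has_derivative Df x) (at x)" "\<forall>b\<in>Basis. rapid (\<lambda>x. Df x b)"
    using rapid_step[OF fg(1)] by blast
  then show ?case
    unfolding fg
    by (intro exI[of _ "\<lambda>x v. T (Df x v)"]) (auto intro!: bounded_linear.has_derivative[OF assms(1)])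
next
  case (3 h k)
  then obtain f where fg: "rapid f" "h = (\<lambda>x. T (f x))" by blast
  obtain C where C: "C > 0" "\<And>x. norm (f x) \<le> C * wt k x" using rapid_bound[OF fg(1)] by blast
  obtain K where K: "K > 0" "\<And>x. norm (T x) \<le> norm x * K"
    using bounded_linear.pos_bounded[OF assms(1)] by blast
  have "norm (T (f x)) \<le> (C * K) * wt k x" for x
    using order.trans[OF K(2)[of "f x"] mult_right_mono[OF C(2)[of x], of K]] K(1) by (simp add: mult_ac)
  then show ?case unfolding fg le_wt_iff by blast
qed

lemma rapid_cmult: "rapid f \<Longrightarrow> rapid (\<lambda>x. c * f x)"
  by (rule rapid_bounded_linear[OF bounded_linear_mult_right])

lemma rapid_scaleR: "rapid f \<Longrightarrow> rapid (\<lambda>x. c *\<^sub>R f x)"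
  by (rule rapid_bounded_linear[OF bounded_linear_scaleR_right])

lemma rapid_uminus: "rapid f \<Longrightarrow> rapid (\<lambda>x. - f x)"
  by (rule rapid_bounded_linear[OF bounded_linear_minus[OF bounded_linear_ident]])

lemma rapid_cnj: "rapid f \<Longrightarrow> rapid (\<lambda>x. cnj (f x))"
  by (rule rapid_bounded_linear[OF bounded_linear_cnj])

lemma rapid_diff: "rapid f \<Longrightarrow> rapid g \<Longrightarrow> rapid (\<lambda>x. f x - g x)"
  using rapid_add[OF _ rapid_uminus, of f g] by simp

lemma rapid_sum: "(\<And>i. i \<in> I \<Longrightarrow> rapid (f i)) \<Longrightarrow> rapid (\<lambda>x. \<Sum>i\<in>I. f i x)"
  by (induction I rule: infinite_finite_induct) (simp_all add: rapid_add)

lemma rapid_dird: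
  assumes "rapid f"
  shows "rapid (dird v f)"
proof -
  obtain D where D: "\<forall>x. (f has_derivative D x) (at x)" "\<forall>b\<in>Basis. rapid (\<lambda>x. D x b)"
    using rapid_step[OF assms] by blast
  have "dird v f x = (\<Sum>b\<in>Basis. (v \<bullet> b) *\<^sub>R D x b)" for x
  proof -
    interpret bounded_linear "D x" using D(1) by (auto dest: has_derivative_bounded_linear)
    have "dird v f x = D x (\<Sum>b\<in>Basis. (v \<bullet> b) *\<^sub>R b)" using dird_eq[OF D(1)[rule_format]] by (simp add: euclidean_representation)
    then show ?thesis by (simp add: sum scaleR)
  qed
  then have "dird v f = (\<lambda>x. \<Sum>b\<in>Basis. (v \<bullet> b) *\<^sub>R D x b)" by auto
  then show ?thesis using D(2) by (auto intro!: rapid_sum rapid_scaleR)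
qed

lemma rapid_dird_bound:
  assumes "rapid f"
  obtains C where "C > 0" "\<And>x v. norm (dird v f x) \<le> C * wt k x * norm v"
proof -
  have "\<exists>C>0. \<forall>x. norm (dird b f x) \<le> C * wt k x" for b
    using rapid_bound[OF rapid_dird[OF assms]] by metis
  then obtain C where C: "\<And>b. C b > 0" "\<And>b x. norm (dird b f x) \<le> C b * wt k x" by metis
  have "norm (dird v f x) \<le> (\<Sum>b\<in>Basis. C b) * wt k x * norm v" for x v
  proof -
    interpret bounded_linear "\<lambda>v. dird v f x" using rapid_has_derivative[OF assms] by (auto dest: has_derivative_bounded_linear)
    have "dird v f x = dird (\<Sum>b\<in>Basis. (v \<bullet> b) *\<^sub>R b) f x" by (simp add: euclidean_representation)
    also have "\<dots> = (\<Sum>b\<in>Basis. (v \<bullet> b) *\<^sub>R dird b f x)" by (simp add: sum scaleR)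
    also have "norm \<dots> \<le> (\<Sum>b\<in>Basis. norm v * (C b * wt k x))"
      by (intro sum_norm_le) (auto intro!: mult_mono C Basis_le_norm)
    finally show ?thesis by (simp add: sum_distrib_left sum_distrib_right mult_ac)
  qed
  moreover have "(\<Sum>b\<in>Basis. C b) > 0" using C(1) by (intro sum_pos) auto
  ultimately show ?thesis using that by blast
qed

text \<open>Injectivity makes \<open>|L x|\<close> comparable to \<open>|x|\<close> from below, so that decay survives.\<close>

lemma rapid_linear_compose:
  fixes L :: "'a::euclidean_space \<Rightarrow> 'b::euclidean_space"
  assumes "linear L" "inj L" "rapid f"
  shows "rapid (\<lambda>x. f (L x))"
proof -
  obtain B where B: "B > 0" "\<And>x. B * norm x \<le> norm (L x)"
    using linear_inj_bounded_below_pos[OF assms(1,2)] by metis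
  have bl: "bounded_linear L" using assms(1) by (rule linear_conv_bounded_linear[THEN iffD1])
  show ?thesis
  proof (rule rapidI[where Q = "\<lambda>h. \<exists>f. rapid f \<and> h = (\<lambda>x. f (L x))"], goal_cases)
    case 1 then show ?case using assms by blast
  next
    case (2 h)
    then obtain f where fg: "rapid f" "h = (\<lambda>x. f (L x))" by blast
    have "((\<lambda>x. f (L x)) has_derivative (\<lambda>v. dird (L v) f (L x))) (at x)" for x
      by (rule has_derivative_compose[OF bounded_linear_imp_has_derivative[OF bl] rapid_has_derivative[OF fg(1)]])
    then show ?case
      unfolding fg using rapid_dird[OF fg(1)]
      by (intro exI[of _ "\<lambda>x v. dird (L v) f (L x)"]) blast
  next
    case (3 h k)
    then obtain f where fg: "rapid f" "h = (\<lambda>x. f (L x))" by blast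
    obtain C where C: "C > 0" "\<And>x. norm (f x) \<le> C * wt k x" using rapid_bound[OF fg(1)] by blast
    have w: "wt k (L x) \<le> inverse (min B 1) ^ k * wt k x" for x
    proof -
      have "min B 1 * (1 + norm x) \<le> 1 + norm (L x)"
        using B(2)[of x] mult_right_mono[of "min B 1" B "norm x"] by (auto simp: distrib_left intro: add_mono)
      then have "(min B 1 * (1 + norm x)) ^ k \<le> (1 + norm (L x)) ^ k"
        using B(1) by (intro power_mono) auto
      then show ?thesis using B(1)
        by (simp add: wt_def power_mult_distrib le_imp_inverse_le power_inverse flip: inverse_mult_distrib)
    qed
    have "norm (f (L x)) \<le> (C * inverse (min B 1) ^ k) * wt k x" for x
      using order.trans[OF C(2)[of "L x"] mult_left_mono[OF w[of x], of C]] C(1) by (simp add: mult_ac)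
    then show ?case unfolding fg le_wt_iff by blast
  qed
qed

lemma rapid_translate:
  assumes "rapid f"
  shows "rapid (\<lambda>x. f (x + a))"
proof (rule rapidI[where Q = "\<lambda>h. \<exists>f. rapid f \<and> h = (\<lambda>x. f (x + a))"], goal_cases)
  case 1 then show ?case using assms by blast
next
  case (2 h)
  then obtain f where fg: "rapid f" "h = (\<lambda>x. f (x + a))" by blast
  have "((\<lambda>x. f (x + a)) has_derivative (\<lambda>v. dird v f (x + a))) (at x)" for x
  proof -
    have "((\<lambda>x. x + a) has_derivative (\<lambda>v. v)) (at x)" by (auto intro!: derivative_eq_intros)
    from has_derivative_compose[OF this rapid_has_derivative[OF fg(1)]] show ?thesis .
  qed
  then show ?case
    unfolding fg using rapid_dird[OF fg(1)]
    by (intro exI[of _ "\<lambda>x v. dird v f (x + a)"]) blast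
next
  case (3 h k)
  then obtain f where fg: "rapid f" "h = (\<lambda>x. f (x + a))" by blast
  obtain C where C: "C > 0" "\<And>x. norm (f x) \<le> C * wt k x" using rapid_bound[OF fg(1)] by blast
  have "norm (f (x + a)) \<le> (C * (1 + norm a) ^ k) * wt k x" for x
  proof -
    have "wt k (x + a) \<le> (1 + norm a) ^ k * wt k x"
      using wt_shift[of k "x + a" "- a"] by simp
    then show ?thesis using order.trans[OF C(2)[of "x + a"] mult_left_mono[of "wt k (x+a)" "(1 + norm a) ^ k * wt k x" C]] C(1) by (simp add: mult_ac)
  qed
  then show ?case unfolding fg le_wt_iff by blast
qed


text \<open>Derivatives of a product \<open>f(x) g(y)\<close> are sums of such products, so the class used for
  \<open>rapidI\<close> consists of finite sums.\<close>

inductive tensors :: "('a::euclidean_space \<times> 'b::euclidean_space \<Rightarrow> complex) \<Rightarrow> bool" where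
  tens: "rapid f \<Longrightarrow> rapid g \<Longrightarrow> tensors (\<lambda>z. f (fst z) * g (snd z))"
| tens_add: "tensors h1 \<Longrightarrow> tensors h2 \<Longrightarrow> tensors (\<lambda>z. h1 z + h2 z)"

lemma tensors_step:
  assumes "tensors h"
  shows "\<exists>D. (\<forall>x. (h has_derivative D x) (at x)) \<and> (\<forall>b\<in>Basis. tensors (\<lambda>x. D x b))"
  using assms
proof induction
  case (tens f g)
  have "((\<lambda>z. f (fst z) * g (snd z)) has_derivative
      (\<lambda>v. f (fst z) * dird (snd v) g (snd z) + dird (fst v) f (fst z) * g (snd z))) (at z)" for z
    by (intro has_derivative_mult
        has_derivative_compose[OF _ rapid_has_derivative[OF tens(1)], where f = fst]
        has_derivative_compose[OF _ rapid_has_derivative[OF tens(2)], where f = snd])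
      (auto intro!: derivative_eq_intros)
  then show ?case
    by (intro exI[of _ "\<lambda>z v. f (fst z) * dird (snd v) g (snd z) + dird (fst v) f (fst z) * g (snd z)"])
      (auto intro!: tensors.intros rapid_dird tens)
next
  case (tens_add h1 h2)
  then obtain D1 D2 where "\<forall>x. (h1 has_derivative D1 x) (at x)" "\<forall>b\<in>Basis. tensors (\<lambda>x. D1 x b)"
    "\<forall>x. (h2 has_derivative D2 x) (at x)" "\<forall>b\<in>Basis. tensors (\<lambda>x. D2 x b)"
    by blast
  then show ?case
    by (intro exI[of _ "\<lambda>x v. D1 x v + D2 x v"]) (auto intro!: derivative_eq_intros tensors.intros)
qed

lemma rapid_tensor:
  fixes f :: "'a::euclidean_space \<Rightarrow> complex" and g :: "'b::euclidean_space \<Rightarrow> complex"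
  assumes "rapid f" "rapid g"
  shows "rapid (\<lambda>z. f (fst z) * g (snd z))"
proof (rule rapidI[where Q = tensors])
  show "\<exists>C. \<forall>x. (1 + norm x) ^ k * norm (h x) \<le> C" if "tensors h" for h :: "'a \<times> 'b \<Rightarrow> complex" and k
    using that
  proof induction
    case (tens f g)
    obtain C D where C: "C > 0" "\<And>x. norm (f x) \<le> C * wt k x" "D > 0" "\<And>x. norm (g x) \<le> D * wt k x"
      using rapid_bound[OF tens(1), of k] rapid_bound[OF tens(2), of k] by metis
    have "norm (f (fst x) * g (snd x)) \<le> (C * D) * wt k x" for x
    proof -
      have "norm (f (fst x) * g (snd x)) \<le> (C * wt k (fst x)) * (D * wt k (snd x))"
        unfolding norm_mult by (intro mult_mono C) (use C in \<open>auto intro: less_imp_le\<close>)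
      also have "\<dots> \<le> (C * D) * wt k x"
        using wt_prod_le[of k "fst x" "snd x"] C by (simp add: mult_ac mult_left_mono)
      finally show ?thesis .
    qed
    then show ?case unfolding le_wt_iff by blast
  next
    case (tens_add h1 h2)
    then obtain C D where "\<And>x. (1 + norm x) ^ k * norm (h1 x) \<le> C" "\<And>x. (1 + norm x) ^ k * norm (h2 x) \<le> D" by blast
    then have "norm (h1 x + h2 x) \<le> (C + D) * wt k x" for x
      unfolding le_wt_iff[symmetric] by (metis add_mono distrib_right norm_triangle_le)
    then show ?case unfolding le_wt_iff by blast
  qed
qed (use assms tensors_step in \<open>auto intro: tensors.intros\<close>)

lemma rapid_mult_linear:
  fixes f :: "'a::euclidean_space \<Rightarrow> complex" and l :: "'a \<Rightarrow> real"
  assumes "linear l" "rapid f"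
  shows "rapid (\<lambda>x. complex_of_real (l x) * f x)"
proof -
  have bl: "bounded_linear l" using assms(1) by (rule linear_conv_bounded_linear[THEN iffD1])
  obtain K where K: "K > 0" "\<And>x. norm (l x) \<le> norm x * K"
    using bounded_linear.pos_bounded[OF bl] by blast
  \<comment> \<open>Differentiating \<open>l f\<close> leaves a constant multiple of \<open>f\<close>, which the class takes up in \<open>g\<close>.\<close>
  show ?thesis
  proof (rule rapidI[where Q = "\<lambda>h. \<exists>f g. rapid f \<and> rapid g \<and> h = (\<lambda>x. complex_of_real (l x) * f x + g x)"], goal_cases)
    case 1 then show ?case using assms(2) rapid_zero by (metis (no_types, lifting) add.right_neutral)
  next
    case (2 h)
    then obtain f g where fg: "rapid f" "rapid g" "h = (\<lambda>x. complex_of_real (l x) * f x + g x)" by blast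
    have l: "((\<lambda>x. complex_of_real (l x)) has_derivative (\<lambda>v. complex_of_real (l v))) (at x)" for x
      by (intro has_derivative_of_real bounded_linear_imp_has_derivative bl)
    have "((\<lambda>x. complex_of_real (l x) * f x + g x) has_derivative
       (\<lambda>v. (complex_of_real (l x) * dird v f x + complex_of_real (l v) * f x) + dird v g x)) (at x)" for x
      by (intro has_derivative_add has_derivative_mult l rapid_has_derivative fg)
    then have d: "((\<lambda>x. complex_of_real (l x) * f x + g x) has_derivative
       (\<lambda>v. complex_of_real (l x) * dird v f x + (complex_of_real (l v) * f x + dird v g x))) (at x)" for x
      by (simp add: add.assoc)
    have "\<exists>f' g'. rapid f' \<and> rapid g' \<and> (\<lambda>x. complex_of_real (l x) * dird b f x + (complex_of_real (l b) * f x + dird b g x))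
        = (\<lambda>x. complex_of_real (l x) * f' x + g' x)" for b
      by (intro exI[of _ "dird b f"] exI[of _ "\<lambda>x. complex_of_real (l b) * f x + dird b g x"])
        (simp add: rapid_dird rapid_add rapid_cmult fg)
    with d show ?case
      unfolding fg(3)
      by (intro exI[of _ "\<lambda>x v. complex_of_real (l x) * dird v f x + (complex_of_real (l v) * f x + dird v g x)"]) simp
  next
    case (3 h k)
    then obtain f g where fg: "rapid f" "rapid g" "h = (\<lambda>x. complex_of_real (l x) * f x + g x)" by blast
    obtain C D where C: "C > 0" "\<And>x. norm (f x) \<le> C * wt (k + 1) x" "\<And>x. norm (g x) \<le> D * wt k x"
      using rapid_bound[OF fg(1), of "k + 1"] rapid_bound[OF fg(2), of k] by metis
    have "norm (h x) \<le> (K * C + D) * wt k x" for x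
    proof -
      have "norm (complex_of_real (l x) * f x) \<le> (norm x * K) * (C * wt (k + 1) x)"
        unfolding norm_mult using K C by (intro mult_mono) auto
      also have "\<dots> \<le> ((1 + norm x) * K) * (C * wt (k + 1) x)"
        using K C by (intro mult_right_mono) auto
      also have "\<dots> = K * C * wt k x" by (simp add: wt_def)
      finally show ?thesis unfolding fg using C(3)[of x] norm_triangle_ineq[of "complex_of_real (l x) * f x" "g x"]
        by (simp add: distrib_right)
    qed
    then show ?case unfolding le_wt_iff by blast
  qed
qed

text \<open>The phase \<open>q\<close> is quadratic: its derivative depends on the base point through the
  affine map \<open>x \<mapsto> \<beta> x v + \<gamma> v\<close>.\<close>

lemma rapid_mult_cis:
  fixes f :: "'a::euclidean_space \<Rightarrow> complex"
  assumes q: "\<And>x. (q has_derivative (\<lambda>v. \<beta> x v + \<gamma> v)) (at x)" and \<beta>: "\<And>v. linear (\<lambda>x. \<beta> x v)" and "rapid f"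
  shows "rapid (\<lambda>x. cis (q x) * f x)"
proof (rule rapidI[where Q = "\<lambda>h. \<exists>f. rapid f \<and> h = (\<lambda>x. cis (q x) * f x)"], goal_cases)
  case 1 then show ?case using assms(3) by blast
next
  case (2 h)
  then obtain f where fg: "rapid f" "h = (\<lambda>x. cis (q x) * f x)" by blast
  let ?D = "\<lambda>x v. dird v f x + \<i> * (complex_of_real (\<beta> x v) * f x + complex_of_real (\<gamma> v) * f x)"
  have d: "((\<lambda>x. cis (q x) * f x) has_derivative
     (\<lambda>v. cis (q x) * dird v f x + ((\<beta> x v + \<gamma> v) *\<^sub>R (\<i> * cis (q x))) * f x)) (at x)" for x
    by (intro has_derivative_mult rapid_has_derivative fg has_derivative_cis q)
  have d: "((\<lambda>x. cis (q x) * f x) has_derivative (\<lambda>v. cis (q x) * ?D x v)) (at x)" for x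
    by (rule has_derivative_eq_rhs[OF d]) (simp add: algebra_simps scaleR_conv_of_real)
  have "\<exists>f'. rapid f' \<and> (\<lambda>x. cis (q x) * ?D x b) = (\<lambda>x. cis (q x) * f' x)" for b
    by (intro exI[of _ "\<lambda>x. ?D x b"] conjI refl rapid_dird rapid_add rapid_cmult fg rapid_mult_linear \<beta>)
  with d show ?case
    unfolding fg(2) by (intro exI[of _ "\<lambda>x v. cis (q x) * ?D x v"]) simp
next
  case (3 h k)
  then obtain f where fg: "rapid f" "h = (\<lambda>x. cis (q x) * f x)" by blast
  obtain C where "\<And>x. norm (f x) \<le> C * wt k x" using rapid_bound[OF fg(1)] by blast
  then show ?case unfolding fg le_wt_iff by (auto simp: norm_mult)
qed

lemma rapid_mult:
  assumes "rapid f" "rapid g"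
  shows "rapid (\<lambda>x. f x * g x)"
proof -
  have "linear (\<lambda>x. (x, x))" by (auto simp: linear_iff)
  moreover have "inj (\<lambda>x. (x, x))" by (auto simp: inj_on_def)
  ultimately show ?thesis using rapid_linear_compose[OF _ _ rapid_tensor[OF assms], of "\<lambda>x. (x, x)"] by simp
qed

lemma rapid_slice_right:
  fixes H :: "'a::euclidean_space \<times> 'b::euclidean_space \<Rightarrow> complex"
  assumes "rapid H"
  shows "rapid (\<lambda>x. H (a, x))"
proof -
  have "linear (\<lambda>x. (0::'a, x))" "inj (\<lambda>x::'b. (0::'a, x))" by (auto simp: linear_iff inj_on_def)
  from rapid_linear_compose[OF this rapid_translate[OF assms, of "(a, 0)"]]
  show ?thesis by simp
qed

lemma rapid_slice_left:
  fixes H :: "'a::euclidean_space \<times> 'b::euclidean_space \<Rightarrow> complex"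
  assumes "rapid H"
  shows "rapid (\<lambda>x. H (x, b))"
proof -
  have "linear (\<lambda>x. (x, 0::'b))" "inj (\<lambda>x::'a. (x, 0::'b))" by (auto simp: linear_iff inj_on_def)
  from rapid_linear_compose[OF this rapid_translate[OF assms, of "(0, b)"]]
  show ?thesis by simp
qed

text \<open>Since \<open>1 + |x| \<le> 1 + \<Sum>\<^sub>b |x \<bullet> b|\<close>, each power of the weight costs one multiplication by a
  coordinate. For functions given by integrals this trades decay estimates for mere boundedness.\<close>

lemma bounded_coordinate_class:
  fixes f :: "'a::euclidean_space \<Rightarrow> complex"
  assumes "Q f"
    and mult: "\<And>f b. Q f \<Longrightarrow> b \<in> Basis \<Longrightarrow> Q (\<lambda>x. complex_of_real (x \<bullet> b) * f x)"
    and bd: "\<And>f. Q f \<Longrightarrow> \<exists>C. \<forall>x. norm (f x) \<le> C"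
  shows "\<exists>C. \<forall>x. (1 + norm x) ^ k * norm (f x) \<le> C"
  using assms(1)
proof (induction k arbitrary: f)
  case 0 then show ?case using bd by simp
next
  case (Suc k)
  obtain C0 where C0: "\<And>x. (1 + norm x) ^ k * norm (f x) \<le> C0" using Suc by blast
  have "\<exists>C. \<forall>x. (1 + norm x) ^ k * norm (complex_of_real (x \<bullet> b) * f x) \<le> C" if "b \<in> Basis" for b
    using Suc.IH[OF mult[OF Suc.prems that]] .
  then obtain C where C: "\<And>b x. b \<in> Basis \<Longrightarrow> (1 + norm x) ^ k * norm (complex_of_real (x \<bullet> b) * f x) \<le> C b" by metis
  have "(1 + norm x) ^ Suc k * norm (f x) \<le> C0 + (\<Sum>b\<in>Basis. C b)" for x
  proof -
    have "(1 + norm x) ^ Suc k * norm (f x) = (1 + norm x) ^ k * norm (f x) + norm x * ((1 + norm x) ^ k * norm (f x))"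
      by (simp add: algebra_simps)
    also have "norm x * ((1 + norm x) ^ k * norm (f x)) \<le> (\<Sum>b\<in>Basis. \<bar>x \<bullet> b\<bar>) * ((1 + norm x) ^ k * norm (f x))"
      by (intro mult_right_mono norm_le_l1) auto
    also have "\<dots> = (\<Sum>b\<in>Basis. (1 + norm x) ^ k * norm (complex_of_real (x \<bullet> b) * f x))"
      unfolding sum_distrib_right by (intro sum.cong refl) (simp add: norm_mult mult_ac)
    also have "\<dots> \<le> (\<Sum>b\<in>Basis. C b)" by (intro sum_mono C)
    finally show ?thesis using C0[of x] by linarith
  qed
  then show ?case by blast
qed

lemma rapidI_coordinates:
  fixes f :: "'a::euclidean_space \<Rightarrow> complex"
  assumes "Q f"
    and "\<And>f. Q f \<Longrightarrow> \<exists>D. (\<forall>x. (f has_derivative D x) (at x)) \<and> (\<forall>b\<in>Basis. Q (\<lambda>x. D x b))"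
    and "\<And>f b. Q f \<Longrightarrow> b \<in> Basis \<Longrightarrow> Q (\<lambda>x. complex_of_real (x \<bullet> b) * f x)"
    and "\<And>f. Q f \<Longrightarrow> \<exists>C. \<forall>x. norm (f x) \<le> C"
  shows "rapid f"
proof (rule rapidI[of Q, OF assms(1,2)])
  fix f :: "'a \<Rightarrow> complex" and k assume "Q f"
  then show "\<exists>C. \<forall>x. (1 + norm x) ^ k * norm (f x) \<le> C"
    by (rule bounded_coordinate_class[of Q, OF _ assms(3,4)])
qed

section \<open>Integrals of rapidly decreasing functions\<close>

lemma nn_integral_inverse_square_finite: "(\<integral>\<^sup>+x. ennreal (inverse (1 + x\<^sup>2)) \<partial>lborel) < \<infinity>"
proof -
  have half: "(\<integral>\<^sup>+x. ennreal (inverse (1 + x\<^sup>2)) * indicator {0..} x \<partial>lborel) = ennreal (pi / 2 - arctan 0)"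
    by (rule nn_integral_FTC_atLeast[where F = arctan])
      (auto intro!: DERIV_arctan tendsto_arctan_at_top)
  have "(\<integral>\<^sup>+x. ennreal (inverse (1 + x\<^sup>2)) * indicator {..0} x \<partial>lborel) =
     (\<integral>\<^sup>+x. ennreal (inverse (1 + x\<^sup>2)) * indicator {..0} x \<partial>distr lborel borel uminus)"
    by (simp add: lborel_distr_uminus)
  also have "\<dots> = (\<integral>\<^sup>+x. ennreal (inverse (1 + x\<^sup>2)) * indicator {0..} x \<partial>lborel)"
    by (subst nn_integral_distr) (auto intro!: nn_integral_cong split: split_indicator)
  finally have other: "(\<integral>\<^sup>+x. ennreal (inverse (1 + x\<^sup>2)) * indicator {..0} x \<partial>lborel) = ennreal (pi / 2 - arctan 0)"
    using half by simp
  have "(\<integral>\<^sup>+x. ennreal (inverse (1 + x\<^sup>2)) \<partial>lborel) \<le>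
    (\<integral>\<^sup>+x. ennreal (inverse (1 + x\<^sup>2)) * indicator {0..} x + ennreal (inverse (1 + x\<^sup>2)) * indicator {..0} x \<partial>lborel)"
    by (intro nn_integral_mono) (auto split: split_indicator)
  also have "\<dots> = ennreal (pi / 2 - arctan 0) + ennreal (pi / 2 - arctan 0)"
    by (subst nn_integral_add) (auto simp: half other)
  also have "\<dots> < \<infinity>" by (simp add: less_top[symmetric])
  finally show ?thesis .
qed

text \<open>As \<open>1 + (x \<bullet> b)\<^sup>2 \<le> (1 + |x|)\<^sup>2\<close> for every coordinate, the weight is dominated by a product of
  one-dimensional integrable functions.\<close>

lemma integrable_wt:
  assumes "2 * DIM('a) \<le> k"
  shows "integrable lborel (wt k :: 'a::euclidean_space \<Rightarrow> real)"
proof (rule integrableI_bounded)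
  have le: "wt k x \<le> (\<Prod>b\<in>Basis. inverse (1 + (x \<bullet> b)\<^sup>2))" for x :: 'a
  proof -
    have "(\<Prod>b\<in>(Basis::'a set). 1 + (x \<bullet> b)\<^sup>2) \<le> (\<Prod>b\<in>(Basis::'a set). (1 + norm x)\<^sup>2)"
    proof (intro prod_mono conjI)
      fix b :: 'a assume b: "b \<in> Basis"
      have "(x \<bullet> b)\<^sup>2 \<le> (norm x)\<^sup>2" using Basis_le_norm[OF b, of x] by (simp add: abs_le_square_iff[symmetric])
      then show "1 + (x \<bullet> b)\<^sup>2 \<le> (1 + norm x)\<^sup>2" using norm_ge_zero[of x] unfolding power2_sum power_one mult_1_right by linarith
    qed auto
    also have "\<dots> = (1 + norm x) ^ (2 * DIM('a))" by (simp add: power_mult)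
    finally have "inverse ((1 + norm x) ^ (2 * DIM('a))) \<le> inverse (\<Prod>b\<in>(Basis::'a set). 1 + (x \<bullet> b)\<^sup>2)"
      by (rule le_imp_inverse_le) (auto intro!: prod_pos add_pos_nonneg)
    moreover have "wt k x \<le> inverse ((1 + norm x) ^ (2 * DIM('a)))"
      using wt_antimono[OF assms, of x] by (simp add: wt_def)
    ultimately show ?thesis by (simp add: prod_inversef[unfolded o_def])
  qed
  have "(\<integral>\<^sup>+x. ennreal (norm (wt k (x::'a))) \<partial>lborel) \<le> (\<integral>\<^sup>+x. (\<Prod>b\<in>Basis. ennreal (inverse (1 + ((x::'a) \<bullet> b)\<^sup>2))) \<partial>lborel)"
    by (intro nn_integral_mono) (auto simp: prod_ennreal intro!: ennreal_leI le)
  also have "\<dots> = (\<Prod>b\<in>(Basis::'a set). (\<integral>\<^sup>+x. ennreal (inverse (1 + x\<^sup>2)) \<partial>lborel))"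
    by (rule nn_integral_lborel_prod) auto
  also have "\<dots> < \<infinity>"
    using nn_integral_inverse_square_finite by (simp add: ennreal_prod_eq_top less_top[symmetric] power_eq_top_ennreal)
  finally show "(\<integral>\<^sup>+x. ennreal (norm (wt k (x::'a))) \<partial>lborel) < \<infinity>" .
qed simp

lemma integrable_wt_bound:
  fixes f :: "'a::euclidean_space \<Rightarrow> 'b::{banach, second_countable_topology}"
  assumes "f \<in> borel_measurable lborel" "2 * DIM('a) \<le> k" "\<And>x. norm (f x) \<le> C * wt k x"
  shows "integrable lborel f"
proof (rule Bochner_Integration.integrable_bound[OF integrable_mult_right[OF integrable_wt[OF assms(2)], of C] assms(1)])
  show "AE x in lborel. norm (f x) \<le> norm (C * wt k x)"
    using order.trans[OF assms(3) abs_ge_self] by simp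
qed

lemma rapid_integrable:
  fixes f :: "'a::euclidean_space \<Rightarrow> complex"
  assumes "rapid f"
  shows "integrable lborel f"
proof -
  obtain C where "\<And>x. norm (f x) \<le> C * wt (2 * DIM('a)) x" using rapid_bound[OF assms] by blast
  then show ?thesis using rapid_borel[OF assms] by (intro integrable_wt_bound[of f "2 * DIM('a)"]) auto
qed

lemma norm_integral_le:
  fixes f :: "'a \<Rightarrow> 'b::{banach, second_countable_topology}"
  assumes "integrable M g" "\<And>x. norm (f x) \<le> g x"
  shows "norm (\<integral>x. f x \<partial>M) \<le> (\<integral>x. g x \<partial>M)"
proof -
  have "norm (\<integral>x. f x \<partial>M) \<le> (\<integral>x. norm (f x) \<partial>M)" by (rule integral_norm_bound)
  also have "\<dots> \<le> (\<integral>x. g x \<partial>M)"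
    using assms order.trans[OF norm_ge_zero assms(2)] by (intro integral_mono') auto
  finally show ?thesis .
qed

lemma lborel_integral_shift:
  fixes f :: "'a::euclidean_space \<Rightarrow> 'b::{banach, second_countable_topology}"
  assumes [measurable]: "f \<in> borel_measurable borel"
  shows "(\<integral>x. f (x + a) \<partial>lborel) = (\<integral>x. f x \<partial>lborel)"
proof -
  have "(\<integral>x. f x \<partial>lborel) = (\<integral>x. f x \<partial>distr lborel borel ((+) a))" by (simp add: lborel_distr_plus)
  also have "\<dots> = (\<integral>x. f (a + x) \<partial>lborel)" by (rule integral_distr) auto
  finally show ?thesis by (simp add: add.commute)
qed

lemma lborel_integral_scale:
  fixes f :: "'a::euclidean_space \<Rightarrow> 'b::{banach, second_countable_topology}"
  assumes [measurable]: "f \<in> borel_measurable borel" and "c \<noteq> 0"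
  shows "(\<integral>x. f x \<partial>lborel) = \<bar>c\<bar> ^ DIM('a) *\<^sub>R (\<integral>x. f (c *\<^sub>R x) \<partial>lborel)"
proof -
  have "(\<integral>x. f x \<partial>lborel) = (\<integral>x. f x \<partial>density (distr lborel borel (\<lambda>x. 0 + c *\<^sub>R x)) (\<lambda>_. \<bar>c\<bar> ^ DIM('a)))"
    using lborel_affine[OF assms(2), of "0::'a"] by simp
  also have "\<dots> = \<bar>c\<bar> ^ DIM('a) *\<^sub>R (\<integral>x. f (c *\<^sub>R x) \<partial>lborel)"
    by (subst integral_density, simp, simp, simp, subst integral_distr) auto
  finally show ?thesis .
qed

lemma lborel_integral_reflect:
  fixes f :: "'a::euclidean_space \<Rightarrow> 'b::{banach, second_countable_topology}"
  assumes [measurable]: "f \<in> borel_measurable borel"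
  shows "(\<integral>x. f (a - x) \<partial>lborel) = (\<integral>x. f x \<partial>lborel)"
proof -
  have "(\<integral>x. f x \<partial>lborel) = (\<integral>x. f (x + a) \<partial>lborel)" by (simp add: lborel_integral_shift)
  also have "\<dots> = (\<integral>x. f (a - x) \<partial>lborel)"
    using lborel_integral_scale[of "\<lambda>x. f (x + a)" "-1"] by simp
  finally show ?thesis ..
qed

text \<open>The set where a continuous function does not vanish is open, hence empty if it is null.\<close>

lemma rapid_AE_zero:
  assumes "rapid f" "AE x in lborel. f x = 0"
  shows "f x = 0"
proof (rule ccontr)
  assume "f x \<noteq> 0"
  let ?U = "{x. f x \<noteq> 0}"
  have "open ?U" by (intro open_Collect_neq rapid_continuous_on assms continuous_on_const)
  moreover have "?U \<noteq> {}" using \<open>f x \<noteq> 0\<close> by auto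
  ultimately have "\<not> negligible ?U" by (rule open_not_negligible)
  moreover have "?U \<in> null_sets lborel"
    using assms(2) \<open>open ?U\<close> by (subst (asm) AE_iff_null) (auto simp: borel_open)
  ultimately show False using negligible_iff_null_sets null_sets_completionI by blast
qed

text \<open>Differentiation under the integral sign, by dominated convergence of difference quotients.\<close>

lemma has_derivative_integral:
  fixes \<Phi> :: "'c::euclidean_space \<Rightarrow> 'y \<Rightarrow> complex"
  assumes r: "r > 0"
    and der: "\<And>y u. u \<in> ball u0 r \<Longrightarrow> ((\<lambda>u. \<Phi> u y) has_derivative D u y) (at u)"
    and bnd: "\<And>y u v. u \<in> ball u0 r \<Longrightarrow> norm (D u y v) \<le> b y * norm v"
    and b: "integrable M b"
    and int: "\<And>u. u \<in> ball u0 r \<Longrightarrow> integrable M (\<Phi> u)"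
    and measD: "\<And>v. (\<lambda>y. D u0 y v) \<in> borel_measurable M"
  shows "((\<lambda>u. \<integral>y. \<Phi> u y \<partial>M) has_derivative (\<lambda>v. \<integral>y. D u0 y v \<partial>M)) (at u0)"
proof -
  have u0: "u0 \<in> ball u0 r" using r by simp
  have linD: "bounded_linear (D u0 y)" for y using der[OF u0] by (rule has_derivative_bounded_linear)
  have intD: "integrable M (\<lambda>y. D u0 y v)" for v
    by (rule Bochner_Integration.integrable_bound[OF integrable_mult_left[OF b, of "norm v"] measD])
      (use order.trans[OF bnd[OF u0] abs_ge_self] in simp)
  have bl: "bounded_linear (\<lambda>v. \<integral>y. D u0 y v \<partial>M)"
  proof (rule bounded_linear_intro[where K = "\<integral>y. b y \<partial>M"])
    fix v w c
    show "(\<integral>y. D u0 y (v + w) \<partial>M) = (\<integral>y. D u0 y v \<partial>M) + (\<integral>y. D u0 y w \<partial>M)"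
      by (simp add: bounded_linear.linear[OF linD] linear_add intD)
    show "(\<integral>y. D u0 y (c *\<^sub>R v) \<partial>M) = c *\<^sub>R (\<integral>y. D u0 y v \<partial>M)"
      by (simp add: bounded_linear.linear[OF linD] linear_scale intD)
    have "norm (\<integral>y. D u0 y v \<partial>M) \<le> (\<integral>y. norm (D u0 y v) \<partial>M)" by (rule integral_norm_bound)
    also have "\<dots> \<le> (\<integral>y. b y * norm v \<partial>M)"
      by (intro integral_mono integrable_norm intD integrable_mult_left b bnd u0)
    finally show "norm (\<integral>y. D u0 y v \<partial>M) \<le> norm v * (\<integral>y. b y \<partial>M)" by (simp add: mult.commute)
  qed
  have lip: "norm (\<Phi> u y - \<Phi> u0 y) \<le> b y * norm (u - u0)" if "u \<in> ball u0 r" for u y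
  proof (rule differentiable_bound[OF convex_ball _ _ that u0])
    show "((\<lambda>u. \<Phi> u y) has_derivative D x y) (at x within ball u0 r)" if "x \<in> ball u0 r" for x
      by (rule has_derivative_at_withinI[OF der[OF that]])
    show "onorm (D x y) \<le> b y" if "x \<in> ball u0 r" for x
      by (rule onorm_le) (rule bnd[OF that])
  qed
  show ?thesis
    unfolding has_derivative_iff_norm
  proof (intro conjI bl, unfold tendsto_at_iff_sequentially, intro allI impI)
    fix X assume X: "\<forall>i. X i \<in> UNIV - {u0}" "X \<longlonglongrightarrow> u0"
    then obtain N where N: "\<And>i. i \<ge> N \<Longrightarrow> X i \<in> ball u0 r"
      using r u0 by (metis LIMSEQ_iff_nz dist_commute lim_sequentially mem_ball)
    define Y where "Y i = X (i + N)" for i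
    have Y: "Y i \<in> ball u0 r" "Y i \<noteq> u0" for i using N X(1) by (auto simp: Y_def)
    have Ylim: "Y \<longlonglongrightarrow> u0" unfolding Y_def by (rule LIMSEQ_ignore_initial_segment[OF X(2)])
    let ?s = "\<lambda>i y. (\<Phi> (Y i) y - \<Phi> u0 y - D u0 y (Y i - u0)) /\<^sub>R norm (Y i - u0)"
    have lim: "(\<lambda>i. \<integral>y. ?s i y \<partial>M) \<longlonglongrightarrow> (\<integral>y. 0 \<partial>M)"
    proof (rule integral_dominated_convergence[where w = "\<lambda>y. 2 * b y"])
      show "(\<lambda>y. ?s i y) \<in> borel_measurable M" for i
        using int[OF Y(1)] int[OF u0] measD by measurable
      show "AE y in M. (\<lambda>i. ?s i y) \<longlonglongrightarrow> 0"
      proof (intro AE_I2)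
        fix y
        have "((\<lambda>u. norm ((\<Phi> u y - \<Phi> u0 y) - D u0 y (u - u0)) / norm (u - u0)) \<longlongrightarrow> 0) (at u0)"
          using der[OF u0, of y] unfolding has_derivative_iff_norm by simp
        then have "(\<lambda>i. norm (?s i y)) \<longlonglongrightarrow> 0"
          unfolding tendsto_at_iff_sequentially using Y(2) Ylim by (auto simp: o_def divide_inverse mult.commute)
        then show "(\<lambda>i. ?s i y) \<longlonglongrightarrow> 0" by (rule tendsto_norm_zero_cancel)
      qed
      show "AE y in M. norm (?s i y) \<le> 2 * b y" for i
      proof (intro AE_I2)
        fix y
        have "norm (\<Phi> (Y i) y - \<Phi> u0 y - D u0 y (Y i - u0)) \<le> b y * norm (Y i - u0) + b y * norm (Y i - u0)"
          using lip[OF Y(1), of i y] bnd[OF u0, of y "Y i - u0"]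
          by (meson add_mono norm_triangle_ineq4 order_trans)
        then show "norm (?s i y) \<le> 2 * b y" using Y(2)[of i]
            by (simp only: norm_scaleR abs_inverse abs_norm_cancel) (simp add: field_simps)
      qed
    qed (use b in auto)
    have eq: "norm (\<integral>y. ?s i y \<partial>M) = norm (((\<integral>y. \<Phi> (Y i) y \<partial>M) - (\<integral>y. \<Phi> u0 y \<partial>M)) - (\<integral>y. D u0 y (Y i - u0) \<partial>M)) / norm (Y i - u0)" for i
      by (simp add: int[OF Y(1)] int[OF u0] intD divide_inverse mult.commute)
    have "(\<lambda>i. norm (((\<integral>y. \<Phi> (Y i) y \<partial>M) - (\<integral>y. \<Phi> u0 y \<partial>M)) - (\<integral>y. D u0 y (Y i - u0) \<partial>M)) / norm (Y i - u0)) \<longlonglongrightarrow> 0"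
      unfolding eq[symmetric] using tendsto_norm_zero[OF lim[unfolded integral_zero]] .
    note d = this[unfolded Y_def]
    show "((\<lambda>u. norm (((\<integral>y. \<Phi> u y \<partial>M) - (\<integral>y. \<Phi> u0 y \<partial>M)) - (\<integral>y. D u0 y (u - u0) \<partial>M)) / norm (u - u0)) \<circ> X) \<longlonglongrightarrow> 0"
      unfolding o_def by (rule LIMSEQ_offset[where k = N]) (rule d)
  qed
qed

lemma rapid_integral_has_derivative:
  fixes H :: "'a::euclidean_space \<times> 'b::euclidean_space \<Rightarrow> complex"
  assumes H: "rapid H"
  shows "((\<lambda>u. \<integral>a. H (a, u) \<partial>lborel) has_derivative (\<lambda>v. \<integral>a. dird (0, v) H (a, u) \<partial>lborel)) (at u)"
proof -
  let ?k = "2 * DIM('a)"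
  obtain C where C: "C > 0" "\<And>x v. norm (dird v H x) \<le> C * wt ?k x * norm v"
    using rapid_dird_bound[OF H] by blast
  show ?thesis
  proof (rule has_derivative_integral[where r = 1 and b = "\<lambda>a. C * wt ?k a"])
    fix a :: 'a and u :: 'b
    have "((\<lambda>u. (a, u)) has_derivative (\<lambda>v. (0, v))) (at u)" by (auto intro!: derivative_eq_intros)
    from has_derivative_compose[OF this rapid_has_derivative[OF H]]
    show "((\<lambda>u. H (a, u)) has_derivative (\<lambda>v. dird (0, v) H (a, u))) (at u)" .
  next
    fix a :: 'a and u v :: 'b
    have "C * wt ?k (a, u) * norm v \<le> C * wt ?k a * norm v"
      using C(1) by (intro mult_mono wt_Pair_le) auto
    then show "norm (dird (0, v) H (a, u)) \<le> C * wt ?k a * norm v"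
      using C(2)[of "(0, v)" "(a, u)"] by (simp add: norm_Pair)
  next
    show "integrable lborel (\<lambda>a::'a. C * wt ?k a)" by (intro integrable_mult_right integrable_wt) simp
    show "integrable lborel (\<lambda>a. H (a, u))" for u
      by (rule rapid_integrable[OF rapid_slice_left[OF H]])
    show "(\<lambda>a. dird (0, v) H (a, u)) \<in> borel_measurable lborel" for v
      using rapid_borel[OF rapid_slice_left[OF rapid_dird[OF H]]] by simp
  qed simp
qed

lemma rapid_integral:
  fixes H :: "'a::euclidean_space \<times> 'b::euclidean_space \<Rightarrow> complex"
  assumes "rapid H"
  shows "rapid (\<lambda>u. \<integral>a. H (a, u) \<partial>lborel)"
proof (rule rapidI_coordinates[where Q = "\<lambda>f. \<exists>H::'a \<times> 'b \<Rightarrow> complex. rapid H \<and> f = (\<lambda>u. \<integral>a. H (a, u) \<partial>lborel)"], goal_cases)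
  case 1 then show ?case using assms by blast
next
  case (2 f)
  then obtain H :: "'a \<times> 'b \<Rightarrow> complex" where H: "rapid H" "f = (\<lambda>u. \<integral>a. H (a, u) \<partial>lborel)" by blast
  have "\<exists>G::'a \<times> 'b \<Rightarrow> complex. rapid G \<and> (\<lambda>u. \<integral>a. dird (0, b) H (a, u) \<partial>lborel) = (\<lambda>u. \<integral>a. G (a, u) \<partial>lborel)" for b
    using rapid_dird[OF H(1)] by blast
  with rapid_integral_has_derivative[OF H(1)] show ?case
    unfolding H(2) by (intro exI[of _ "\<lambda>u v. \<integral>a. dird (0, v) H (a, u) \<partial>lborel"]) simp
next
  case (3 f b)
  then obtain H :: "'a \<times> 'b \<Rightarrow> complex" where H: "rapid H" "f = (\<lambda>u. \<integral>a. H (a, u) \<partial>lborel)" by blast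
  have "linear (\<lambda>z::'a \<times> 'b. snd z \<bullet> b)" by (auto simp: linear_iff inner_left_distrib)
  from rapid_mult_linear[OF this H(1)] show ?case
    unfolding H(2) by (intro exI[of _ "\<lambda>z. complex_of_real (snd z \<bullet> b) * H z"]) simp
next
  case (4 f)
  then obtain H :: "'a \<times> 'b \<Rightarrow> complex" where H: "rapid H" "f = (\<lambda>u. \<integral>a. H (a, u) \<partial>lborel)" by blast
  let ?k = "2 * DIM('a)"
  obtain C where C: "C > 0" "\<And>x. norm (H x) \<le> C * wt ?k x" using rapid_bound[OF H(1)] by blast
  have "norm (f u) \<le> (\<integral>a. C * wt ?k (a::'a) \<partial>lborel)" for u
    unfolding H(2)
  proof (rule norm_integral_le)
    show "integrable lborel (\<lambda>a::'a. C * wt ?k a)" by (intro integrable_mult_right integrable_wt) simp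
    show "norm (H (a, u)) \<le> C * wt ?k a" for a
      using order.trans[OF C(2)[of "(a, u)"] mult_left_mono[OF wt_Pair_le(1)]] C(1) by simp
  qed
  then show ?case by blast
qed

lemma iter_deriv_integral:
  fixes H :: "'a::euclidean_space \<times> 'b::euclidean_space \<Rightarrow> complex"
  assumes "rapid H" "vs \<in> lists Basis"
  shows "iter_deriv vs (\<lambda>u. \<integral>a. H (a, u) \<partial>lborel) = (\<lambda>u. \<integral>a. iter_deriv (map (Pair 0) vs) H (a, u) \<partial>lborel)"
  using assms(2)
proof (induction vs)
  case (Cons v vs)
  have r: "rapid (iter_deriv (map (Pair 0) vs) H)"
    by (rule rapid_iter_deriv[OF assms(1)]) (use Cons in \<open>auto simp: Basis_prod_def\<close>)
  show ?case
  proof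
    fix u
    have "iter_deriv (v # vs) (\<lambda>u. \<integral>a. H (a, u) \<partial>lborel) u
      = dird v (\<lambda>u. \<integral>a. iter_deriv (map (Pair 0) vs) H (a, u) \<partial>lborel) u"
      using Cons by (simp add: dird_def)
    also have "\<dots> = (\<integral>a. dird (0, v) (iter_deriv (map (Pair 0) vs) H) (a, u) \<partial>lborel)"
      by (rule dird_eq[OF rapid_integral_has_derivative[OF r]])
    finally show "iter_deriv (v # vs) (\<lambda>u. \<integral>a. H (a, u) \<partial>lborel) u = (\<integral>a. iter_deriv (map (Pair 0) (v # vs)) H (a, u) \<partial>lborel)"
      by (simp add: dird_def)
  qed
qed simp

lemma iter_deriv_slice:
  fixes H :: "'a::euclidean_space \<times> 'b::euclidean_space \<Rightarrow> complex"
  assumes "rapid H" "vs \<in> lists Basis"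
  shows "iter_deriv vs (\<lambda>u. H (a, u)) = (\<lambda>u. iter_deriv (map (Pair 0) vs) H (a, u))"
  using assms(2)
proof (induction vs)
  case (Cons v vs)
  have r: "rapid (iter_deriv (map (Pair 0) vs) H)"
    by (rule rapid_iter_deriv[OF assms(1)]) (use Cons in \<open>auto simp: Basis_prod_def\<close>)
  show ?case
  proof
    fix u :: 'b
    have "((\<lambda>u. (a, u)) has_derivative (\<lambda>v. (0, v))) (at u)" by (auto intro!: derivative_eq_intros)
    from has_derivative_compose[OF this rapid_has_derivative[OF r]]
    have "((\<lambda>u. iter_deriv (map (Pair 0) vs) H (a, u)) has_derivative (\<lambda>v. dird (0, v) (iter_deriv (map (Pair 0) vs) H) (a, u))) (at u)" .
    from dird_eq[OF this, of v] Cons show "iter_deriv (v # vs) (\<lambda>u. H (a, u)) u = iter_deriv (map (Pair 0) (v # vs)) H (a, u)"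
      by (simp add: dird_def)
  qed
qed simp

text \<open>Integration by parts without boundary terms: by translation invariance
  \<open>\<integral> f(x + t v) dx\<close> is constant in \<open>t\<close>, and its derivative at \<open>0\<close> is the integral of \<open>\<partial>\<^sub>v f\<close>.\<close>

lemma integral_dird_zero:
  fixes f :: "'a::euclidean_space \<Rightarrow> complex"
  assumes f: "rapid f"
  shows "(\<integral>x. dird v f x \<partial>lborel) = 0"
proof -
  let ?k = "2 * DIM('a)"
  obtain C where C: "C > 0" "\<And>x v. norm (dird v f x) \<le> C * wt ?k x * norm v"
    using rapid_dird_bound[OF f] by blast
  have "((\<lambda>t. \<integral>x. f (x + t *\<^sub>R v) \<partial>lborel) has_derivative (\<lambda>s. \<integral>x. dird (s *\<^sub>R v) f (x + 0 *\<^sub>R v) \<partial>lborel)) (at 0)"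
  proof (rule has_derivative_integral[where r = 1 and b = "\<lambda>x. (C * (1 + norm v) ^ ?k * norm v) * wt ?k x"])
    fix t :: real and x :: 'a
    have "((\<lambda>t. x + t *\<^sub>R v) has_derivative (\<lambda>s. s *\<^sub>R v)) (at t)" by (auto intro!: derivative_eq_intros)
    from has_derivative_compose[OF this rapid_has_derivative[OF f]]
    show "((\<lambda>t. f (x + t *\<^sub>R v)) has_derivative (\<lambda>s. dird (s *\<^sub>R v) f (x + t *\<^sub>R v))) (at t)" .
  next
    fix t s :: real and x :: 'a assume "t \<in> ball 0 1"
    have "norm (t *\<^sub>R v) \<le> norm v"
      using \<open>t \<in> ball 0 1\<close> mult_right_mono[of "\<bar>t\<bar>" 1 "norm v"] by simp
    then have "(1 + norm (t *\<^sub>R v)) ^ ?k \<le> (1 + norm v) ^ ?k" by (intro power_mono) auto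
    moreover have "wt ?k (x + t *\<^sub>R v) \<le> (1 + norm (t *\<^sub>R v)) ^ ?k * wt ?k x"
      using wt_shift[of ?k "x + t *\<^sub>R v" "- (t *\<^sub>R v)"] by simp
    ultimately have "wt ?k (x + t *\<^sub>R v) \<le> (1 + norm v) ^ ?k * wt ?k x"
      by (meson mult_right_mono order_trans wt_pos(2))
    then have "C * wt ?k (x + t *\<^sub>R v) * norm (s *\<^sub>R v) \<le> C * ((1 + norm v) ^ ?k * wt ?k x) * norm (s *\<^sub>R v)"
      using C(1) by (intro mult_right_mono mult_left_mono) auto
    then show "norm (dird (s *\<^sub>R v) f (x + t *\<^sub>R v)) \<le> (C * (1 + norm v) ^ ?k * norm v) * wt ?k x * norm s"
      using C(2)[of "s *\<^sub>R v" "x + t *\<^sub>R v"] by (simp add: mult_ac)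
  next
    show "integrable lborel (\<lambda>x::'a. (C * (1 + norm v) ^ ?k * norm v) * wt ?k x)"
      by (intro integrable_mult_right integrable_wt) simp
    show "integrable lborel (\<lambda>x. f (x + t *\<^sub>R v))" for t
      by (rule rapid_integrable[OF rapid_translate[OF f]])
    show "(\<lambda>x. dird (s *\<^sub>R v) f (x + 0 *\<^sub>R v)) \<in> borel_measurable lborel" for s
      using rapid_borel[OF rapid_dird[OF f]] by simp
  qed simp
  moreover have "(\<lambda>t. \<integral>x. f (x + t *\<^sub>R v) \<partial>lborel) = (\<lambda>t. \<integral>x. f x \<partial>lborel)"
    by (intro ext lborel_integral_shift rapid_borel f)
  ultimately have "((\<lambda>t::real. \<integral>x. f x \<partial>lborel) has_derivative (\<lambda>s. \<integral>x. dird (s *\<^sub>R v) f x \<partial>lborel)) (at 0)" by simp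
  from has_derivative_unique[OF this has_derivative_const] have "(\<integral>x. dird (1 *\<^sub>R v) f x \<partial>lborel) = 0"
    by metis
  then show ?thesis by simp
qed

section \<open>Fourier transform\<close>

definition fourier :: "('a::euclidean_space \<Rightarrow> complex) \<Rightarrow> 'a \<Rightarrow> complex" where
  "fourier h \<xi> = (\<integral>y. cis (- (y \<bullet> \<xi>)) * h y \<partial>lborel)"

text \<open>The first variable of \<open>h\<close> is transformed, the second one is a parameter. The result takes the
  parameter first, which is the order (position, frequency) of phase space.\<close>

definition partial_fourier :: "('a::euclidean_space \<times> 'b::euclidean_space \<Rightarrow> complex) \<Rightarrow> 'b \<times> 'a \<Rightarrow> complex" where
  "partial_fourier h z = (\<integral>y. cis (- (y \<bullet> snd z)) * h (y, fst z) \<partial>lborel)"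

lemma borel_measurable_cis [measurable (raw)]:
  "f \<in> borel_measurable M \<Longrightarrow> (\<lambda>x. cis (f x)) \<in> borel_measurable M"
  using borel_measurable_continuous_onI[OF continuous_on_cis[OF continuous_on_id]]
  by (rule measurable_compose[rotated])

lemma borel_measurable_cnj [measurable (raw)]:
  "f \<in> borel_measurable M \<Longrightarrow> (\<lambda>x. cnj (f x)) \<in> borel_measurable M"
  by (rule measurable_compose[OF _ borel_measurable_continuous_onI[OF continuous_on_cnj[OF continuous_on_id]]])

lemma norm_wt_Suc: "norm y * wt (Suc k) y \<le> wt k y"
  by (simp add: wt_def divide_simps)

lemma partial_fourier_integrable:
  fixes h :: "'a::euclidean_space \<times> 'b::euclidean_space \<Rightarrow> complex"
  assumes "rapid h"
  shows "integrable lborel (\<lambda>y. cis (- (y \<bullet> \<xi>)) * h (y, p))"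
proof (rule Bochner_Integration.integrable_bound[OF rapid_integrable[OF rapid_slice_left[OF assms, of p]]])
  show "(\<lambda>y. cis (- (y \<bullet> \<xi>)) * h (y, p)) \<in> borel_measurable lborel"
    using rapid_borel[OF rapid_slice_left[OF assms, of p]] by measurable
qed (simp add: norm_mult)

lemma partial_fourier_has_derivative:
  fixes h :: "'a::euclidean_space \<times> 'b::euclidean_space \<Rightarrow> complex"
  assumes h: "rapid h"
  shows "(partial_fourier h has_derivative
     (\<lambda>w. partial_fourier (\<lambda>u. dird (0, fst w) h u - \<i> * (complex_of_real (fst u \<bullet> snd w) * h u)) z)) (at z)"
proof -
  let ?k = "2 * DIM('a)"
  obtain C where C: "C > 0" "\<And>x v. norm (dird v h x) \<le> C * wt ?k x * norm v"
    using rapid_dird_bound[OF h] by blast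
  obtain C' where C': "C' > 0" "\<And>x. norm (h x) \<le> C' * wt (Suc ?k) x" using rapid_bound[OF h] by blast
  have bm: "(\<lambda>y. h (y, p)) \<in> borel_measurable borel" "(\<lambda>y. dird v h (y, p)) \<in> borel_measurable borel" for p v
    by (rule rapid_borel[OF rapid_slice_left[OF h]], rule rapid_borel[OF rapid_slice_left[OF rapid_dird[OF h]]])
  have "((\<lambda>z. \<integral>y. cis (- (y \<bullet> snd z)) * h (y, fst z) \<partial>lborel) has_derivative
     (\<lambda>w. \<integral>y. cis (- (y \<bullet> snd z)) * (dird (0, fst w) h (y, fst z) - \<i> * (complex_of_real (y \<bullet> snd w) * h (y, fst z))) \<partial>lborel)) (at z)"
  proof (rule has_derivative_integral[where r = 1 and b = "\<lambda>y. (C + C') * wt ?k y"])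
    fix y :: 'a and z :: "'b \<times> 'a"
    have 1: "((\<lambda>z. cis (- (y \<bullet> snd z))) has_derivative (\<lambda>w. (- (y \<bullet> snd w)) *\<^sub>R (\<i> * cis (- (y \<bullet> snd z))))) (at z)"
      by (rule has_derivative_cis) (auto intro!: derivative_eq_intros)
    have "((\<lambda>z::'b \<times> 'a. (y, fst z)) has_derivative (\<lambda>w. (0, fst w))) (at z)" by (auto intro!: derivative_eq_intros)
    from has_derivative_compose[OF this rapid_has_derivative[OF h]]
    have 2: "((\<lambda>z. h (y, fst z)) has_derivative (\<lambda>w. dird (0, fst w) h (y, fst z))) (at z)" .
    show "((\<lambda>z. cis (- (y \<bullet> snd z)) * h (y, fst z)) has_derivative
      (\<lambda>w. cis (- (y \<bullet> snd z)) * (dird (0, fst w) h (y, fst z) - \<i> * (complex_of_real (y \<bullet> snd w) * h (y, fst z))))) (at z)"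
      by (rule has_derivative_eq_rhs[OF has_derivative_mult[OF 1 2]]) (simp add: algebra_simps scaleR_conv_of_real)
  next
    fix y :: 'a and z w :: "'b \<times> 'a"
    have f: "norm (fst w) \<le> norm w" "norm (snd w) \<le> norm w" by (metis norm_fst_le norm_snd_le surjective_pairing)+
    have "norm (dird (0, fst w) h (y, fst z)) \<le> C * wt ?k (y, fst z) * norm (0::'a, fst w)" by (rule C)
    also have "\<dots> \<le> C * wt ?k y * norm w" using C(1) f by (intro mult_mono wt_Pair_le) (auto simp: norm_Pair)
    finally have 1: "norm (dird (0, fst w) h (y, fst z)) \<le> C * wt ?k y * norm w" .
    have "\<bar>y \<bullet> snd w\<bar> * norm (h (y, fst z)) \<le> (norm y * norm w) * (C' * wt (Suc ?k) y)"
    proof (intro mult_mono)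
      show "\<bar>y \<bullet> snd w\<bar> \<le> norm y * norm w"
        using Cauchy_Schwarz_ineq2[of y "snd w"] f by (meson mult_left_mono norm_ge_zero order_trans)
      show "norm (h (y, fst z)) \<le> C' * wt (Suc ?k) y"
        using order.trans[OF C'(2) mult_left_mono[OF wt_Pair_le(1)]] C'(1) by simp
    qed auto
    also have "\<dots> = C' * norm w * (norm y * wt (Suc ?k) y)" by (simp add: mult_ac)
    also have "\<dots> \<le> C' * norm w * wt ?k y"
      using C'(1) by (intro mult_left_mono norm_wt_Suc) auto
    finally have 2: "\<bar>y \<bullet> snd w\<bar> * norm (h (y, fst z)) \<le> C' * norm w * wt ?k y" .
    have "norm (cis (- (y \<bullet> snd z)) * (dird (0, fst w) h (y, fst z) - \<i> * (complex_of_real (y \<bullet> snd w) * h (y, fst z))))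
      \<le> norm (dird (0, fst w) h (y, fst z)) + \<bar>y \<bullet> snd w\<bar> * norm (h (y, fst z))"
      by (simp add: norm_mult) (rule order.trans[OF norm_triangle_ineq4], simp add: norm_mult)
    with 1 2 show "norm (cis (- (y \<bullet> snd z)) * (dird (0, fst w) h (y, fst z) - \<i> * (complex_of_real (y \<bullet> snd w) * h (y, fst z))))
      \<le> (C + C') * wt ?k y * norm w" by (simp add: algebra_simps)
  next
    show "integrable lborel (\<lambda>y::'a. (C + C') * wt ?k y)" by (intro integrable_mult_right integrable_wt) simp
    show "integrable lborel (\<lambda>y. cis (- (y \<bullet> snd z)) * h (y, fst z))" for z
      by (rule partial_fourier_integrable[OF h])
    show "(\<lambda>y. cis (- (y \<bullet> snd z)) * (dird (0, fst w) h (y, fst z) - \<i> * (complex_of_real (y \<bullet> snd w) * h (y, fst z)))) \<in> borel_measurable lborel" for w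
      using bm by measurable
  qed simp
  then show ?thesis by (simp add: partial_fourier_def[abs_def])
qed

text \<open>Smoothness of \<open>h\<close> becomes decay of its transform: multiplication by a frequency
  coordinate is moved onto \<open>h\<close> as a derivative.\<close>

lemma partial_fourier_mult_freq:
  fixes h :: "'a::euclidean_space \<times> 'b::euclidean_space \<Rightarrow> complex"
  assumes h: "rapid h"
  shows "complex_of_real (snd z \<bullet> b) * partial_fourier h z = partial_fourier (\<lambda>u. - \<i> * dird (b, 0) h u) z"
proof -
  have r: "rapid (\<lambda>y. cis (- (y \<bullet> snd z)) * h (y, fst z))"
    by (rule rapid_mult_cis[where \<beta> = "\<lambda>x v. 0" and \<gamma> = "\<lambda>v. - (v \<bullet> snd z)"])
      (auto intro!: derivative_eq_intros rapid_slice_left h simp: linear_iff)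
  have "dird b (\<lambda>y. cis (- (y \<bullet> snd z)) * h (y, fst z)) y =
    cis (- (y \<bullet> snd z)) * dird (b, 0) h (y, fst z) - (\<i> * complex_of_real (snd z \<bullet> b)) * (cis (- (y \<bullet> snd z)) * h (y, fst z))" for y
  proof -
    have 1: "((\<lambda>y. cis (- (y \<bullet> snd z))) has_derivative (\<lambda>w. (- (w \<bullet> snd z)) *\<^sub>R (\<i> * cis (- (y \<bullet> snd z))))) (at y)"
      by (rule has_derivative_cis) (auto intro!: derivative_eq_intros)
    have "((\<lambda>y::'a. (y, fst z)) has_derivative (\<lambda>w. (w, 0))) (at y)" by (auto intro!: derivative_eq_intros)
    from has_derivative_compose[OF this rapid_has_derivative[OF h]]
    have 2: "((\<lambda>y. h (y, fst z)) has_derivative (\<lambda>w. dird (w, 0) h (y, fst z))) (at y)" .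
    show ?thesis
      by (subst dird_eq[OF has_derivative_mult[OF 1 2]]) (simp add: scaleR_conv_of_real inner_commute)
  qed
  then have "0 = (\<integral>y. cis (- (y \<bullet> snd z)) * dird (b, 0) h (y, fst z) - (\<i> * complex_of_real (snd z \<bullet> b)) * (cis (- (y \<bullet> snd z)) * h (y, fst z)) \<partial>lborel)"
    using integral_dird_zero[OF r, of b] by simp
  also have "\<dots> = partial_fourier (dird (b, 0) h) z - (\<i> * complex_of_real (snd z \<bullet> b)) * partial_fourier h z"
    unfolding partial_fourier_def
    by (subst Bochner_Integration.integral_diff) (auto intro!: integrable_mult_right partial_fourier_integrable rapid_dird h)
  finally have "partial_fourier (dird (b, 0) h) z = \<i> * (complex_of_real (snd z \<bullet> b) * partial_fourier h z)" by simp
  moreover have "partial_fourier (\<lambda>u. - \<i> * dird (b, 0) h u) z = - \<i> * partial_fourier (dird (b, 0) h) z"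
    unfolding partial_fourier_def integral_mult_right_zero[symmetric] by (simp add: mult_ac)
  ultimately show ?thesis by (simp add: mult.assoc[symmetric])
qed

lemma rapid_partial_fourier:
  fixes h :: "'a::euclidean_space \<times> 'b::euclidean_space \<Rightarrow> complex"
  assumes "rapid h"
  shows "rapid (partial_fourier h)"
proof (rule rapidI_coordinates[where Q = "\<lambda>f. \<exists>h::'a \<times> 'b \<Rightarrow> complex. rapid h \<and> f = partial_fourier h"], goal_cases)
  case 1 then show ?case using assms by blast
next
  case (2 f)
  then obtain h :: "'a \<times> 'b \<Rightarrow> complex" where H: "rapid h" "f = partial_fourier h" by blast
  have l: "linear (\<lambda>u::'a \<times> 'b. fst u \<bullet> b)" for b by (auto simp: linear_iff inner_left_distrib)
  have "\<exists>G::'a \<times> 'b \<Rightarrow> complex. rapid G \<and>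
     (\<lambda>z. partial_fourier (\<lambda>u. dird (0, fst w) h u - \<i> * (complex_of_real (fst u \<bullet> snd w) * h u)) z) = partial_fourier G" for w
    by (rule exI[of _ "\<lambda>u. dird (0, fst w) h u - \<i> * (complex_of_real (fst u \<bullet> snd w) * h u)"])
      (intro conjI refl rapid_diff rapid_dird rapid_cmult rapid_mult_linear l H)
  with partial_fourier_has_derivative[OF H(1)] show ?case
    unfolding H(2)
    by (intro exI[of _ "\<lambda>z w. partial_fourier (\<lambda>u. dird (0, fst w) h u - \<i> * (complex_of_real (fst u \<bullet> snd w) * h u)) z"]) simp
next
  case (3 f b)
  then obtain h :: "'a \<times> 'b \<Rightarrow> complex" where H: "rapid h" "f = partial_fourier h" by blast
  consider b1 where "b = (b1, 0)" | b2 where "b = (0, b2)" using 3(2) by (auto simp: Basis_prod_def)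
  then show ?case
  proof cases
    case 1
    have "linear (\<lambda>z::'a \<times> 'b. snd z \<bullet> b1)" by (auto simp: linear_iff inner_left_distrib)
    from rapid_mult_linear[OF this H(1)] show ?thesis
      unfolding H(2) 1
      by (intro exI[of _ "\<lambda>z. complex_of_real (snd z \<bullet> b1) * h z"] conjI ext)
        (simp_all add: partial_fourier_def inner_prod_def mult.left_commute flip: integral_mult_right_zero)
  next
    case 2
    have "(\<lambda>z. complex_of_real (z \<bullet> b) * partial_fourier h z) = partial_fourier (\<lambda>u. - \<i> * dird (b2, 0) h u)"
      using partial_fourier_mult_freq[OF H(1), of _ b2] by (simp add: 2 inner_prod_def)
    then show ?thesis unfolding H(2) using rapid_cmult[OF rapid_dird[OF H(1)]] by metis
  qed
next
  case (4 f)
  then obtain h :: "'a \<times> 'b \<Rightarrow> complex" where H: "rapid h" "f = partial_fourier h" by blast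
  let ?k = "2 * DIM('a)"
  obtain C where C: "C > 0" "\<And>x. norm (h x) \<le> C * wt ?k x" using rapid_bound[OF H(1)] by blast
  have "norm (f u) \<le> (\<integral>a. C * wt ?k (a::'a) \<partial>lborel)" for u
    unfolding H(2) partial_fourier_def
  proof (rule norm_integral_le)
    show "integrable lborel (\<lambda>a::'a. C * wt ?k a)" by (intro integrable_mult_right integrable_wt) simp
    show "norm (cis (- (a \<bullet> snd u)) * h (a, fst u)) \<le> C * wt ?k a" for a
      using order.trans[OF C(2)[of "(a, fst u)"] mult_left_mono[OF wt_Pair_le(1)]] C(1) by (simp add: norm_mult)
  qed
  then show ?case by blast
qed

text \<open>The parametrised transform of \<open>h(y) h(p)\<close>, restricted to a parameter \<open>p\<close> with
  \<open>h p \<noteq> 0\<close>, is a multiple of the transform of \<open>h\<close>.\<close>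

lemma rapid_fourier:
  fixes h :: "'a::euclidean_space \<Rightarrow> complex"
  assumes h: "rapid h"
  shows "rapid (fourier h)"
proof (cases "\<forall>x. h x = 0")
  case True
  then have "fourier h = (\<lambda>x. 0)" by (simp add: fourier_def[abs_def])
  then show ?thesis by simp
next
  case False
  then obtain p where p: "h p \<noteq> 0" by blast
  have "(\<lambda>\<xi>. inverse (h p) * partial_fourier (\<lambda>z. h (fst z) * h (snd z)) (p, \<xi>)) = fourier h"
    using p by (auto simp: partial_fourier_def fourier_def mult.assoc[symmetric])
  then show ?thesis
    using rapid_cmult[OF rapid_slice_right[OF rapid_partial_fourier[OF rapid_tensor[OF h h]]]] by metis
qed

lemma fourier_multiplication_formula:
  fixes f g :: "'a::euclidean_space \<Rightarrow> complex"
  assumes "rapid f" "rapid g"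
  shows "(\<integral>x. fourier f x * g x \<partial>lborel) = (\<integral>x. f x * fourier g x \<partial>lborel)"
proof -
  have "integrable lborel (\<lambda>z::'a \<times> 'a. cis (- (fst z \<bullet> snd z)) * (f (fst z) * g (snd z)))"
  proof (rule Bochner_Integration.integrable_bound[OF rapid_integrable[OF rapid_tensor[OF assms]]])
    have "continuous_on UNIV (\<lambda>z::'a \<times> 'a. cis (- (fst z \<bullet> snd z)) * (f (fst z) * g (snd z)))"
      by (intro continuous_on_mult continuous_on_cis continuous_on_minus continuous_on_inner continuous_on_fst
        continuous_on_snd continuous_on_id rapid_continuous_on[OF rapid_tensor] assms)
    then show "(\<lambda>z::'a \<times> 'a. cis (- (fst z \<bullet> snd z)) * (f (fst z) * g (snd z))) \<in> borel_measurable lborel"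
      by (simp add: borel_measurable_continuous_onI)
  qed (simp add: norm_mult)
  then have "integrable (lborel \<Otimes>\<^sub>M lborel) (\<lambda>(y::'a, x::'a). cis (- (y \<bullet> x)) * (f y * g x))"
    by (simp add: lborel_prod case_prod_beta')
  from lborel_pair.Fubini_integral[OF this]
  have "(\<integral>x. \<integral>y. cis (- (y \<bullet> x)) * (f y * g x) \<partial>lborel \<partial>lborel) = (\<integral>y. \<integral>x. cis (- (y \<bullet> x)) * (f y * g x) \<partial>lborel \<partial>lborel)" .
  moreover have "(\<integral>y. cis (- (y \<bullet> x)) * (f y * g x) \<partial>lborel) = fourier f x * g x" for x
    unfolding fourier_def by (subst mult.assoc[symmetric], subst integral_mult_left_zero) simp
  moreover have "(\<integral>x. cis (- (y \<bullet> x)) * (f y * g x) \<partial>lborel) = f y * fourier g y" for y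
  proof -
    have "(\<integral>x. cis (- (y \<bullet> x)) * (f y * g x) \<partial>lborel) = (\<integral>x. f y * (cis (- (x \<bullet> y)) * g x) \<partial>lborel)"
      by (simp add: inner_commute mult.left_commute)
    then show ?thesis unfolding fourier_def by simp
  qed
  ultimately show ?thesis by simp
qed

lemma fourier_scale:
  fixes g :: "'a::euclidean_space \<Rightarrow> complex"
  assumes "rapid g" "c > 0"
  shows "fourier g u = c ^ DIM('a) *\<^sub>R fourier (\<lambda>x. g (c *\<^sub>R x)) (c *\<^sub>R u)"
proof -
  have "fourier g u = \<bar>c\<bar> ^ DIM('a) *\<^sub>R (\<integral>y. cis (- ((c *\<^sub>R y) \<bullet> u)) * g (c *\<^sub>R y) \<partial>lborel)"
    unfolding fourier_def
  proof (rule lborel_integral_scale)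
    show "(\<lambda>y. cis (- (y \<bullet> u)) * g y) \<in> borel_measurable borel"
      using rapid_borel[OF assms(1)] by measurable
  qed (use assms in simp)
  then show ?thesis using assms(2) by (simp add: fourier_def)
qed

text \<open>In the multiplication formula \<open>\<integral> \<F>f \<cdot> g = \<integral> f \<cdot> \<F>g\<close> replace \<open>g\<close> by its dilation
  \<open>g(c x)\<close>. A change of variables moves the dilation to \<open>f\<close> on the right, and letting
  \<open>c \<rightarrow> 0\<close> replaces the dilated functions by their values at \<open>0\<close>. Hence \<open>\<integral> \<F>f\<close> is
  proportional to \<open>f 0\<close>.\<close>

lemma fourier_at_zero_exchange:
  fixes f g :: "'a::euclidean_space \<Rightarrow> complex"
  assumes f: "rapid f" and g: "rapid g"
  shows "g 0 * (\<integral>x. fourier f x \<partial>lborel) = f 0 * (\<integral>x. fourier g x \<partial>lborel)"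
proof -
  have scaled: "(\<integral>x. fourier f x * g (c *\<^sub>R x) \<partial>lborel) = (\<integral>x. f (c *\<^sub>R x) * fourier g x \<partial>lborel)" if "c > 0" for c
  proof -
    have lin: "linear (\<lambda>x::'a. c *\<^sub>R x)" "inj (\<lambda>x::'a. c *\<^sub>R x)" using that by (auto simp: linear_iff inj_on_def algebra_simps)
    have r: "rapid (\<lambda>x. g (c *\<^sub>R x))" by (rule rapid_linear_compose[OF lin g])
    have "(\<integral>x. fourier f x * g (c *\<^sub>R x) \<partial>lborel) = (\<integral>y. f y * fourier (\<lambda>x. g (c *\<^sub>R x)) y \<partial>lborel)"
      by (rule fourier_multiplication_formula[OF f r])
    also have "\<dots> = \<bar>c\<bar> ^ DIM('a) *\<^sub>R (\<integral>y. f (c *\<^sub>R y) * fourier (\<lambda>x. g (c *\<^sub>R x)) (c *\<^sub>R y) \<partial>lborel)"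
      using that by (intro lborel_integral_scale rapid_borel rapid_mult f rapid_fourier r) simp
    also have "\<dots> = (\<integral>y. f (c *\<^sub>R y) * fourier g y \<partial>lborel)"
      using that by (simp add: fourier_scale[OF g that] flip: integral_scaleR_right)
    finally show ?thesis .
  qed
  have lim: "(\<lambda>n. \<integral>x. F x * G (inverse (real (Suc n)) *\<^sub>R x) \<partial>lborel) \<longlonglongrightarrow> (\<integral>x. F x * G 0 \<partial>lborel)"
    if F: "rapid F" and G: "rapid G" for F G :: "'a \<Rightarrow> complex"
  proof -
    obtain C where C: "C > 0" "\<And>x. norm (G x) \<le> C * wt 0 x" using rapid_bound[OF G] by blast
    show ?thesis
    proof (rule integral_dominated_convergence[where w = "\<lambda>x. norm (F x) * C"])
      show "(\<lambda>x. F x * G 0) \<in> borel_measurable lborel"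
        "\<And>n. (\<lambda>x. F x * G (inverse (real (Suc n)) *\<^sub>R x)) \<in> borel_measurable lborel"
        using rapid_borel[OF F] rapid_borel[OF G] by measurable
      show "integrable lborel (\<lambda>x. norm (F x) * C)"
        by (intro integrable_mult_left integrable_norm rapid_integrable F)
      show "AE x in lborel. norm (F x * G (inverse (real (Suc n)) *\<^sub>R x)) \<le> norm (F x) * C" for n
        using C by (auto simp: norm_mult intro!: mult_left_mono)
      show "AE x in lborel. (\<lambda>n. F x * G (inverse (real (Suc n)) *\<^sub>R x)) \<longlonglongrightarrow> F x * G 0"
      proof (intro AE_I2 tendsto_mult tendsto_const)
        fix x :: 'a
        have "(\<lambda>n. inverse (real (Suc n)) *\<^sub>R x) \<longlonglongrightarrow> 0 *\<^sub>R x"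
          by (intro tendsto_scaleR LIMSEQ_inverse_real_of_nat tendsto_const)
        then have "(\<lambda>n. inverse (real (Suc n)) *\<^sub>R x) \<longlonglongrightarrow> 0" by simp
        then show "(\<lambda>n. G (inverse (real (Suc n)) *\<^sub>R x)) \<longlonglongrightarrow> G 0"
          by (rule isCont_tendsto_compose[OF differentiable_imp_continuous_within[OF rapid_differentiable[OF G]]])
      qed
    qed
  qed
  have "(\<lambda>n. \<integral>x. f (inverse (real (Suc n)) *\<^sub>R x) * fourier g x \<partial>lborel) \<longlonglongrightarrow> (\<integral>x. fourier f x * g 0 \<partial>lborel)"
    using lim[OF rapid_fourier[OF f] g] by (simp add: scaled)
  moreover have "(\<lambda>n. \<integral>x. f (inverse (real (Suc n)) *\<^sub>R x) * fourier g x \<partial>lborel) \<longlonglongrightarrow> (\<integral>x. fourier g x * f 0 \<partial>lborel)"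
    using lim[OF rapid_fourier[OF g] f] by (simp add: mult.commute)
  ultimately have "(\<integral>x. fourier f x * g 0 \<partial>lborel) = (\<integral>x. fourier g x * f 0 \<partial>lborel)" by (rule LIMSEQ_unique)
  then show ?thesis by (simp add: mult.commute)
qed

lemma fourier_translate:
  assumes "rapid h"
  shows "fourier (\<lambda>y. h (y + x)) \<xi> = cis (x \<bullet> \<xi>) * fourier h \<xi>"
proof -
  have "fourier h \<xi> = (\<integral>y. cis (- ((y + x) \<bullet> \<xi>)) * h (y + x) \<partial>lborel)"
    unfolding fourier_def using rapid_borel[OF assms]
    by (intro lborel_integral_shift[symmetric]) measurable
  also have "\<dots> = (\<integral>y. cis (- (x \<bullet> \<xi>)) * (cis (- (y \<bullet> \<xi>)) * h (y + x)) \<partial>lborel)"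
  proof -
    have "cis (- ((y + x) \<bullet> \<xi>)) = cis (- (x \<bullet> \<xi>)) * cis (- (y \<bullet> \<xi>))" for y
      unfolding cis_mult by (simp add: inner_left_distrib algebra_simps)
    then show ?thesis by (simp only: mult.assoc)
  qed
  also have "\<dots> = cis (- (x \<bullet> \<xi>)) * fourier (\<lambda>y. h (y + x)) \<xi>"
    unfolding fourier_def by simp
  finally show ?thesis by (simp add: mult.assoc[symmetric] cis_mult)
qed

lemma fourier_inversion_upto_constant:
  fixes g :: "'a::euclidean_space \<Rightarrow> complex"
  assumes g: "rapid g" "g a \<noteq> 0"
  obtains C where "\<And>h x. rapid h \<Longrightarrow> (\<integral>\<xi>. cis (x \<bullet> \<xi>) * fourier h \<xi> \<partial>lborel) = C * (h (x :: 'a))"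
proof -
  let ?g = "\<lambda>x. g (x + a)"
  have g': "rapid ?g" by (rule rapid_translate[OF g(1)])
  define C where "C = (\<integral>x. fourier ?g x \<partial>lborel) / g a"
  have "(\<integral>\<xi>. cis (x \<bullet> \<xi>) * fourier h \<xi> \<partial>lborel) = C * h x" if h: "rapid h" for h and x :: 'a
  proof -
    have "g a * (\<integral>\<xi>. fourier (\<lambda>y. h (y + x)) \<xi> \<partial>lborel) = h x * (\<integral>\<xi>. fourier ?g \<xi> \<partial>lborel)"
      using fourier_at_zero_exchange[OF rapid_translate[OF h, of x] g'] by simp
    then show ?thesis using g(2) by (simp add: C_def fourier_translate[OF h] field_simps)
  qed
  then show ?thesis using that by blast
qed

lemma norm_square_mult_cnj: "complex_of_real ((norm z)\<^sup>2) = z * cnj z"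
  by (rule complex_norm_square)

lemma rapid_integral_norm_square_zero:
  assumes f: "rapid f" and "(\<integral>x. f x * cnj (f x) \<partial>lborel) = 0"
  shows "f x = 0"
proof -
  have i: "integrable lborel (\<lambda>x. f x * cnj (f x))" by (rule rapid_integrable[OF rapid_mult[OF f rapid_cnj[OF f]]])
  then have i2: "integrable lborel (\<lambda>x. (norm (f x))\<^sup>2)"
    using integrable_Re[OF i] by (simp only: Re_complex_of_real flip: norm_square_mult_cnj)
  have "complex_of_real (\<integral>x. (norm (f x))\<^sup>2 \<partial>lborel) = (\<integral>x. f x * cnj (f x) \<partial>lborel)"
    by (simp only: norm_square_mult_cnj flip: integral_complex_of_real)
  then have "(\<integral>x. (norm (f x))\<^sup>2 \<partial>lborel) = 0" using assms(2) by simp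
  then have "AE x in lborel. f x = 0" using integral_nonneg_eq_0_iff_AE[OF i2] by simp
  then show ?thesis by (rule rapid_AE_zero[OF f])
qed

text \<open>The constant cannot vanish: otherwise the double transform of every rapidly decreasing
  function would be zero, and the multiplication formula with the reflected conjugate of \<open>h\<close> would give
  \<open>\<integral> |\<F>h|\<^sup>2 = 0\<close> for all \<open>h\<close>. But the transform of \<open>|g|\<^sup>2\<close> at \<open>0\<close> is
  \<open>\<integral> |g|\<^sup>2 > 0\<close>.\<close>

theorem fourier_inversion:
  fixes g :: "'a::euclidean_space \<Rightarrow> complex"
  assumes g: "rapid g" "g a \<noteq> 0"
  obtains C where "C \<noteq> 0" "\<And>h x. rapid h \<Longrightarrow> (\<integral>\<xi>. cis (x \<bullet> \<xi>) * fourier h \<xi> \<partial>lborel) = C * (h (x :: 'a))"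
proof -
  obtain C where C: "\<And>h x. rapid h \<Longrightarrow> (\<integral>\<xi>. cis (x \<bullet> \<xi>) * fourier h \<xi> \<partial>lborel) = C * (h (x :: 'a))"
    using fourier_inversion_upto_constant[OF g] by blast
  have "C \<noteq> 0"
  proof
    assume "C = 0"
    then have ff: "fourier (fourier h) x = 0" if "rapid h" for h and x :: 'a
      using C[OF that, of "- x"] by (simp add: fourier_def[of "fourier h"] inner_commute)
    have "fourier h x = 0" if h: "rapid h" for h and x :: 'a
    proof (rule rapid_integral_norm_square_zero[OF rapid_fourier[OF h]])
      let ?k = "\<lambda>y. cnj (h (- y))"
      have k: "rapid ?k"
        by (intro rapid_cnj rapid_linear_compose[OF _ _ h]) (auto simp: linear_iff inj_on_def)
      have "fourier ?k \<xi> = cnj (fourier h \<xi>)" for \<xi>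
      proof -
        have "cnj (fourier h \<xi>) = (\<integral>y. cis (y \<bullet> \<xi>) * cnj (h y) \<partial>lborel)"
          unfolding fourier_def by (subst Bochner_Integration.integral_cnj[symmetric]) (simp add: cis_cnj)
        also have "\<dots> = (\<integral>y. cis ((0 - y) \<bullet> \<xi>) * cnj (h (0 - y)) \<partial>lborel)"
          using rapid_borel[OF h] by (intro lborel_integral_reflect[symmetric]) measurable
        finally show ?thesis by (simp add: fourier_def)
      qed
      then have "(\<integral>x. fourier h x * cnj (fourier h x) \<partial>lborel) = (\<integral>x. fourier h x * fourier ?k x \<partial>lborel)" by simp
      also have "\<dots> = (\<integral>x. h x * fourier (fourier ?k) x \<partial>lborel)"
        by (rule fourier_multiplication_formula[OF h rapid_fourier[OF k]])
      finally show "(\<integral>x. fourier h x * cnj (fourier h x) \<partial>lborel) = 0" by (simp add: ff[OF k])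
    qed
    from this[OF rapid_mult[OF g(1) rapid_cnj[OF g(1)]], of 0]
    have "(\<integral>x. g x * cnj (g x) \<partial>lborel) = 0" by (simp add: fourier_def)
    then show False using rapid_integral_norm_square_zero[OF g(1)] g(2) by blast
  qed
  then show ?thesis using that C by blast
qed

section \<open>Square integrable functions\<close>

lemma integral_Cauchy_Schwarz:
  fixes f g :: "'a \<Rightarrow> real"
  assumes [measurable]: "f \<in> borel_measurable M" "g \<in> borel_measurable M"
    and f: "integrable M (\<lambda>x. (f x)\<^sup>2)" and g: "integrable M (\<lambda>x. (g x)\<^sup>2)"
  shows "integrable M (\<lambda>x. f x * g x)"
    and "(\<integral>x. \<bar>f x * g x\<bar> \<partial>M) \<le> sqrt (\<integral>x. (f x)\<^sup>2 \<partial>M) * sqrt (\<integral>x. (g x)\<^sup>2 \<partial>M)"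
proof -
  show i: "integrable M (\<lambda>x. f x * g x)"
  proof (rule Bochner_Integration.integrable_bound[OF Bochner_Integration.integrable_add[OF f g]])
    have "\<bar>a * b\<bar> \<le> a\<^sup>2 + b\<^sup>2" for a b :: real
    proof -
      have "2 * \<bar>a\<bar> * \<bar>b\<bar> \<le> a\<^sup>2 + b\<^sup>2" using sum_squares_bound[of "\<bar>a\<bar>" "\<bar>b\<bar>"] by simp
      moreover have "0 \<le> \<bar>a\<bar> * \<bar>b\<bar>" by simp
      ultimately show ?thesis by (simp only: abs_mult)
    qed
    then show "AE x in M. norm (f x * g x) \<le> norm ((f x)\<^sup>2 + (g x)\<^sup>2)" by simp
  qed simp
  let ?I = "\<integral>x. \<bar>f x * g x\<bar> \<partial>M" and ?F = "\<integral>x. (f x)\<^sup>2 \<partial>M" and ?G = "\<integral>x. (g x)\<^sup>2 \<partial>M"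
  have conv: "(\<integral>\<^sup>+x. ennreal (h x) \<partial>M) = ennreal (\<integral>x. h x \<partial>M)" if "integrable M h" "\<And>x. 0 \<le> h x" for h
    using that by (simp add: nn_integral_eq_integral)
  have "(\<integral>\<^sup>+x. ennreal \<bar>f x\<bar> * ennreal \<bar>g x\<bar> \<partial>M)\<^sup>2 \<le> (\<integral>\<^sup>+x. (ennreal \<bar>f x\<bar>)\<^sup>2 \<partial>M) * (\<integral>\<^sup>+x. (ennreal \<bar>g x\<bar>)\<^sup>2 \<partial>M)"
    by (rule Cauchy_Schwarz_nn_integral) auto
  then have "(ennreal ?I)\<^sup>2 \<le> ennreal ?F * ennreal ?G"
    using conv[OF integrable_abs[OF i]] conv[OF f] conv[OF g]
    by (simp add: ennreal_mult[symmetric] ennreal_power abs_mult)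
  then have "?I\<^sup>2 \<le> ?F * ?G"
    by (simp add: ennreal_power ennreal_mult[symmetric] integral_nonneg_AE)
  then have "?I \<le> sqrt (?F * ?G)" by (simp add: real_le_rsqrt)
  then show "?I \<le> sqrt ?F * sqrt ?G" by (simp add: real_sqrt_mult)
qed

lemma L2I: "f \<in> borel_measurable borel \<Longrightarrow> integrable lborel (\<lambda>x. (norm (f x))\<^sup>2) \<Longrightarrow> f \<in> L2"
  by (simp add: L2_def)

lemma L2_borel: "f \<in> L2 \<Longrightarrow> f \<in> borel_measurable borel"
  by (simp add: L2_def)

lemma L2_integrable: "f \<in> L2 \<Longrightarrow> integrable lborel (\<lambda>x. (norm (f x))\<^sup>2)"
  by (simp add: L2_def)

lemma L2_norm_nonneg [simp]: "0 \<le> L2_norm f"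
  by (simp add: L2_norm_def integral_nonneg_AE)

lemma L2_norm_square: "(L2_norm f)\<^sup>2 = (\<integral>x. (norm (f x))\<^sup>2 \<partial>lborel)"
  by (simp add: L2_norm_def integral_nonneg_AE)

lemma L2_Cauchy_Schwarz:
  assumes f: "f \<in> L2" and g: "g \<in> L2"
  shows "integrable lborel (\<lambda>x. f x * g x)"
    and "(\<integral>x. norm (f x * g x) \<partial>lborel) \<le> L2_norm f * L2_norm g"
    and "norm (\<integral>x. f x * g x \<partial>lborel) \<le> L2_norm f * L2_norm g"
proof -
  have m: "(\<lambda>x. f x * g x) \<in> borel_measurable borel"
    using L2_borel[OF f] L2_borel[OF g] by (rule borel_measurable_times)
  have *: "integrable lborel (\<lambda>x. norm (f x) * norm (g x))"
    "(\<integral>x. \<bar>norm (f x) * norm (g x)\<bar> \<partial>lborel) \<le> L2_norm f * L2_norm g"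
    unfolding L2_norm_def using L2_borel[OF f] L2_borel[OF g]
    by (intro integral_Cauchy_Schwarz L2_integrable f g; simp)+
  from *(1) show "integrable lborel (\<lambda>x. f x * g x)"
    by (rule Bochner_Integration.integrable_bound) (use m in \<open>simp_all add: norm_mult\<close>)
  from *(2) show **: "(\<integral>x. norm (f x * g x) \<partial>lborel) \<le> L2_norm f * L2_norm g"
    by (simp add: norm_mult)
  show "norm (\<integral>x. f x * g x \<partial>lborel) \<le> L2_norm f * L2_norm g"
    by (rule order.trans[OF integral_norm_bound **])
qed

lemma L2_scale:
  assumes "f \<in> L2"
  shows "(\<lambda>x. c * f x) \<in> L2" "L2_norm (\<lambda>x. c * f x) = norm c * L2_norm f"
  using L2_borel[OF assms] L2_integrable[OF assms]
  by (auto intro!: L2I simp: norm_mult power_mult_distrib L2_norm_def real_sqrt_mult)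

lemma L2_dominated:
  assumes "f \<in> borel_measurable borel" "g \<in> L2" "\<And>x. norm (f x) \<le> norm (g x)"
  shows "f \<in> L2" "L2_norm f \<le> L2_norm g"
proof -
  have le: "(norm (f x))\<^sup>2 \<le> (norm (g x))\<^sup>2" for x using assms(3) by (simp add: power_mono)
  show "f \<in> L2"
    by (rule L2I[OF assms(1)], rule Bochner_Integration.integrable_bound[OF L2_integrable[OF assms(2)]])
      (use assms(1) le in auto)
  then show "L2_norm f \<le> L2_norm g"
    unfolding L2_norm_def
    by (intro real_sqrt_le_mono integral_mono L2_integrable assms le)
qed

lemma L2_cnj:
  assumes "f \<in> L2"
  shows "(\<lambda>x. cnj (f x)) \<in> L2" "L2_norm (\<lambda>x. cnj (f x)) = L2_norm f"
proof -
  show "(\<lambda>x. cnj (f x)) \<in> L2"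
    using L2_integrable[OF assms] borel_measurable_cnj[OF L2_borel[OF assms]] by (intro L2I) simp_all
qed (simp add: L2_norm_def)

lemma L2_add:
  assumes f: "f \<in> L2" and g: "g \<in> L2"
  shows "(\<lambda>x. f x + g x) \<in> L2" "L2_norm (\<lambda>x. f x + g x) \<le> L2_norm f + L2_norm g"
proof -
  note [measurable] = L2_borel[OF f] L2_borel[OF g]
  have i: "integrable lborel (\<lambda>x. norm (f x * g x))" using L2_Cauchy_Schwarz(1)[OF f g] by simp
  have le: "(norm (f x + g x))\<^sup>2 \<le> (norm (f x))\<^sup>2 + (norm (g x))\<^sup>2 + 2 * norm (f x * g x)" for x
    using power_mono[OF norm_triangle_ineq[of "f x" "g x"], of 2] by (simp add: power2_sum norm_mult)
  have i2: "integrable lborel (\<lambda>x. (norm (f x))\<^sup>2 + (norm (g x))\<^sup>2 + 2 * norm (f x * g x))"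
    by (intro Bochner_Integration.integrable_add integrable_mult_right i L2_integrable f g)
  show m: "(\<lambda>x. f x + g x) \<in> L2"
  proof (rule L2I)
    show "integrable lborel (\<lambda>x. (norm (f x + g x))\<^sup>2)"
      by (rule Bochner_Integration.integrable_bound[OF i2]) (use order.trans[OF le abs_ge_self] in auto)
  qed measurable
  have "(L2_norm (\<lambda>x. f x + g x))\<^sup>2 \<le> (\<integral>x. (norm (f x))\<^sup>2 + (norm (g x))\<^sup>2 + 2 * norm (f x * g x) \<partial>lborel)"
    unfolding L2_norm_square by (intro integral_mono i2 L2_integrable m le)
  also have "\<dots> = (L2_norm f)\<^sup>2 + (L2_norm g)\<^sup>2 + 2 * (\<integral>x. norm (f x * g x) \<partial>lborel)"
    using i L2_integrable[OF f] L2_integrable[OF g] by (simp add: L2_norm_square)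
  also have "\<dots> \<le> (L2_norm f + L2_norm g)\<^sup>2"
    using L2_Cauchy_Schwarz(2)[OF f g] by (simp add: power2_sum)
  finally show "L2_norm (\<lambda>x. f x + g x) \<le> L2_norm f + L2_norm g"
    by (rule power2_le_imp_le) simp
qed

lemma L2_diff:
  assumes f: "f \<in> L2" and g: "g \<in> L2"
  shows "(\<lambda>x. f x - g x) \<in> L2" "L2_norm (\<lambda>x. f x - g x) \<le> L2_norm f + L2_norm g"
  using L2_add[OF f L2_scale(1)[OF g, of "-1"]] L2_scale(2)[OF g, of "-1"] by simp_all

lemma L2_norm_minus_commute: "L2_norm (\<lambda>x. f x - g x) = L2_norm (\<lambda>x. g x - f x)"
  by (simp add: L2_norm_def norm_minus_commute)

lemma L2_norm_triangle:
  assumes "f \<in> L2" "g \<in> L2" "h \<in> L2"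
  shows "L2_norm (\<lambda>x. f x - h x) \<le> L2_norm (\<lambda>x. f x - g x) + L2_norm (\<lambda>x. g x - h x)"
  using L2_add(2)[OF L2_diff(1)[OF assms(1,2)] L2_diff(1)[OF assms(2,3)]] by simp

lemma L2_norm_le_diff:
  assumes "f \<in> L2" "g \<in> L2"
  shows "L2_norm f \<le> L2_norm g + L2_norm (\<lambda>x. f x - g x)"
  using L2_add(2)[OF assms(2) L2_diff(1)[OF assms]] by simp

lemma L2_zero [simp]: "(\<lambda>x. 0) \<in> L2" "L2_norm (\<lambda>x. 0) = 0"
  by (simp_all add: L2_def L2_norm_def)

lemma rapid_L2:
  assumes "rapid f"
  shows "f \<in> L2"
proof (rule L2I[OF rapid_borel[OF assms]])
  have "integrable lborel (\<lambda>x. Re (f x * cnj (f x)))"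
    by (rule integrable_Re[OF rapid_integrable[OF rapid_mult[OF assms rapid_cnj[OF assms]]]])
  then show "integrable lborel (\<lambda>x. (norm (f x))\<^sup>2)"
    by (simp only: Re_complex_of_real flip: norm_square_mult_cnj)
qed

lemma L2_norm_zero_AE:
  assumes "f \<in> L2" "L2_norm f = 0"
  shows "AE x in lborel. f x = 0"
proof -
  have "(\<integral>x. (norm (f x))\<^sup>2 \<partial>lborel) = 0" using assms(2) L2_norm_square[of f] by simp
  then show ?thesis using integral_nonneg_eq_0_iff_AE[OF L2_integrable[OF assms(1)]] by simp
qed

lemma L2_norm_cong_AE:
  assumes "AE x in lborel. f x = g x" "f \<in> borel_measurable borel" "g \<in> borel_measurable borel"
  shows "L2_norm f = L2_norm g"
  unfolding L2_norm_def using assms by (intro arg_cong[where f = sqrt] integral_cong_AE) auto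

lemma L2_dominated_convergence:
  assumes [measurable]: "\<And>n. f n \<in> borel_measurable borel" "g \<in> borel_measurable borel"
    and w: "integrable lborel (\<lambda>x. (w x)\<^sup>2)" "\<And>n. AE x in lborel. norm (f n x - g x) \<le> w x"
    and lim: "AE x in lborel. (\<lambda>n. f n x) \<longlonglongrightarrow> g x"
  shows "(\<lambda>n. L2_norm (\<lambda>x. f n x - g x)) \<longlonglongrightarrow> 0"
proof -
  have "(\<lambda>n. \<integral>x. (norm (f n x - g x))\<^sup>2 \<partial>lborel) \<longlonglongrightarrow> (\<integral>x. 0 \<partial>(lborel :: (real^'a) measure))"
  proof (rule integral_dominated_convergence[OF _ _ w(1)])
    show "AE x in lborel. (\<lambda>n. (norm (f n x - g x))\<^sup>2) \<longlonglongrightarrow> 0"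
      using lim
    proof eventually_elim
      case (elim x)
      have "(\<lambda>n. (norm (f n x - g x))\<^sup>2) \<longlonglongrightarrow> (norm (g x - g x))\<^sup>2"
        by (intro tendsto_power tendsto_norm tendsto_diff elim tendsto_const)
      then show ?case by simp
    qed
    show "AE x in lborel. norm ((norm (f n x - g x))\<^sup>2) \<le> (w x)\<^sup>2" for n
      using w(2)[of n] by eventually_elim (simp add: power_mono)
  qed auto
  then show ?thesis
    unfolding L2_norm_def using tendsto_real_sqrt by fastforce
qed

text \<open>Completeness along rapidly convergent sequences.  The weights \<open>4 ^ n\<close> turn the summable
  square norms into one integrable majorant of all increments.\<close>

lemma L2_complete:
  fixes u :: "nat \<Rightarrow> real ^ 'n::finite \<Rightarrow> complex"
  assumes u: "\<And>n. u n \<in> L2" and step: "\<And>n. L2_norm (\<lambda>x. u (Suc n) x - u n x) \<le> C / 4 ^ n"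
  obtains v where "v \<in> L2" "(\<lambda>n. L2_norm (\<lambda>x. u n x - v x)) \<longlonglongrightarrow> 0"
proof -
  note [measurable] = L2_borel[OF u]
  define a where "a n x = (norm (u (Suc n) x - u n x))\<^sup>2" for n x
  have am [measurable]: "a n \<in> borel_measurable borel" for n unfolding a_def by measurable
  have ai: "integrable lborel (a n)" for n
    using L2_integrable[OF L2_diff(1)[OF u u]] by (simp add: a_def[abs_def])
  have a0: "0 \<le> a n x" for n x by (simp add: a_def)
  define S where "S x = (\<Sum>n. ennreal (4 ^ n * a n x))" for x
  have Sm [measurable]: "S \<in> borel_measurable borel" unfolding S_def by measurable
  have "(\<integral>\<^sup>+x. S x \<partial>lborel) = (\<Sum>n. (\<integral>\<^sup>+x. ennreal (4 ^ n * a n x) \<partial>lborel))"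
    unfolding S_def by (rule nn_integral_suminf) simp
  also have "\<dots> \<le> (\<Sum>n. ennreal (C\<^sup>2 * (1 / 4) ^ n))"
  proof (intro suminf_le)
    fix n
    have "(\<integral>x. a n x \<partial>lborel) \<le> (C / 4 ^ n)\<^sup>2"
      using power_mono[OF step L2_norm_nonneg, of n 2] by (simp add: L2_norm_square a_def)
    then have "4 ^ n * (\<integral>x. a n x \<partial>lborel) \<le> C\<^sup>2 * (1 / 4) ^ n"
      by (simp add: power_divide field_simps power2_eq_square)
    then show "(\<integral>\<^sup>+x. ennreal (4 ^ n * a n x) \<partial>lborel) \<le> ennreal (C\<^sup>2 * (1 / 4) ^ n)"
      by (subst nn_integral_eq_integral) (auto simp: ai a0 intro!: ennreal_leI)
  qed auto
  also have "\<dots> = ennreal (\<Sum>n. C\<^sup>2 * (1 / 4) ^ n)"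
    by (intro suminf_ennreal2) (auto intro!: summable_mult summable_geometric)
  also have "\<dots> < \<infinity>" by simp
  finally have Sfin: "(\<integral>\<^sup>+x. S x \<partial>lborel) < \<infinity>" .
  then have SAE: "AE x in lborel. S x \<noteq> \<infinity>" by (intro nn_integral_PInf_AE) auto
  define s where "s x = enn2real (S x)" for x
  have sm [measurable]: "s \<in> borel_measurable borel" unfolding s_def by measurable
  have si: "integrable lborel s"
  proof (rule integrableI_bounded)
    have "(\<integral>\<^sup>+x. ennreal (norm (s x)) \<partial>lborel) \<le> (\<integral>\<^sup>+x. S x \<partial>lborel)"
      by (intro nn_integral_mono) (simp add: s_def ennreal_enn2real_if)
    then show "(\<integral>\<^sup>+x. ennreal (norm (s x)) \<partial>lborel) < \<infinity>" using Sfin by (rule order.strict_trans1)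
  qed simp
  define v where "v x = lim (\<lambda>n. u n x)" for x
  have vm [measurable]: "v \<in> borel_measurable borel" unfolding v_def by measurable
  have pt: "(\<lambda>n. u n x) \<longlonglongrightarrow> v x \<and> (\<forall>n. norm (u n x - v x) \<le> 2 * sqrt (s x))" if "S x \<noteq> \<infinity>" for x
  proof -
    have inc: "norm (u (Suc n) x - u n x) \<le> sqrt (s x) * (1 / 2) ^ n" for n
    proof -
      have "ennreal (4 ^ n * a n x) \<le> S x"
        unfolding S_def by (rule sum_le_suminf[of _ "{n}", simplified]) auto
      also have "S x = ennreal (s x)" using that by (simp add: s_def ennreal_enn2real_if)
      finally have "4 ^ n * a n x \<le> s x" by (simp add: s_def)
      then have "(2 ^ n * norm (u (Suc n) x - u n x))\<^sup>2 \<le> s x"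
        by (simp add: a_def power_mult_distrib power2_eq_square[of "2 ^ n"] flip: power_mult_distrib[of 2 2 n])
      then have "2 ^ n * norm (u (Suc n) x - u n x) \<le> sqrt (s x)" by (rule real_le_rsqrt)
      then show ?thesis by (simp add: power_divide field_simps)
    qed
    have sg: "summable (\<lambda>n. sqrt (s x) * (1 / 2) ^ n)" by (intro summable_mult summable_geometric) simp
    have sn: "summable (\<lambda>n. norm (u (Suc n) x - u n x))"
      by (rule summable_comparison_test'[OF sg, of 0]) (use inc in simp)
    have sm: "summable (\<lambda>n. u (Suc n) x - u n x)" by (rule summable_norm_cancel[OF sn])
    have "convergent (\<lambda>n. u n x)"
    proof -
      have "(\<lambda>n. \<Sum>i<n. u (Suc i) x - u i x) \<longlonglongrightarrow> (\<Sum>i. u (Suc i) x - u i x)" by (rule summable_LIMSEQ[OF sm])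
      then have "(\<lambda>n. (u n x - u 0 x) + u 0 x) \<longlonglongrightarrow> (\<Sum>i. u (Suc i) x - u i x) + u 0 x"
        unfolding sum_lessThan_telescope[of "\<lambda>i. u i x"] by (intro tendsto_add tendsto_const)
      then show ?thesis by (auto simp: convergent_def)
    qed
    then have lim: "(\<lambda>n. u n x) \<longlonglongrightarrow> v x" unfolding v_def by (simp add: convergent_LIMSEQ_iff)
    have "norm (u n x - v x) \<le> 2 * sqrt (s x)" for n
    proof -
      have "norm (u (n + m) x - u n x) \<le> 2 * sqrt (s x)" for m
      proof -
        have "norm (u (n + m) x - u n x) = norm (\<Sum>i<m. u (n + Suc i) x - u (n + i) x)"
          using sum_lessThan_telescope[of "\<lambda>i. u (n + i) x" m] by simp
        also have "\<dots> \<le> (\<Sum>i<m. sqrt (s x) * (1 / 2) ^ i)"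
        proof (intro sum_norm_le)
          fix i
          have "norm (u (n + Suc i) x - u (n + i) x) \<le> sqrt (s x) * (1 / 2) ^ (n + i)" using inc[of "n + i"] by simp
          also have "\<dots> \<le> sqrt (s x) * (1 / 2) ^ i"
            by (intro mult_left_mono power_decreasing) (auto simp: s_def)
          finally show "norm (u (n + Suc i) x - u (n + i) x) \<le> sqrt (s x) * (1 / 2) ^ i" .
        qed
        also have "\<dots> \<le> (\<Sum>i. sqrt (s x) * (1 / 2) ^ i)"
          by (intro sum_le_suminf sg) (auto simp: s_def)
        also have "\<dots> = 2 * sqrt (s x)" by (subst suminf_mult) (auto simp: suminf_geometric)
        finally show ?thesis .
      qed
      moreover have "(\<lambda>m. norm (u (n + m) x - u n x)) \<longlonglongrightarrow> norm (v x - u n x)"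
        using LIMSEQ_ignore_initial_segment[OF lim, of n]
        by (intro tendsto_norm tendsto_diff tendsto_const) (simp add: add.commute)
      ultimately have "norm (v x - u n x) \<le> 2 * sqrt (s x)" by (intro LIMSEQ_le_const2) auto
      then show ?thesis by (simp add: norm_minus_commute)
    qed
    with lim show ?thesis by blast
  qed
  have w: "integrable lborel (\<lambda>x. (2 * sqrt (s x))\<^sup>2)"
    using integrable_mult_right[OF si, of 4] by (simp add: power_mult_distrib s_def)
  have dom: "AE x in lborel. norm (u n x - v x) \<le> 2 * sqrt (s x)" for n
    using SAE by eventually_elim (use pt in blast)
  have lim: "(\<lambda>n. L2_norm (\<lambda>x. u n x - v x)) \<longlonglongrightarrow> 0"
  proof (rule L2_dominated_convergence[OF _ _ w dom])
    show "AE x in lborel. (\<lambda>n. u n x) \<longlonglongrightarrow> v x" using SAE by eventually_elim (use pt in blast)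
  qed auto
  have "(\<lambda>x. u 0 x - v x) \<in> L2"
  proof (rule L2I)
    show "integrable lborel (\<lambda>x. (norm (u 0 x - v x))\<^sup>2)"
      by (rule Bochner_Integration.integrable_bound[OF w], measurable)
        (use dom[of 0] in eventually_elim, simp only: real_norm_def abs_power2 power_mono norm_ge_zero)
  qed measurable
  from L2_diff(1)[OF u[of 0] this] have "v \<in> L2" by simp
  with lim show ?thesis using that by blast
qed

section \<open>Density of the Schwartz functions\<close>

text \<open>Membership in the closure of the rapidly decreasing functions.\<close>

definition L2_limit :: "(real ^ 'n::finite \<Rightarrow> complex) \<Rightarrow> bool" where
  "L2_limit f \<longleftrightarrow> f \<in> L2 \<and> (\<forall>e>0. \<exists>\<phi>. rapid \<phi> \<and> L2_norm (\<lambda>x. f x - \<phi> x) < e)"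

lemma L2_limit_add:
  assumes "L2_limit f" "L2_limit g"
  shows "L2_limit (\<lambda>x. f x + g x)"
  unfolding L2_limit_def
proof (intro conjI allI impI)
  have fg: "f \<in> L2" "g \<in> L2" using assms by (auto simp: L2_limit_def)
  then show "(\<lambda>x. f x + g x) \<in> L2" by (rule L2_add)
  fix e :: real assume "e > 0"
  then obtain \<phi> \<psi> where r: "rapid \<phi>" "rapid \<psi>" "L2_norm (\<lambda>x. f x - \<phi> x) < e / 2" "L2_norm (\<lambda>x. g x - \<psi> x) < e / 2"
    using assms unfolding L2_limit_def by (meson half_gt_zero)
  have "L2_norm (\<lambda>x. (f x - \<phi> x) + (g x - \<psi> x)) < e"
    using L2_add(2)[OF L2_diff(1)[OF fg(1) rapid_L2[OF r(1)]] L2_diff(1)[OF fg(2) rapid_L2[OF r(2)]]] r by simp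
  then show "\<exists>\<phi>. rapid \<phi> \<and> L2_norm (\<lambda>x. f x + g x - \<phi> x) < e"
    using rapid_add[OF r(1,2)] by (intro exI[of _ "\<lambda>x. \<phi> x + \<psi> x"]) (simp add: algebra_simps)
qed

lemma L2_limit_scale:
  assumes "L2_limit f"
  shows "L2_limit (\<lambda>x. c * f x)"
  unfolding L2_limit_def
proof (intro conjI allI impI)
  have f: "f \<in> L2" using assms by (auto simp: L2_limit_def)
  then show "(\<lambda>x. c * f x) \<in> L2" by (rule L2_scale)
  fix e :: real assume "e > 0"
  then have "e / (norm c + 1) > 0" by (intro divide_pos_pos add_nonneg_pos) auto
  then obtain \<phi> where r: "rapid \<phi>" "L2_norm (\<lambda>x. f x - \<phi> x) < e / (norm c + 1)"
    using assms unfolding L2_limit_def by meson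
  have "L2_norm (\<lambda>x. c * (f x - \<phi> x)) = norm c * L2_norm (\<lambda>x. f x - \<phi> x)"
    by (rule L2_scale(2)[OF L2_diff(1)[OF f rapid_L2[OF r(1)]]])
  also have "\<dots> \<le> (norm c + 1) * L2_norm (\<lambda>x. f x - \<phi> x)" by (intro mult_right_mono) auto
  also have "\<dots> < (norm c + 1) * (e / (norm c + 1))"
    using r(2) by (intro mult_strict_left_mono add_nonneg_pos) auto
  also have "\<dots> = e" by (simp add: add_nonneg_eq_0_iff)
  finally show "\<exists>\<phi>. rapid \<phi> \<and> L2_norm (\<lambda>x. c * f x - \<phi> x) < e"
    using rapid_cmult[OF r(1), of c] by (intro exI[of _ "\<lambda>x. c * \<phi> x"]) (simp add: algebra_simps)
qed

lemma L2_limit_zero: "L2_limit (\<lambda>x. 0)"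
  unfolding L2_limit_def by (auto intro!: exI[of _ "\<lambda>x. 0"])

lemma L2_limit_sum: "(\<And>i. i \<in> I \<Longrightarrow> L2_limit (f i)) \<Longrightarrow> L2_limit (\<lambda>x. \<Sum>i\<in>I. f i x)"
  by (induction I rule: infinite_finite_induct) (simp_all add: L2_limit_zero L2_limit_add)

lemma L2_limit_LIMSEQ:
  assumes f: "f \<in> L2" and h: "\<And>n. L2_limit (h n)" and lim: "(\<lambda>n. L2_norm (\<lambda>x. h n x - f x)) \<longlonglongrightarrow> 0"
  shows "L2_limit f"
  unfolding L2_limit_def
proof (intro conjI allI impI f)
  fix e :: real assume e: "e > 0"
  have "eventually (\<lambda>n. L2_norm (\<lambda>x. h n x - f x) < e / 2) sequentially"
    using e by (intro order_tendstoD(2)[OF lim]) simp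
  then obtain n where n: "L2_norm (\<lambda>x. h n x - f x) < e / 2" by (auto simp: eventually_sequentially)
  obtain \<phi> where r: "rapid \<phi>" "L2_norm (\<lambda>x. h n x - \<phi> x) < e / 2"
    using h[of n] e unfolding L2_limit_def by (meson half_gt_zero)
  have hn: "h n \<in> L2" using h by (auto simp: L2_limit_def)
  have "L2_norm (\<lambda>x. f x - \<phi> x) < e"
    using L2_norm_triangle[OF f hn rapid_L2[OF r(1)]] n r(2) L2_norm_minus_commute[of f "h n"] by simp
  with r(1) show "\<exists>\<phi>. rapid \<phi> \<and> L2_norm (\<lambda>x. f x - \<phi> x) < e" by blast
qed

lemma rapid_convolution_indicator:
  fixes r :: "'a::euclidean_space \<Rightarrow> complex"
  assumes Q [measurable]: "Q \<in> sets borel" and bQ: "bounded Q" and "rapid r"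
  shows "rapid (\<lambda>x. \<integral>y. indicat_real Q y *\<^sub>R r (x - y) \<partial>lborel)"
proof -
  have iQ: "integrable lborel (indicat_real Q)"
    using emeasure_bounded_finite[OF bQ] by (simp add: Q)
  obtain R where R: "\<And>y. y \<in> Q \<Longrightarrow> norm y \<le> R" "R \<ge> 0" using bQ unfolding bounded_pos by (meson less_imp_le)
  have bm: "(\<lambda>y. r (x - y)) \<in> borel_measurable borel" if "rapid r" for x and r :: "'a \<Rightarrow> complex"
    using rapid_borel[OF that] by measurable
  show ?thesis
  proof (rule rapidI[where Q = "\<lambda>f. \<exists>r. rapid r \<and> f = (\<lambda>x. \<integral>y. indicat_real Q y *\<^sub>R r (x - y) \<partial>lborel)"], goal_cases)
    case 1 then show ?case using assms(3) by blast
  next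
    case (2 f)
    then obtain r where r: "rapid r" "f = (\<lambda>x. \<integral>y. indicat_real Q y *\<^sub>R r (x - y) \<partial>lborel)" by blast
    obtain C where C: "C > 0" "\<And>x v. norm (dird v r x) \<le> C * wt 0 x * norm v" using rapid_dird_bound[OF r(1)] by blast
    have "((\<lambda>x. \<integral>y. indicat_real Q y *\<^sub>R r (x - y) \<partial>lborel) has_derivative
       (\<lambda>v. \<integral>y. indicat_real Q y *\<^sub>R dird v r (x - y) \<partial>lborel)) (at x)" for x
    proof (rule has_derivative_integral[where r = 1 and b = "\<lambda>y. indicat_real Q y * C"])
      fix y u :: 'a
      have "((\<lambda>x. x - y) has_derivative (\<lambda>v. v)) (at u)" by (auto intro!: derivative_eq_intros)
      from has_derivative_compose[OF this rapid_has_derivative[OF r(1)]]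
      show "((\<lambda>x. indicat_real Q y *\<^sub>R r (x - y)) has_derivative (\<lambda>v. indicat_real Q y *\<^sub>R dird v r (u - y))) (at u)"
        by (rule has_derivative_scaleR_right)
    next
      fix y u v :: 'a
      show "norm (indicat_real Q y *\<^sub>R dird v r (u - y)) \<le> indicat_real Q y * C * norm v"
        using C(2)[of v "u - y"] by (auto split: split_indicator)
    next
      show "integrable lborel (\<lambda>y. indicat_real Q y * C)" by (rule integrable_mult_left[OF iQ])
      obtain C' where C': "\<And>x. norm (r x) \<le> C' * wt 0 x" using rapid_bound[OF r(1)] by blast
      show "integrable lborel (\<lambda>y. indicat_real Q y *\<^sub>R r (u - y))" for u
      proof (rule Bochner_Integration.integrable_bound[OF integrable_mult_left[OF iQ, of C']])
        show "AE y in lborel. norm (indicat_real Q y *\<^sub>R r (u - y)) \<le> norm (indicat_real Q y * C')"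
          using order.trans[OF C' abs_ge_self] by (intro AE_I2) (auto split: split_indicator)
      qed (use bm[OF r(1)] in measurable)
      show "(\<lambda>y. indicat_real Q y *\<^sub>R dird v r (x - y)) \<in> borel_measurable lborel" for v
        using bm[OF rapid_dird[OF r(1)]] by measurable
    qed simp
    moreover have "\<exists>r'. rapid r' \<and> (\<lambda>x. \<integral>y. indicat_real Q y *\<^sub>R dird v r (x - y) \<partial>lborel) = (\<lambda>x. \<integral>y. indicat_real Q y *\<^sub>R r' (x - y) \<partial>lborel)" for v
      using rapid_dird[OF r(1)] by blast
    ultimately show ?case
      unfolding r(2) by (intro exI[of _ "\<lambda>x v. \<integral>y. indicat_real Q y *\<^sub>R dird v r (x - y) \<partial>lborel"]) simp
  next
    case (3 f k)
    then obtain r where r: "rapid r" "f = (\<lambda>x. \<integral>y. indicat_real Q y *\<^sub>R r (x - y) \<partial>lborel)" by blast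
    obtain C where C: "C > 0" "\<And>x. norm (r x) \<le> C * wt k x" using rapid_bound[OF r(1)] by blast
    have "norm (f x) \<le> (\<integral>y. indicat_real Q y * (C * (1 + R) ^ k * wt k x) \<partial>lborel)" for x
      unfolding r(2)
    proof (rule norm_integral_le)
      fix y
      have "norm (r (x - y)) \<le> C * (1 + R) ^ k * wt k x" if "y \<in> Q"
      proof -
        have "norm (r (x - y)) \<le> C * ((1 + norm y) ^ k * wt k x)"
          using order.trans[OF C(2) mult_left_mono[OF wt_shift[of k "x - y" y]]] C(1) by simp
        also have "\<dots> \<le> C * ((1 + R) ^ k * wt k x)"
          using R(1)[OF that] R(2) C(1) by (intro mult_left_mono mult_right_mono power_mono) auto
        finally show ?thesis by (simp add: mult.assoc)
      qed
      then show "norm (indicat_real Q y *\<^sub>R r (x - y)) \<le> indicat_real Q y * (C * (1 + R) ^ k * wt k x)"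
        by (auto split: split_indicator)
    qed (rule integrable_mult_left[OF iQ])
    then have "norm (f x) \<le> ((\<integral>y. indicat_real Q y \<partial>lborel) * (C * (1 + R) ^ k)) * wt k x" for x
      by (simp add: mult.assoc)
    then show ?case unfolding le_wt_iff by blast
  qed
qed

lemma rapid_mass_one:
  fixes g :: "'a::euclidean_space \<Rightarrow> complex"
  assumes g: "rapid g" "g a \<noteq> 0"
  obtains \<rho> :: "'a \<Rightarrow> complex" where "rapid \<rho>" "(\<integral>x. \<rho> x \<partial>lborel) = 1"
proof -
  let ?I = "\<integral>x. g x * cnj (g x) \<partial>lborel"
  have "?I \<noteq> 0" using rapid_integral_norm_square_zero[OF g(1)] g(2) by blast
  then have "(\<integral>x. inverse ?I * (g x * cnj (g x)) \<partial>lborel) = 1" by (subst integral_mult_right_zero) simp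
  then show ?thesis using that[OF rapid_cmult[OF rapid_mult[OF g(1) rapid_cnj[OF g(1)]]]] by blast
qed

lemma integrable_indicator_box: "integrable lborel (indicat_real (box a b))"
  using emeasure_lborel_box_finite[of a b] by (intro integrable_real_indicator) auto

text \<open>Convolution with an approximate identity. The convolutions converge to the indicator off
  the boundary of the box, a null set, and since the box is bounded they share a majorant of arbitrary
  polynomial decay.\<close>

lemma L2_limit_box:
  fixes a b :: "real ^ 'n::finite"
  assumes \<rho>: "rapid \<rho>" "(\<integral>x. \<rho> (x :: real ^ 'n) \<partial>lborel) = 1"
  shows "L2_limit (\<lambda>x. complex_of_real (indicator (box a b) x))"
proof -
  let ?Q = "box a b" and ?k = "2 * DIM(real ^ 'n)"
  define c where "c n = real (Suc n)" for n
  have c: "c n > 0" "c n \<ge> 1" for n by (simp_all add: c_def)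
  define \<phi> where "\<phi> n x = (\<integral>y. indicat_real ?Q y *\<^sub>R (complex_of_real (c n ^ DIM(real ^ 'n)) * \<rho> (c n *\<^sub>R (x - y))) \<partial>lborel)" for n x
  have bm [measurable]: "\<rho> \<in> borel_measurable borel" by (rule rapid_borel[OF \<rho>(1)])
  have r\<phi>: "rapid (\<phi> n)" for n
  proof -
    have "linear (\<lambda>x::real^'n. c n *\<^sub>R x)" "inj (\<lambda>x::real^'n. c n *\<^sub>R x)"
      using c(1)[of n] by (auto simp: linear_iff inj_on_def algebra_simps)
    then show ?thesis
      unfolding \<phi>_def
      by (intro rapid_convolution_indicator[where r = "\<lambda>u. complex_of_real (c n ^ DIM(real ^ 'n)) * \<rho> (c n *\<^sub>R u)"] rapid_cmult
          rapid_linear_compose[OF _ _ \<rho>(1)]) auto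
  qed
  have \<phi>: "\<phi> n x = (\<integral>u. indicat_real ?Q (x - inverse (c n) *\<^sub>R u) *\<^sub>R \<rho> u \<partial>lborel)" for n x
  proof -
    have "\<phi> n x = (\<integral>y. indicat_real ?Q (x - y) *\<^sub>R (complex_of_real (c n ^ DIM(real ^ 'n)) * \<rho> (c n *\<^sub>R (x - (x - y)))) \<partial>lborel)"
      unfolding \<phi>_def by (rule lborel_integral_reflect[symmetric]) measurable
    also have "\<dots> = (\<integral>y. c n ^ DIM(real ^ 'n) *\<^sub>R (indicat_real ?Q (x - y) *\<^sub>R \<rho> (c n *\<^sub>R y)) \<partial>lborel)"
      by (intro Bochner_Integration.integral_cong refl) (simp add: scaleR_conv_of_real)
    also have "\<dots> = c n ^ DIM(real ^ 'n) *\<^sub>R (\<integral>y. indicat_real ?Q (x - inverse (c n) *\<^sub>R (c n *\<^sub>R y)) *\<^sub>R \<rho> (c n *\<^sub>R y) \<partial>lborel)"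
      using c(1)[of n] by (simp only: integral_scaleR_right) simp
    also have "\<dots> = \<bar>c n\<bar> ^ DIM(real ^ 'n) *\<^sub>R (\<integral>y. indicat_real ?Q (x - inverse (c n) *\<^sub>R (c n *\<^sub>R y)) *\<^sub>R \<rho> (c n *\<^sub>R y) \<partial>lborel)"
      using c(1)[of n] by simp
    also have "\<dots> = (\<integral>u. indicat_real ?Q (x - inverse (c n) *\<^sub>R u) *\<^sub>R \<rho> u \<partial>lborel)"
      by (rule lborel_integral_scale[symmetric]) (use c(1)[of n] in \<open>measurable, simp\<close>)
    finally show ?thesis .
  qed
  obtain R where R: "\<And>y. y \<in> ?Q \<Longrightarrow> norm y \<le> R" "R \<ge> 0" using bounded_box[of a b] unfolding bounded_pos by (meson less_imp_le)
  \<comment> \<open>One half of the order makes the majorant integrable in \<open>u\<close>, the other absorbs the factor in \<open>ind\<close> below.\<close>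
  obtain C where C: "C > 0" "\<And>x. norm (\<rho> x) \<le> C * wt (?k + ?k) x" using rapid_bound[OF \<rho>(1)] by blast
  have ind: "indicat_real ?Q (x - t *\<^sub>R u) \<le> (1 + R) ^ ?k * (1 + norm u) ^ ?k * wt ?k x" if "0 \<le> t" "t \<le> 1" for x u t
  proof (cases "x - t *\<^sub>R u \<in> ?Q")
    case True
    have "norm (t *\<^sub>R u) \<le> norm u" using that mult_right_mono[of t 1 "norm u"] by simp
    then have "norm x \<le> R + norm u" using R(1)[OF True] norm_triangle_ineq[of "x - t *\<^sub>R u" "t *\<^sub>R u"] by simp
    moreover have "(1 + R) * (1 + norm u) = 1 + R + norm u + R * norm u" by (simp add: algebra_simps)
    ultimately have "1 + norm x \<le> (1 + R) * (1 + norm u)" using mult_nonneg_nonneg[OF R(2) norm_ge_zero[of u]] by linarith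
    then have "(1 + norm x) ^ ?k \<le> ((1 + R) * (1 + norm u)) ^ ?k" by (intro power_mono) auto
    then have "(1 + norm x) ^ ?k * wt ?k x \<le> ((1 + R) ^ ?k * (1 + norm u) ^ ?k) * wt ?k x"
      unfolding power_mult_distrib by (intro mult_right_mono) auto
    then show ?thesis using True by simp
  next
    case False then show ?thesis using R(2) by simp
  qed
  define B where "B = (1 + R) ^ ?k * (\<integral>u. C * wt ?k (u :: real ^ 'n) \<partial>lborel)"
  have B: "B \<ge> 0" using R(2) C(1) by (simp add: B_def integral_nonneg_AE)
  have bd: "norm (\<phi> n x) \<le> B * wt ?k x" for n x
  proof -
    have "norm (\<phi> n x) \<le> (\<integral>u. ((1 + R) ^ ?k * wt ?k x) * (C * wt ?k (u :: real ^ 'n)) \<partial>lborel)"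
      unfolding \<phi>
    proof (rule norm_integral_le)
      show "integrable lborel (\<lambda>u::real^'n. ((1 + R) ^ ?k * wt ?k x) * (C * wt ?k u))"
        by (intro integrable_mult_right integrable_wt) simp
      fix u
      have "norm (indicat_real ?Q (x - inverse (c n) *\<^sub>R u) *\<^sub>R \<rho> u) \<le>
        ((1 + R) ^ ?k * (1 + norm u) ^ ?k * wt ?k x) * (C * wt (?k + ?k) u)"
        unfolding norm_scaleR using ind[of "inverse (c n)" x u] c[of n] R(2) C(2)[of u]
        by (intro mult_mono) (auto simp: inverse_le_1_iff)
      also have "\<dots> = ((1 + R) ^ ?k * wt ?k x) * (C * wt ?k u) * ((1 + norm u) ^ ?k * wt ?k u)"
        unfolding wt_add by (simp only: mult_ac)
      finally show "norm (indicat_real ?Q (x - inverse (c n) *\<^sub>R u) *\<^sub>R \<rho> u) \<le> ((1 + R) ^ ?k * wt ?k x) * (C * wt ?k u)"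
        by simp
    qed
    then show ?thesis by (simp add: B_def mult_ac)
  qed
  have lim: "(\<lambda>n. \<phi> n x) \<longlonglongrightarrow> complex_of_real (indicator ?Q x)" if "x \<notin> cbox a b - box a b" for x
  proof -
    have "(\<lambda>n. \<phi> n x) \<longlonglongrightarrow> (\<integral>u. indicat_real ?Q x *\<^sub>R \<rho> u \<partial>lborel)"
      unfolding \<phi>
    proof (rule integral_dominated_convergence[OF _ _ integrable_norm[OF rapid_integrable[OF \<rho>(1)]]])
      show "AE u in lborel. norm (indicat_real ?Q (x - inverse (c n) *\<^sub>R u) *\<^sub>R \<rho> u) \<le> norm (\<rho> u)" for n
        by (auto split: split_indicator)
      show "AE u in lborel. (\<lambda>n. indicat_real ?Q (x - inverse (c n) *\<^sub>R u) *\<^sub>R \<rho> u) \<longlonglongrightarrow> indicat_real ?Q x *\<^sub>R \<rho> u"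
      proof (intro AE_I2 tendsto_scaleR tendsto_const)
        fix u :: "real ^ 'n"
        have "(\<lambda>n. x - inverse (c n) *\<^sub>R u) \<longlonglongrightarrow> x - 0 *\<^sub>R u"
          unfolding c_def by (intro tendsto_diff tendsto_const tendsto_scaleR LIMSEQ_inverse_real_of_nat)
        then have X: "(\<lambda>n. x - inverse (c n) *\<^sub>R u) \<longlonglongrightarrow> x" by simp
        have "eventually (\<lambda>n. indicat_real ?Q (x - inverse (c n) *\<^sub>R u) = indicat_real ?Q x) sequentially"
        proof (cases "x \<in> ?Q")
          case True
          from topological_tendstoD[OF X open_box True] show ?thesis
            by eventually_elim (simp add: True)
        next
          case False
          then have "x \<in> - cbox a b" using that by blast
          from topological_tendstoD[OF X open_Compl[OF closed_cbox] this] show ?thesis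
            by eventually_elim (use False box_subset_cbox[of a b] in \<open>auto simp: indicator_def\<close>)
        qed
        then show "(\<lambda>n. indicat_real ?Q (x - inverse (c n) *\<^sub>R u)) \<longlonglongrightarrow> indicat_real ?Q x"
          by (rule tendsto_eventually)
      qed
    qed measurable
    then show ?thesis by (simp add: \<rho>(2) scaleR_conv_of_real)
  qed
  have wi: "integrable lborel (\<lambda>x::real^'n. ((B + (1 + R) ^ ?k) * wt ?k x)\<^sup>2)"
  proof -
    have "(\<lambda>x::real^'n. ((B + (1 + R) ^ ?k) * wt ?k x)\<^sup>2) = (\<lambda>x. (B + (1 + R) ^ ?k)\<^sup>2 * wt (?k + ?k) x)"
      by (simp only: power_mult_distrib wt_add power2_eq_square mult_ac)
    then show ?thesis by (simp only:) (intro integrable_mult_right integrable_wt, simp)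
  qed
  have ind0: "indicat_real ?Q x \<le> (1 + R) ^ ?k * wt ?k x" for x using ind[of 0 x 0] by simp
  show ?thesis
  proof (rule L2_limit_LIMSEQ[where h = \<phi>])
    show "(\<lambda>x. complex_of_real (indicator ?Q x)) \<in> L2"
    proof (rule L2I)
      have "(\<lambda>x. (norm (complex_of_real (indicator ?Q x)))\<^sup>2) = indicat_real ?Q" by (auto split: split_indicator)
      then show "integrable lborel (\<lambda>x. (norm (complex_of_real (indicator ?Q x)))\<^sup>2)"
        by (simp add: integrable_indicator_box)
    qed measurable
    show "L2_limit (\<phi> n)" for n
      unfolding L2_limit_def using rapid_L2[OF r\<phi>] r\<phi>[of n] by (auto intro!: exI[of _ "\<phi> n"])
    show "(\<lambda>n. L2_norm (\<lambda>x. \<phi> n x - complex_of_real (indicator ?Q x))) \<longlonglongrightarrow> 0"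
    proof (rule L2_dominated_convergence[OF _ _ wi])
      show "\<phi> n \<in> borel_measurable borel" for n by (rule rapid_borel[OF r\<phi>])
      show "AE x in lborel. norm (\<phi> n x - complex_of_real (indicator ?Q x)) \<le> (B + (1 + R) ^ ?k) * wt ?k x" for n
      proof (intro AE_I2)
        fix x
        have "norm (\<phi> n x - complex_of_real (indicator ?Q x)) \<le> norm (\<phi> n x) + norm (complex_of_real (indicator ?Q x))"
          by (rule norm_triangle_ineq4)
        also have "\<dots> \<le> B * wt ?k x + (1 + R) ^ ?k * wt ?k x"
          using bd[of n x] ind0[of x] by (intro add_mono) auto
        finally show "norm (\<phi> n x - complex_of_real (indicator ?Q x)) \<le> (B + (1 + R) ^ ?k) * wt ?k x"
          by (simp add: distrib_right)
      qed
      show "AE x in lborel. (\<lambda>n. \<phi> n x) \<longlonglongrightarrow> complex_of_real (indicator ?Q x)"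
        using AE_not_in[OF null_sets_cbox_Diff_box[of a b]] by eventually_elim (rule lim)
    qed measurable
  qed
qed

text \<open>Boxes are stable under intersection and generate the Borel sets. Cutting with a fixed box keeps all
  measures finite, so that complements correspond to differences and disjoint unions to convergent
  series in \<open>L\<^sup>2\<close>.\<close>

lemma L2_limit_indicator:
  fixes A :: "(real ^ 'n::finite) set"
  assumes \<rho>: "rapid \<rho>" "(\<integral>x. \<rho> (x :: real ^ 'n) \<partial>lborel) = 1"
    and "A \<in> sets borel"
  shows "L2_limit (\<lambda>x. complex_of_real (indicator (A \<inter> box a b) x))"
proof -
  let ?Q = "box a b"
  let ?G = "range (\<lambda>(a, b). box a b :: (real ^ 'n) set)"
  have L2: "(\<lambda>x. complex_of_real (indicator (A \<inter> ?Q) x)) \<in> L2" if [measurable]: "A \<in> sets borel" for A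
  proof (rule L2I)
    have "emeasure lborel (A \<inter> ?Q) < \<infinity>"
      by (rule order.strict_trans1[OF emeasure_mono emeasure_lborel_box_finite[of a b]]) auto
    moreover have "(\<lambda>x. (norm (complex_of_real (indicator (A \<inter> ?Q) x)))\<^sup>2) = indicat_real (A \<inter> ?Q)" by (auto split: split_indicator)
    ultimately show "integrable lborel (\<lambda>x. (norm (complex_of_real (indicator (A \<inter> ?Q) x)))\<^sup>2)" by simp
  qed measurable
  have G: "Int_stable ?G"
    by (force simp: Int_stable_def box_Int_box)
  have A: "A \<in> sigma_sets UNIV ?G" using assms(3) by (subst (asm) borel_eq_box) simp
  have sb: "sigma_sets UNIV ?G = sets borel" by (subst borel_eq_box) simp
  have "?G \<subseteq> Pow UNIV" by simp
  from G this A show ?thesis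
  proof (induction A rule: sigma_sets_induct_disjoint)
    case (basic A)
    then obtain c d where "A = box c d" by auto
    moreover obtain e f where "box c d \<inter> box a b = box e f" by (simp add: box_Int_box)
    ultimately show ?case using L2_limit_box[OF \<rho>] by simp
  next
    case empty then show ?case using L2_limit_zero by simp
  next
    case (compl A)
    have "(\<lambda>x. complex_of_real (indicator ((UNIV - A) \<inter> ?Q) x)) =
      (\<lambda>x. complex_of_real (indicator ?Q x) + (-1) * complex_of_real (indicator (A \<inter> ?Q) x))"
      by (auto split: split_indicator)
    then show ?case
      by (simp only:) (intro L2_limit_add L2_limit_box[OF \<rho>] L2_limit_scale compl)
  next
    case (union A)
    have Am [measurable]: "A i \<in> sets borel" for i using union(2) sb by auto
    define h where "h n x = (\<Sum>i<n. complex_of_real (indicator (A i \<inter> ?Q) x))" for n x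
    have h: "h n x = complex_of_real (indicator ((\<Union>i<n. A i) \<inter> ?Q) x)" for n x
    proof -
      have "disjoint_family_on A {..<n}" using union(1) by (rule disjoint_family_on_mono[OF subset_UNIV])
      then have "indicat_real (\<Union>i<n. A i) x = (\<Sum>i<n. indicat_real (A i) x)"
        by (intro indicator_UN_disjoint) auto
      then show ?thesis
        unfolding h_def by (simp only: indicator_inter_arith of_real_sum of_real_mult sum_distrib_right)
    qed
    show ?case
    proof (rule L2_limit_LIMSEQ[where h = h])
      show "L2_limit (h n)" for n unfolding h_def by (intro L2_limit_sum union)
      show "(\<lambda>x. complex_of_real (indicator (\<Union> (range A) \<inter> ?Q) x)) \<in> L2" by (rule L2) measurable
      have i: "integrable lborel (\<lambda>x. (indicat_real ?Q x)\<^sup>2)"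
        by (simp add: power2_eq_square integrable_indicator_box flip: indicator_inter_arith)
      show "(\<lambda>n. L2_norm (\<lambda>x. h n x - complex_of_real (indicator (\<Union> (range A) \<inter> ?Q) x))) \<longlonglongrightarrow> 0"
      proof (rule L2_dominated_convergence[OF _ _ i])
        show "h n \<in> borel_measurable borel" for n unfolding h_def[abs_def] by measurable
        show "AE x in lborel. norm (h n x - complex_of_real (indicator (\<Union> (range A) \<inter> ?Q) x)) \<le> indicat_real ?Q x" for n
          unfolding h by (intro AE_I2) (auto split: split_indicator)
        show "AE x in lborel. (\<lambda>n. h n x) \<longlonglongrightarrow> complex_of_real (indicator (\<Union> (range A) \<inter> ?Q) x)"
        proof (intro AE_I2)
          fix x
          have "eventually (\<lambda>n. h n x = complex_of_real (indicator (\<Union> (range A) \<inter> ?Q) x)) sequentially"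
          proof (cases "\<exists>i. x \<in> A i")
            case True
            then obtain i where "x \<in> A i" by blast
            then show ?thesis unfolding h
              by (intro eventually_sequentiallyI[of "Suc i"]) (auto simp: indicator_def Suc_le_eq)
          next
            case False then show ?thesis unfolding h by (auto simp: indicator_def)
          qed
          then show "(\<lambda>n. h n x) \<longlonglongrightarrow> complex_of_real (indicator (\<Union> (range A) \<inter> ?Q) x)"
            by (rule tendsto_eventually)
        qed
      qed measurable
    qed
  qed
qed

theorem rapid_dense_L2:
  fixes g f :: "real ^ 'n::finite \<Rightarrow> complex"
  assumes "rapid g" "g a \<noteq> 0" and f: "f \<in> L2"
  shows "L2_limit f"
proof -
  obtain \<rho> :: "real ^ 'n \<Rightarrow> complex" where \<rho>: "rapid \<rho>" "(\<integral>x. \<rho> x \<partial>lborel) = 1" using rapid_mass_one assms by blast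
  have [measurable]: "f \<in> borel_measurable lborel" using L2_borel[OF f] by simp
  obtain s where s: "\<And>i. simple_function lborel (s i)" "\<And>x. (\<lambda>i. s i x) \<longlonglongrightarrow> f x" "\<And>i x. norm (s i x) \<le> 2 * norm (f x)"
  proof -
    have "\<exists>F. (\<forall>i. simple_function lborel (F i)) \<and> (\<forall>x. (\<lambda>i. F i x) \<longlonglongrightarrow> f x) \<and> (\<forall>i x. norm (F i x) \<le> 2 * norm (f x))"
      using borel_measurable_implies_sequence_metric[of f lborel 0] by simp
    then show ?thesis using that by blast
  qed
  define Q where "Q i = box (- (real i *\<^sub>R One)) (real i *\<^sub>R One :: real ^ 'n)" for i
  have [measurable]: "s i \<in> borel_measurable borel" for i using borel_measurable_simple_function[OF s(1)] by simp
  define h where "h i x = complex_of_real (indicator (Q i) x) * s i x" for i x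
  have Qev: "eventually (\<lambda>i. x \<in> Q i) sequentially" for x
  proof -
    obtain m where m: "x \<in> Q m" proof -
      have "x \<in> (\<Union>i::nat. box (- (real i *\<^sub>R One)) (real i *\<^sub>R One))" unfolding UN_box_eq_UNIV by simp
      then show ?thesis using that unfolding Q_def by blast
    qed
    have "Q m \<subseteq> Q i" if "m \<le> i" for i
      unfolding Q_def using that by (auto simp: box_def)
    then show ?thesis using m by (intro eventually_sequentiallyI[of m]) auto
  qed
  show ?thesis
  proof (rule L2_limit_LIMSEQ[OF f, where h = h])
    show "L2_limit (h i)" for i
    proof -
      have "h i x = (\<Sum>y\<in>s i ` UNIV. y * complex_of_real (indicator ((s i -` {y}) \<inter> Q i) x))" for x
        unfolding h_def
        by (subst simple_function_indicator_representation_banach[OF s(1)], simp)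
          (auto simp: sum_distrib_left scaleR_conv_of_real indicator_inter_arith intro!: sum.cong)
      then have "h i = (\<lambda>x. \<Sum>y\<in>s i ` UNIV. y * complex_of_real (indicator ((s i -` {y}) \<inter> Q i) x))" by auto
      moreover have "s i -` {y} \<in> sets borel" for y
        by (rule measurable_sets_borel[of _ borel]) auto
      ultimately show ?thesis unfolding Q_def
        by (simp add: L2_limit_sum L2_limit_scale L2_limit_indicator[OF \<rho>])
    qed
    have w: "integrable lborel (\<lambda>x. (3 * norm (f x))\<^sup>2)"
      using integrable_mult_right[OF L2_integrable[OF f], of 9] by (simp add: power_mult_distrib)
    show "(\<lambda>n. L2_norm (\<lambda>x. h n x - f x)) \<longlonglongrightarrow> 0"
    proof (rule L2_dominated_convergence[OF _ _ w])
      show "h n \<in> borel_measurable borel" for n unfolding h_def[abs_def] Q_def by measurable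
      show "AE x in lborel. norm (h n x - f x) \<le> 3 * norm (f x)" for n
      proof (intro AE_I2)
        fix x
        have "norm (h n x) \<le> 2 * norm (f x)" unfolding h_def using s(3)[of n x] by (auto split: split_indicator)
        then show "norm (h n x - f x) \<le> 3 * norm (f x)" using norm_triangle_ineq4[of "h n x" "f x"] by simp
      qed
      show "AE x in lborel. (\<lambda>n. h n x) \<longlonglongrightarrow> f x"
      proof (intro AE_I2)
        fix x
        have "eventually (\<lambda>n. s n x = h n x) sequentially"
          using Qev[of x] by eventually_elim (simp add: h_def)
        then show "(\<lambda>n. h n x) \<longlonglongrightarrow> f x" using s(2)[of x] by (rule Lim_transform_eventually[rotated])
      qed
    qed (use L2_borel[OF f] in simp)
  qed
qed

section \<open>Continuous functionals on Schwartz functions\<close>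

lemma iter_deriv_linear_comb:
  assumes "rapid f" "rapid g" "vs \<in> lists Basis"
  shows "iter_deriv vs (\<lambda>x. a * f x + b * g x) = (\<lambda>x. a * iter_deriv vs f x + b * iter_deriv vs g x)"
  using assms(3)
proof (induction vs)
  case (Cons v vs)
  have r: "rapid (iter_deriv vs f)" "rapid (iter_deriv vs g)"
    using Cons rapid_iter_deriv assms by auto
  show ?case
  proof
    fix x
    have "((\<lambda>x. a * iter_deriv vs f x + b * iter_deriv vs g x) has_derivative
       (\<lambda>v. a * dird v (iter_deriv vs f) x + b * dird v (iter_deriv vs g) x)) (at x)"
      by (intro has_derivative_add has_derivative_mult_right rapid_has_derivative r)
    from dird_eq[OF this, of v] Cons
    show "iter_deriv (v # vs) (\<lambda>x. a * f x + b * g x) x = a * iter_deriv (v # vs) f x + b * iter_deriv (v # vs) g x"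
      by (simp add: dird_def)
  qed
qed simp

lemma iter_deriv_cmult:
  assumes "rapid f" "vs \<in> lists Basis"
  shows "iter_deriv vs (\<lambda>x. a * f x) = (\<lambda>x. a * iter_deriv vs f x)"
  using iter_deriv_linear_comb[OF assms(1) assms(1) assms(2), of a 0] by simp

lemma iter_deriv_sum:
  assumes "finite I" "\<And>i. i \<in> I \<Longrightarrow> rapid (f i)" "vs \<in> lists Basis"
  shows "iter_deriv vs (\<lambda>x. \<Sum>i\<in>I. c i * f i x) = (\<lambda>x. \<Sum>i\<in>I. c i * iter_deriv vs (f i) x)"
  using assms(1,2)
proof (induction I)
  case empty
  show ?case using iter_deriv_cmult[OF rapid_zero assms(3), of 0] by simp
next
  case (insert i I)
  have "rapid (\<lambda>x. \<Sum>i\<in>I. c i * f i x)" using insert by (intro rapid_sum rapid_cmult) auto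
  with insert iter_deriv_linear_comb[OF _ this assms(3), of "f i" "c i" 1] show ?case by simp
qed

text \<open>Convergence in every Schwartz seminorm, with the rate as an explicit null sequence.\<close>

definition schwartz_conv :: "(nat \<Rightarrow> 'a::euclidean_space \<Rightarrow> complex) \<Rightarrow> ('a \<Rightarrow> complex) \<Rightarrow> bool" where
  "schwartz_conv \<phi> \<Phi> \<longleftrightarrow> (\<forall>n. rapid (\<phi> n)) \<and> rapid \<Phi> \<and>
     (\<forall>k. \<forall>vs\<in>lists Basis. \<exists>c. c \<longlonglongrightarrow> 0 \<and>
        (\<forall>\<^sub>F n in sequentially. \<forall>x. norm (iter_deriv vs (\<phi> n) x - iter_deriv vs \<Phi> x) \<le> c n * wt k x))"

definition schwartz_functional :: "(('a::euclidean_space \<Rightarrow> complex) \<Rightarrow> complex) \<Rightarrow> bool" where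
  "schwartz_functional T \<longleftrightarrow>
     (\<forall>\<phi> \<psi> a b. rapid \<phi> \<longrightarrow> rapid \<psi> \<longrightarrow> T (\<lambda>x. a * \<phi> x + b * \<psi> x) = a * T \<phi> + b * T \<psi>) \<and>
     (\<forall>\<phi> \<Phi>. schwartz_conv \<phi> \<Phi> \<longrightarrow> (\<lambda>n. T (\<phi> n)) \<longlonglongrightarrow> T \<Phi>)"

lemma schwartz_functional_cmult:
  assumes "schwartz_functional T" "rapid f"
  shows "T (\<lambda>x. a * f x) = a * T f"
proof -
  have "T (\<lambda>x. a * f x + 0 * f x) = a * T f + 0 * T f" using assms unfolding schwartz_functional_def by blast
  then show ?thesis by simp
qed

lemma schwartz_functional_sum:
  assumes T: "schwartz_functional T" and "finite I" "\<And>i. i \<in> I \<Longrightarrow> rapid (f i)"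
  shows "T (\<lambda>x. \<Sum>i\<in>I. c i * f i x) = (\<Sum>i\<in>I. c i * T (f i))"
  using assms(2,3)
proof (induction I)
  case empty
  show ?case using schwartz_functional_cmult[OF T rapid_zero, of 0] by simp
next
  case (insert i I)
  have r: "rapid (\<lambda>x. \<Sum>i\<in>I. c i * f i x)" using insert by (intro rapid_sum rapid_cmult) auto
  have "T (\<lambda>x. c i * f i x + 1 * (\<Sum>i\<in>I. c i * f i x)) = c i * T (f i) + 1 * T (\<lambda>x. \<Sum>i\<in>I. c i * f i x)"
    using T insert(4)[of i] r unfolding schwartz_functional_def by blast
  with insert show ?case by simp
qed

text \<open>Mean value inequality on the segment from \<open>z\<close> to \<open>z'\<close>, along which the weight in \<open>z\<close> changes by
  at most a factor \<open>2\<^sup>m\<close>.\<close>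

lemma rapid_lipschitz:
  fixes D :: "'z::euclidean_space \<times> 'a::euclidean_space \<Rightarrow> complex"
  assumes "rapid D"
  obtains C where "C > 0" "\<And>z z' x. dist z' z \<le> 1 \<Longrightarrow> norm (D (z', x) - D (z, x)) \<le> C * dist z' z * wt m z * wt k x"
proof -
  obtain C where C: "C > 0" "\<And>x v. norm (dird v D x) \<le> C * wt (m + k) x * norm v" using rapid_dird_bound[OF assms] by blast
  have "norm (D (z', x) - D (z, x)) \<le> (C * 2 ^ m) * dist z' z * wt m z * wt k x" if d: "dist z' z \<le> 1" for z z' x
  proof -
    have der: "((\<lambda>z. D (z, x)) has_derivative (\<lambda>v. dird (v, 0) D (\<zeta>, x))) (at \<zeta> within cball z 1)" for \<zeta>
    proof -
      have "((\<lambda>z. (z, x)) has_derivative (\<lambda>v. (v, 0))) (at \<zeta> within cball z 1)" by (auto intro!: derivative_eq_intros)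
      from has_derivative_compose[OF this rapid_has_derivative[OF assms]] show ?thesis .
    qed
    have on: "onorm (\<lambda>v. dird (v, 0) D (\<zeta>, x)) \<le> C * 2 ^ m * wt m z * wt k x" if "\<zeta> \<in> cball z 1" for \<zeta>
    proof (rule onorm_le)
      fix v
      have "wt m \<zeta> \<le> (1 + norm (z - \<zeta>)) ^ m * wt m z" using wt_shift[of m \<zeta> "z - \<zeta>"] by simp
      also have "\<dots> \<le> 2 ^ m * wt m z"
        using that by (intro mult_right_mono power_mono) (auto simp: dist_norm)
      finally have w: "wt (m + k) (\<zeta>, x) \<le> 2 ^ m * wt m z * wt k x"
        using wt_Pair_le_prod[of m k \<zeta> x] by (meson mult_right_mono order_trans wt_pos(2))
      have "norm (dird (v, 0) D (\<zeta>, x)) \<le> C * wt (m + k) (\<zeta>, x) * norm (v, 0::'a)" by (rule C)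
      also have "\<dots> \<le> C * (2 ^ m * wt m z * wt k x) * norm v"
        using C(1) w by (intro mult_mono) (auto simp: norm_Pair)
      finally show "norm (dird (v, 0) D (\<zeta>, x)) \<le> C * 2 ^ m * wt m z * wt k x * norm v" by (simp add: mult_ac)
    qed
    have "norm (D (z', x) - D (z, x)) \<le> (C * 2 ^ m * wt m z * wt k x) * norm (z' - z)"
      by (rule differentiable_bound[OF convex_cball der on]) (use d in \<open>auto simp: dist_commute\<close>)
    then show ?thesis by (simp add: dist_norm mult_ac)
  qed
  moreover have "C * 2 ^ m > 0" using C(1) by simp
  ultimately show ?thesis using that by blast
qed

lemma rapid_bound_prod:
  fixes D :: "'z::euclidean_space \<times> 'a::euclidean_space \<Rightarrow> complex"
  assumes "rapid D"
  obtains C where "C > 0" "\<And>z x. norm (D (z, x)) \<le> C * wt m z * wt k x"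
proof -
  obtain C where C: "C > 0" "\<And>x. norm (D x) \<le> C * wt (m + k) x" using rapid_bound[OF assms] by blast
  have "norm (D (z, x)) \<le> C * wt m z * wt k x" for z x
    using order.trans[OF C(2) mult_left_mono[OF wt_Pair_le_prod[of m k z x]]] C(1) by (simp add: mult.assoc)
  with C(1) show ?thesis using that by blast
qed

lemma rapid_iter_deriv_right:
  fixes H :: "'z::euclidean_space \<times> 'a::euclidean_space \<Rightarrow> complex"
  assumes "rapid H" "vs \<in> lists Basis"
  shows "rapid (iter_deriv (map (Pair 0) vs) H)"
  using assms by (intro rapid_iter_deriv) (auto simp: Basis_prod_def)

lemma schwartz_functional_slice_continuous:
  fixes H :: "'z::euclidean_space \<times> 'a::euclidean_space \<Rightarrow> complex"
  assumes T: "schwartz_functional T" and H: "rapid H"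
  shows "continuous_on UNIV (\<lambda>z. T (\<lambda>x. H (z, x)))"
proof (rule continuous_on_sequentiallyI)
  fix u z assume u: "u \<longlonglongrightarrow> (z :: 'z)"
  have "schwartz_conv (\<lambda>n x. H (u n, x)) (\<lambda>x. H (z, x))"
    unfolding schwartz_conv_def
  proof (intro conjI allI ballI rapid_slice_right H)
    fix k :: nat and vs :: "'a list" assume vs: "vs \<in> lists Basis"
    obtain C where C: "C > 0" "\<And>z z' x. dist z' z \<le> 1 \<Longrightarrow>
      norm (iter_deriv (map (Pair 0) vs) H (z', x) - iter_deriv (map (Pair 0) vs) H (z, x)) \<le> C * dist z' z * wt 0 z * wt k x"
      using rapid_lipschitz[OF rapid_iter_deriv_right[OF H vs]] by blast
    have "(\<lambda>n. C * dist (u n) z) \<longlonglongrightarrow> C * 0"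
      by (intro tendsto_mult tendsto_const iffD1[OF tendsto_dist_iff u])
    moreover have "\<forall>\<^sub>F n in sequentially. dist (u n) z < 1" using u by (rule tendstoD) simp
    then have "\<forall>\<^sub>F n in sequentially. \<forall>x. norm (iter_deriv vs (\<lambda>x. H (u n, x)) x - iter_deriv vs (\<lambda>x. H (z, x)) x) \<le> (C * dist (u n) z) * wt k x"
      by eventually_elim (use C(2) in \<open>simp add: iter_deriv_slice[OF H vs]\<close>)
    ultimately show "\<exists>c. c \<longlonglongrightarrow> 0 \<and> (\<forall>\<^sub>F n in sequentially. \<forall>x. norm (iter_deriv vs (\<lambda>x. H (u n, x)) x - iter_deriv vs (\<lambda>x. H (z, x)) x) \<le> c n * wt k x)"
      by (intro exI[of _ "\<lambda>n. C * dist (u n) z"]) simp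
  qed
  then show "(\<lambda>n. T (\<lambda>x. H (u n, x))) \<longlonglongrightarrow> T (\<lambda>x. H (z, x))"
    using T unfolding schwartz_functional_def by blast
qed

text \<open>If the bound failed along a sequence of parameters, the slices could be rescaled to converge
  to \<open>0\<close> in all seminorms while the values of \<open>T\<close> on them stay larger than \<open>1\<close>.\<close>

lemma schwartz_functional_slice_bound:
  fixes H :: "'z::euclidean_space \<times> 'a::euclidean_space \<Rightarrow> complex"
  assumes T: "schwartz_functional T" and H: "rapid H"
  obtains C where "C > 0" "\<And>z. norm (T (\<lambda>x. H (z, x))) \<le> C * wt m z"
proof -
  have "\<exists>C. \<forall>z. norm (T (\<lambda>x. H (z, x))) \<le> C * wt m z"
  proof (rule ccontr)
    assume "\<not> ?thesis"
    then have "\<exists>z. norm (T (\<lambda>x. H (z, x))) > real (Suc n) * wt m z" for n by (meson not_le)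
    then obtain u where u: "\<And>n. norm (T (\<lambda>x. H (u n, x))) > real (Suc n) * wt m (u n)" by metis
    define a where "a n = complex_of_real (inverse (real (Suc n) * wt m (u n)))" for n
    have na: "norm (a n) * (real (Suc n) * wt m (u n)) = 1" for n
    proof -
      have "wt m (u n) \<noteq> 0" using wt_pos(1)[of m "u n"] by linarith
      moreover have "norm (a n) = inverse (real (Suc n) * wt m (u n))"
        unfolding a_def norm_of_real by (rule abs_of_nonneg) simp
      ultimately show ?thesis by (simp add: field_simps del: of_nat_Suc)
    qed
    have "schwartz_conv (\<lambda>n x. a n * H (u n, x)) (\<lambda>x. 0)"
      unfolding schwartz_conv_def
    proof (intro conjI allI ballI)
      show "rapid (\<lambda>x. a n * H (u n, x))" for n by (rule rapid_cmult[OF rapid_slice_right[OF H]])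
      fix k :: nat and vs :: "'a list" assume vs: "vs \<in> lists Basis"
      obtain C where C: "C > 0" "\<And>z x. norm (iter_deriv (map (Pair 0) vs) H (z, x)) \<le> C * wt m z * wt k x"
        using rapid_bound_prod[OF rapid_iter_deriv_right[OF H vs]] by blast
      have z: "iter_deriv vs (\<lambda>x::'a. 0::complex) = (\<lambda>x. 0)" using iter_deriv_cmult[OF rapid_zero vs, of 0] by simp
      have "norm (iter_deriv vs (\<lambda>x. a n * H (u n, x)) x - iter_deriv vs (\<lambda>x. 0) x) \<le> (C * inverse (real (Suc n))) * wt k x" for n x
      proof -
        have "norm (iter_deriv vs (\<lambda>x. a n * H (u n, x)) x - iter_deriv vs (\<lambda>x. 0) x) = norm (a n) * norm (iter_deriv (map (Pair 0) vs) H (u n, x))"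
          by (simp add: z iter_deriv_cmult[OF rapid_slice_right[OF H] vs] iter_deriv_slice[OF H vs] norm_mult)
        also have "\<dots> \<le> norm (a n) * (C * wt m (u n) * wt k x)" by (intro mult_left_mono C) simp
        also have "\<dots> = (norm (a n) * (real (Suc n) * wt m (u n))) * (C * inverse (real (Suc n))) * wt k x"
          by simp
        finally show ?thesis unfolding na by simp
      qed
      moreover have "(\<lambda>n. C * inverse (real (Suc n))) \<longlonglongrightarrow> 0"
        using tendsto_mult[OF tendsto_const LIMSEQ_inverse_real_of_nat, of C] by simp
      ultimately show "\<exists>c. c \<longlonglongrightarrow> 0 \<and> (\<forall>\<^sub>F n in sequentially. \<forall>x. norm (iter_deriv vs (\<lambda>x. a n * H (u n, x)) x - iter_deriv vs (\<lambda>x. 0) x) \<le> c n * wt k x)"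
        by (intro exI[of _ "\<lambda>n. C * inverse (real (Suc n))"]) simp
    qed simp
    then have "(\<lambda>n. T (\<lambda>x. a n * H (u n, x))) \<longlonglongrightarrow> T (\<lambda>x. 0)"
      using T unfolding schwartz_functional_def by blast
    moreover have "T (\<lambda>x. 0) = 0" using schwartz_functional_cmult[OF T rapid_zero, of 0] by simp
    ultimately have "(\<lambda>n. T (\<lambda>x. a n * H (u n, x))) \<longlonglongrightarrow> 0" by simp
    then have "(\<lambda>n. norm (T (\<lambda>x. a n * H (u n, x)))) \<longlonglongrightarrow> 0" by (rule tendsto_norm_zero)
    then have "\<forall>\<^sub>F n in sequentially. norm (T (\<lambda>x. a n * H (u n, x))) < 1" by (rule order_tendstoD) simp
    then obtain n where "norm (T (\<lambda>x. a n * H (u n, x))) < 1" by (auto simp: eventually_sequentially)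
    moreover have "norm (T (\<lambda>x. a n * H (u n, x))) = norm (a n) * norm (T (\<lambda>x. H (u n, x)))"
      by (simp add: schwartz_functional_cmult[OF T rapid_slice_right[OF H]] norm_mult)
    moreover have "norm (a n) * norm (T (\<lambda>x. H (u n, x))) \<ge> norm (a n) * (real (Suc n) * wt m (u n))"
      by (intro mult_left_mono less_imp_le[OF u]) simp
    ultimately show False unfolding na by simp
  qed
  then obtain C where C: "\<And>z. norm (T (\<lambda>x. H (z, x))) \<le> C * wt m z" by blast
  show ?thesis
  proof (rule that[of "max C 1"])
    show "norm (T (\<lambda>x. H (z, x))) \<le> max C 1 * wt m z" for z
      by (rule order.trans[OF C mult_right_mono]) auto
  qed simp
qed

lemma integral_simple_compose:
  fixes F :: "'z::euclidean_space \<Rightarrow> complex"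
  assumes s: "simple_function lborel s" and A [measurable]: "A \<in> sets borel" and bA: "bounded A"
  shows "integrable lborel (\<lambda>z. indicat_real A z *\<^sub>R F (s z))"
    and "(\<integral>z. indicat_real A z *\<^sub>R F (s z) \<partial>lborel) = (\<Sum>v\<in>range s. complex_of_real (measure lborel (s -` {v} \<inter> A)) * F v)"
proof -
  have fin: "finite (range s)" using s by (simp add: simple_function_def)
  have m: "s -` {v} \<inter> A \<in> sets lborel" for v
  proof -
    have "s -` {v} \<inter> space lborel \<in> sets lborel" by (rule simple_functionD(2)[OF s])
    then show ?thesis using A by auto
  qed
  have em: "emeasure lborel (s -` {v} \<inter> A) < \<infinity>" for v
    by (rule emeasure_bounded_finite) (use bA in \<open>auto intro: bounded_subset\<close>)
  have eq: "indicat_real A z *\<^sub>R F (s z) = (\<Sum>v\<in>range s. indicat_real (s -` {v} \<inter> A) z *\<^sub>R F v)" for z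
  proof -
    have "(\<Sum>v\<in>range s. indicat_real (s -` {v} \<inter> A) z *\<^sub>R F v) = (\<Sum>v\<in>range s. if v = s z then indicat_real A z *\<^sub>R F v else 0)"
      by (intro sum.cong refl) (auto simp: indicator_def)
    then show ?thesis using fin by (simp add: sum.delta)
  qed
  have i: "integrable lborel (\<lambda>z. indicat_real (s -` {v} \<inter> A) z *\<^sub>R F v)" for v
    using m em by (intro integrable_scaleR_left) auto
  show "integrable lborel (\<lambda>z. indicat_real A z *\<^sub>R F (s z))"
    unfolding eq by (intro Bochner_Integration.integrable_sum i)
  have "(\<integral>z. indicat_real A z *\<^sub>R F (s z) \<partial>lborel) = (\<Sum>v\<in>range s. \<integral>z. indicat_real (s -` {v} \<inter> A) z *\<^sub>R F v \<partial>lborel)"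
    unfolding eq by (intro Bochner_Integration.integral_sum i)
  also have "\<dots> = (\<Sum>v\<in>range s. complex_of_real (measure lborel (s -` {v} \<inter> A)) * F v)"
    using m em by (intro sum.cong refl) (simp add: scaleR_conv_of_real)
  finally show "(\<integral>z. indicat_real A z *\<^sub>R F (s z) \<partial>lborel) = (\<Sum>v\<in>range s. complex_of_real (measure lborel (s -` {v} \<inter> A)) * F v)" .
qed

text \<open>Let \<open>s i\<close> be simple functions converging to the identity, and \<open>A i\<close> bounded sets on which
  \<open>s i z\<close> is within \<open>1\<close> of \<open>z\<close>. Replacing \<open>z\<close> by \<open>s i z\<close> on \<open>A i\<close> turns the integral into a finite sum
  \<open>S i\<close>, through which \<open>T\<close> passes by linearity. The sums converge in all seminorms, because \<open>H\<close>
  and its derivatives are Lipschitz in \<open>z\<close> with an integrable constant; the values of \<open>T\<close> converge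
  by dominated convergence.\<close>

theorem schwartz_functional_integral:
  fixes H :: "'z::euclidean_space \<times> 'a::euclidean_space \<Rightarrow> complex"
  assumes T: "schwartz_functional T" and H: "rapid H"
  shows "T (\<lambda>x. \<integral>z. H (z, x) \<partial>lborel) = (\<integral>z. T (\<lambda>x. H (z, x)) \<partial>lborel)"
proof -
  let ?m = "2 * DIM('z)"
  let ?F = "\<lambda>z. T (\<lambda>x. H (z, x))"
  have "\<exists>F. (\<forall>i. simple_function lborel (F i)) \<and> (\<forall>z. (\<lambda>i. F i z) \<longlonglongrightarrow> (z :: 'z))"
    using borel_measurable_implies_sequence_metric[of "\<lambda>z::'z. z" lborel 0] by auto
  then obtain s where s: "\<And>i. simple_function lborel (s i)" "\<And>z::'z. (\<lambda>i. s i z) \<longlonglongrightarrow> z" by blast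
  have [measurable]: "s i \<in> borel_measurable borel" for i using borel_measurable_simple_function[OF s(1)] by simp
  define A where "A i = {z. norm z \<le> real i \<and> dist (s i z) z \<le> 1}" for i
  have Am [measurable]: "A i \<in> sets borel" for i unfolding A_def by measurable
  have bA: "bounded (A i)" for i unfolding A_def bounded_iff by blast
  have Aev: "\<forall>\<^sub>F i in sequentially. z \<in> A i" for z
  proof -
    have "\<forall>\<^sub>F i in sequentially. dist (s i z) z < 1" using s(2) by (rule tendstoD) simp
    moreover have "\<forall>\<^sub>F i in sequentially. norm z \<le> real i"
      using eventually_ge_at_top[of "nat \<lceil>norm z\<rceil>"] by eventually_elim linarith
    ultimately show ?thesis by eventually_elim (simp add: A_def)
  qed
  have wtA: "wt k (s i z) \<le> 2 ^ k * wt k z" if "z \<in> A i" for k i z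
  proof -
    have "wt k (s i z) \<le> (1 + norm (z - s i z)) ^ k * wt k z" using wt_shift[of k "s i z" "z - s i z"] by simp
    also have "\<dots> \<le> 2 ^ k * wt k z"
      using that by (intro mult_right_mono power_mono) (auto simp: A_def dist_norm norm_minus_commute)
    finally show ?thesis .
  qed
  define S where "S i x = (\<Sum>v\<in>range (s i). complex_of_real (measure lborel (s i -` {v} \<inter> A i)) * H (v, x))" for i x
  have fin: "finite (range (s i))" for i using s(1)[of i] by (simp add: simple_function_def)
  have rS: "rapid (S i)" for i unfolding S_def by (intro rapid_sum rapid_cmult rapid_slice_right H)
  have TS: "T (S i) = (\<integral>z. indicat_real (A i) z *\<^sub>R ?F (s i z) \<partial>lborel)" for i
    unfolding S_def integral_simple_compose(2)[OF s(1) Am bA, where F = ?F]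
    by (rule schwartz_functional_sum[OF T fin]) (rule rapid_slice_right[OF H])
  obtain C where C: "C > 0" "\<And>z. norm (?F z) \<le> C * wt ?m z" using schwartz_functional_slice_bound[OF T H] by blast
  have cF: "continuous_on UNIV ?F" by (rule schwartz_functional_slice_continuous[OF T H])
  have lim1: "(\<lambda>i. T (S i)) \<longlonglongrightarrow> (\<integral>z. ?F z \<partial>lborel)"
    unfolding TS
  proof (rule integral_dominated_convergence[where w = "\<lambda>z. C * 2 ^ ?m * wt ?m z"])
    show "?F \<in> borel_measurable lborel" using borel_measurable_continuous_onI[OF cF] by simp
    show "(\<lambda>z. indicat_real (A i) z *\<^sub>R ?F (s i z)) \<in> borel_measurable lborel" for i
      by (rule borel_measurable_integrable[OF integral_simple_compose(1)[OF s(1) Am bA]])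
    show "integrable lborel (\<lambda>z::'z. C * 2 ^ ?m * wt ?m z)" by (intro integrable_mult_right integrable_wt) simp
    show "AE z in lborel. (\<lambda>i. indicat_real (A i) z *\<^sub>R ?F (s i z)) \<longlonglongrightarrow> ?F z"
    proof (intro AE_I2)
      fix z
      have "(\<lambda>i. ?F (s i z)) \<longlonglongrightarrow> ?F z"
        by (rule continuous_on_tendsto_compose[OF cF s(2)]) auto
      moreover have "\<forall>\<^sub>F i in sequentially. ?F (s i z) = indicat_real (A i) z *\<^sub>R ?F (s i z)"
        using Aev[of z] by eventually_elim simp
      ultimately show "(\<lambda>i. indicat_real (A i) z *\<^sub>R ?F (s i z)) \<longlonglongrightarrow> ?F z" by (rule Lim_transform_eventually)
    qed
    show "AE z in lborel. norm (indicat_real (A i) z *\<^sub>R ?F (s i z)) \<le> C * 2 ^ ?m * wt ?m z" for i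
    proof (intro AE_I2)
      fix z
      show "norm (indicat_real (A i) z *\<^sub>R ?F (s i z)) \<le> C * 2 ^ ?m * wt ?m z"
        using order.trans[OF C(2)[of "s i z"] mult_left_mono[OF wtA[of z i ?m]]] C(1)
        by (cases "z \<in> A i") (auto simp: mult.assoc)
    qed
  qed
  have "schwartz_conv S (\<lambda>x. \<integral>z. H (z, x) \<partial>lborel)"
    unfolding schwartz_conv_def
  proof (intro conjI allI ballI rS rapid_integral H)
    fix k :: nat and vs :: "'a list" assume vs: "vs \<in> lists Basis"
    define D where "D = iter_deriv (map (Pair 0) vs) H"
    have D: "rapid D" unfolding D_def by (rule rapid_iter_deriv_right[OF H vs])
    obtain L where L: "L > 0" "\<And>z z' x. dist z' z \<le> 1 \<Longrightarrow> norm (D (z', x) - D (z, x)) \<le> L * dist z' z * wt ?m z * wt k x"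
      using rapid_lipschitz[OF D] by blast
    obtain B where B: "B > 0" "\<And>z x. norm (D (z, x)) \<le> B * wt ?m z * wt k x" using rapid_bound_prod[OF D] by blast
    define e where "e i z = (if z \<in> A i then L * dist (s i z) z * wt ?m z else B * wt ?m z)" for i z
    have em [measurable]: "e i \<in> borel_measurable borel" for i unfolding e_def by measurable
    have e: "0 \<le> e i z" "e i z \<le> (L + B) * wt ?m z" for i z
    proof -
      show "0 \<le> e i z" using L(1) B(1) by (simp add: e_def)
      have "L * dist (s i z) z * wt ?m z \<le> L * 1 * wt ?m z" if "z \<in> A i"
        using that L(1) by (intro mult_right_mono mult_left_mono) (auto simp: A_def)
      then show "e i z \<le> (L + B) * wt ?m z" using L(1) B(1) by (auto simp: e_def distrib_right intro: add_increasing add_increasing2)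
    qed
    have ie: "integrable lborel (e i)" for i
      by (rule integrable_wt_bound[of _ ?m "L + B"]) (use e in auto)
    have limc: "(\<lambda>i. \<integral>z. e i z \<partial>lborel) \<longlonglongrightarrow> (\<integral>z. 0 \<partial>(lborel :: 'z measure))"
    proof (rule integral_dominated_convergence[where w = "\<lambda>z. (L + B) * wt ?m z"])
      show "integrable lborel (\<lambda>z::'z. (L + B) * wt ?m z)" by (intro integrable_mult_right integrable_wt) simp
      show "AE z in lborel. (\<lambda>i. e i z) \<longlonglongrightarrow> 0"
      proof (intro AE_I2)
        fix z
        have "(\<lambda>i. L * dist (s i z) z * wt ?m z) \<longlonglongrightarrow> L * 0 * wt ?m z"
          by (intro tendsto_mult tendsto_const iffD1[OF tendsto_dist_iff s(2)])
        moreover have "\<forall>\<^sub>F i in sequentially. L * dist (s i z) z * wt ?m z = e i z"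
          using Aev[of z] by eventually_elim (simp add: e_def)
        ultimately show "(\<lambda>i. e i z) \<longlonglongrightarrow> 0" by (simp add: Lim_transform_eventually)
      qed
    qed (use e in auto)
    have "norm (iter_deriv vs (S i) x - iter_deriv vs (\<lambda>x. \<integral>z. H (z, x) \<partial>lborel) x) \<le> (\<integral>z. e i z \<partial>lborel) * wt k x" for i x
    proof -
      have 1: "iter_deriv vs (S i) x = (\<integral>z. indicat_real (A i) z *\<^sub>R D (s i z, x) \<partial>lborel)"
        unfolding S_def integral_simple_compose(2)[OF s(1) Am bA, where F = "\<lambda>v. D (v, x)"]
        by (subst iter_deriv_sum[OF fin rapid_slice_right[OF H] vs]) (simp add: iter_deriv_slice[OF H vs] D_def)
      have 2: "iter_deriv vs (\<lambda>x. \<integral>z. H (z, x) \<partial>lborel) x = (\<integral>z. D (z, x) \<partial>lborel)"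
        by (simp add: iter_deriv_integral[OF H vs] D_def)
      have "iter_deriv vs (S i) x - iter_deriv vs (\<lambda>x. \<integral>z. H (z, x) \<partial>lborel) x = (\<integral>z. indicat_real (A i) z *\<^sub>R D (s i z, x) - D (z, x) \<partial>lborel)"
        unfolding 1 2
        by (rule Bochner_Integration.integral_diff[symmetric])
          (rule integral_simple_compose(1)[OF s(1) Am bA], rule rapid_integrable[OF rapid_slice_left[OF D]])
      also have "norm \<dots> \<le> (\<integral>z. e i z * wt k x \<partial>lborel)"
      proof (rule norm_integral_le)
        show "integrable lborel (\<lambda>z. e i z * wt k x)" by (rule integrable_mult_left[OF ie])
        show "norm (indicat_real (A i) z *\<^sub>R D (s i z, x) - D (z, x)) \<le> e i z * wt k x" for z
          using L(2)[of "s i z" z x] B(2)[of z x] by (cases "z \<in> A i") (auto simp: e_def A_def)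
      qed
      finally show ?thesis by simp
    qed
    then show "\<exists>c. c \<longlonglongrightarrow> 0 \<and> (\<forall>\<^sub>F n in sequentially. \<forall>x. norm (iter_deriv vs (S n) x - iter_deriv vs (\<lambda>x. \<integral>z. H (z, x) \<partial>lborel) x) \<le> c n * wt k x)"
      using limc by (intro exI[of _ "\<lambda>i. \<integral>z. e i z \<partial>lborel"]) simp
  qed
  then have "(\<lambda>i. T (S i)) \<longlonglongrightarrow> T (\<lambda>x. \<integral>z. H (z, x) \<partial>lborel)"
    using T unfolding schwartz_functional_def by blast
  then show ?thesis using lim1 by (rule LIMSEQ_unique)
qed

section \<open>Relation to the topologies\<close>

text \<open>By induction on the generation of open sets it suffices to consider subbasic ones, which are seminorm
  balls around points \<open>h\<close> other than the limit; this is where the triangle inequality enters.\<close>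

lemma schwartz_conv_limitin:
  fixes \<phi> :: "nat \<Rightarrow> real ^ 'n::finite \<Rightarrow> complex"
  assumes "schwartz_conv \<phi> \<Phi>"
  shows "limitin schwartz_topology \<phi> \<Phi> sequentially"
proof -
  let ?B = "{{f \<in> schwartz. schwartz_seminorm k vs (\<lambda>x. f x - h x) < e} | (h :: real ^ 'n \<Rightarrow> complex) k vs e.
        h \<in> schwartz \<and> vs \<in> lists Basis \<and> e > 0}"
  have r: "rapid (\<phi> n)" "rapid \<Phi>" for n using assms by (auto simp: schwartz_conv_def)
  have idiff: "iter_deriv vs (\<lambda>x. f x - h x) = (\<lambda>x. iter_deriv vs f x - iter_deriv vs h x)"
    if "rapid f" "rapid h" "vs \<in> lists Basis" for f h :: "real ^ 'n \<Rightarrow> complex" and vs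
    using iter_deriv_linear_comb[OF that, of 1 "-1"] by simp
  have zero: "schwartz_seminorm k vs (\<lambda>x::real^'n. f x - f x) = 0" if "rapid f" "vs \<in> lists Basis" for k vs and f :: "real ^ 'n \<Rightarrow> complex"
    unfolding schwartz_seminorm_def idiff[OF that(1) that] by simp
  have basis: "\<forall>\<^sub>F n in sequentially. \<phi> n \<in> U" if U0: "U \<in> ?B" "\<Phi> \<in> U" for U
  proof -
    obtain h k vs e where U: "U = {f \<in> schwartz. schwartz_seminorm k vs (\<lambda>x. f x - h x) < e}"
      and h: "rapid h" and vs: "vs \<in> lists Basis" and "e > 0"
      using U0(1) by (auto simp: schwartz_iff_rapid)
    let ?p = "\<lambda>f. schwartz_seminorm k vs (\<lambda>x. f x - h x)"
    obtain c where c: "c \<longlonglongrightarrow> 0"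
      "\<forall>\<^sub>F n in sequentially. \<forall>x. norm (iter_deriv vs (\<phi> n) x - iter_deriv vs \<Phi> x) \<le> c n * wt k x"
      using assms vs unfolding schwartz_conv_def by blast
    have pd: "?p \<Phi> < e" using U0(2) by (simp add: U)
    have bdd: "bdd_above (range (\<lambda>x. (1 + norm x) ^ k * norm (iter_deriv vs (\<lambda>x. \<Phi> x - h x) x)))"
    proof -
      have "rapid (\<lambda>x. \<Phi> x - h x)" by (rule rapid_diff[OF r(2) h])
      then obtain B where "\<And>x. (1 + norm x) ^ k * norm (iter_deriv vs (\<lambda>x. \<Phi> x - h x) x) \<le> B"
        using vs unfolding rapid_def by blast
      then show ?thesis by (intro bdd_aboveI[of _ B]) auto
    qed
    have "\<forall>\<^sub>F n in sequentially. c n < e - ?p \<Phi>" using order_tendstoD(2)[OF c(1)] pd by simp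
    then show ?thesis using c(2)
    proof eventually_elim
      case (elim n)
      have "?p (\<phi> n) \<le> c n + ?p \<Phi>"
        unfolding schwartz_seminorm_def
      proof (rule cSUP_least)
        fix x
        have "norm (iter_deriv vs (\<lambda>x. \<phi> n x - h x) x) \<le> norm (iter_deriv vs (\<phi> n) x - iter_deriv vs \<Phi> x) + norm (iter_deriv vs (\<lambda>x. \<Phi> x - h x) x)"
          unfolding idiff[OF r(1) h vs] idiff[OF r(2) h vs] using norm_triangle_ineq[of "iter_deriv vs (\<phi> n) x - iter_deriv vs \<Phi> x" "iter_deriv vs \<Phi> x - iter_deriv vs h x"] by simp
        then have "(1 + norm x) ^ k * norm (iter_deriv vs (\<lambda>x. \<phi> n x - h x) x) \<le>
           (1 + norm x) ^ k * norm (iter_deriv vs (\<phi> n) x - iter_deriv vs \<Phi> x) + (1 + norm x) ^ k * norm (iter_deriv vs (\<lambda>x. \<Phi> x - h x) x)"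
          unfolding distrib_left[symmetric] by (rule mult_left_mono) simp
        also have "\<dots> \<le> c n + (SUP x. (1 + norm x) ^ k * norm (iter_deriv vs (\<lambda>x. \<Phi> x - h x) x))"
          using elim(2) by (intro add_mono cSUP_upper bdd) (auto simp: le_wt_iff)
        finally show "(1 + norm x) ^ k * norm (iter_deriv vs (\<lambda>x. \<phi> n x - h x) x) \<le> c n + (SUP x. (1 + norm x) ^ k * norm (iter_deriv vs (\<lambda>x. \<Phi> x - h x) x))" .
      qed simp
      then show ?case using elim(1) r by (simp add: U schwartz_iff_rapid)
    qed
  qed
  have gen: "\<forall>\<^sub>F n in sequentially. \<phi> n \<in> U" if "generate_topology_on ?B U" "\<Phi> \<in> U" for U
    using that
  proof (induction rule: generate_topology_on.induct)
    case (Int a b)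
    then show ?case by (auto intro: eventually_conj)
  next
    case (UN K)
    then obtain a where "a \<in> K" "\<Phi> \<in> a" by blast
    then have "\<forall>\<^sub>F n in sequentially. \<phi> n \<in> a" using UN by blast
    then show ?case by eventually_elim (use \<open>a \<in> K\<close> in blast)
  next
    case (Basis s)
    then show ?case by (rule basis)
  qed auto
  have "\<Phi> \<in> {f \<in> schwartz. schwartz_seminorm 0 [] (\<lambda>x. f x - \<Phi> x) < 1}"
    using r zero[OF r(2), of "[]" 0] by (simp add: schwartz_iff_rapid)
  moreover have "{f \<in> schwartz. schwartz_seminorm 0 [] (\<lambda>x. f x - \<Phi> x) < 1} \<in> ?B"
    using r(2) schwartz_iff_rapid zero_less_one lists.Nil by blast
  ultimately have "\<Phi> \<in> topspace schwartz_topology" unfolding schwartz_topology_def topology_generated_by_topspace by blast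
  then show ?thesis
    unfolding limitin_def using gen by (auto simp: schwartz_topology_def openin_topology_generated_by_iff)
qed

lemma topspace_schwartz: "topspace schwartz_topology = (schwartz :: (real ^ 'n::finite \<Rightarrow> complex) set)"
proof
  show "topspace schwartz_topology \<subseteq> (schwartz :: (real ^ 'n \<Rightarrow> complex) set)"
    unfolding schwartz_topology_def topology_generated_by_topspace by blast
  show "(schwartz :: (real ^ 'n \<Rightarrow> complex) set) \<subseteq> topspace schwartz_topology"
  proof
    fix f :: "real ^ 'n \<Rightarrow> complex" assume "f \<in> schwartz"
    then have "rapid f" by (simp add: schwartz_iff_rapid)
    then have "schwartz_conv (\<lambda>n. f) f" unfolding schwartz_conv_def by (auto intro!: exI[of _ "\<lambda>n. 0"])
    then show "f \<in> topspace schwartz_topology" by (rule limitin_topspace[OF schwartz_conv_limitin])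
  qed
qed

lemma tempered_functional:
  fixes S :: "(real ^ 'n::finite \<Rightarrow> complex) \<Rightarrow> complex"
  assumes "S \<in> tempered"
  shows "schwartz_functional S"
  unfolding schwartz_functional_def
proof (intro conjI allI impI)
  show "S (\<lambda>x. a * \<phi> x + b * \<psi> x) = a * S \<phi> + b * S \<psi>" if "rapid \<phi>" "rapid \<psi>" for a b \<phi> \<psi>
    using assms that unfolding tempered_def by (simp add: schwartz_iff_rapid)
  fix \<phi> and \<Phi> :: "real ^ 'n \<Rightarrow> complex" assume "schwartz_conv \<phi> \<Phi>"
  then have "limitin schwartz_topology \<phi> \<Phi> sequentially" by (rule schwartz_conv_limitin)
  moreover have "continuous_map schwartz_topology euclidean S" using assms by (simp add: tempered_def)
  ultimately have "limitin euclidean (S \<circ> \<phi>) (S \<Phi>) sequentially" by (rule continuous_map_limit[rotated])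
  then show "(\<lambda>n. S (\<phi> n)) \<longlonglongrightarrow> S \<Phi>" by (simp add: o_def)
qed

lemma operator_functionals:
  fixes A :: "'n::finite distr_op"
  assumes A: "continuous_linear_S_S' A"
  shows "rapid \<phi> \<Longrightarrow> schwartz_functional (A \<phi>)"
    and "rapid \<theta> \<Longrightarrow> schwartz_functional (\<lambda>\<phi>. A \<phi> \<theta>)"
proof -
  have cont: "continuous_map schwartz_topology tempered_topology A" using A by (simp add: continuous_linear_S_S'_def)
  show "schwartz_functional (A \<phi>)" if "rapid \<phi>" for \<phi>
  proof (rule tempered_functional)
    have "A \<phi> \<in> topspace tempered_topology"
      using continuous_map_image_subset_topspace[OF cont] that by (auto simp: topspace_schwartz schwartz_iff_rapid)
    then show "A \<phi> \<in> tempered" unfolding tempered_topology_def topology_generated_by_topspace by blast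
  qed
  assume \<theta>: "rapid \<theta>"
  show "schwartz_functional (\<lambda>\<phi>. A \<phi> \<theta>)"
    unfolding schwartz_functional_def
  proof (intro conjI allI impI)
    show "A (\<lambda>x. a * \<phi> x + b * \<psi> x) \<theta> = a * A \<phi> \<theta> + b * A \<psi> \<theta>" if "rapid \<phi>" "rapid \<psi>" for a b \<phi> \<psi>
      using A that \<theta> unfolding continuous_linear_S_S'_def by (simp add: schwartz_iff_rapid)
    fix \<phi> and \<Phi> :: "real ^ 'n \<Rightarrow> complex" assume "schwartz_conv \<phi> \<Phi>"
    then have "limitin schwartz_topology \<phi> \<Phi> sequentially" by (rule schwartz_conv_limitin)
    from continuous_map_limit[OF cont this] have lim: "limitin tempered_topology (A \<circ> \<phi>) (A \<Phi>) sequentially" .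
    show "(\<lambda>n. A (\<phi> n) \<theta>) \<longlonglongrightarrow> A \<Phi> \<theta>"
    proof (rule topological_tendstoI)
      fix U assume U: "open U" "A \<Phi> \<theta> \<in> U"
      let ?V = "{S \<in> tempered. S \<theta> \<in> U}"
      have "openin tempered_topology ?V"
        unfolding tempered_topology_def openin_topology_generated_by_iff
        by (rule generate_topology_on.Basis) (use U \<theta> schwartz_iff_rapid in blast)
      moreover have "A \<Phi> \<in> tempered" using limitin_topspace[OF lim] unfolding tempered_topology_def topology_generated_by_topspace by blast
      ultimately have "\<forall>\<^sub>F n in sequentially. (A \<circ> \<phi>) n \<in> ?V" using lim U unfolding limitin_def by blast
      then show "\<forall>\<^sub>F n in sequentially. A (\<phi> n) \<theta> \<in> U" by eventually_elim simp
    qed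
  qed
qed

section \<open>The short-time Fourier transform\<close>

lemma phase_shift_cis: "phase_shift z g y = cis (y \<bullet> snd z) * g (y - fst z)"
  by (simp add: phase_shift_def cis_conv_exp)

lemma norm_phase_shift [simp]: "norm (phase_shift z g y) = norm (g (y - fst z))"
  by (simp add: phase_shift_cis norm_mult)

text \<open>The function \<open>z \<mapsto> \<langle>f, \<pi>(z)g\<rangle>\<close> on phase space.\<close>

definition stft :: "(real ^ 'n::finite \<Rightarrow> complex) \<Rightarrow> (real ^ 'n \<Rightarrow> complex) \<Rightarrow> 'n phase \<Rightarrow> complex" where
  "stft g f z = (\<integral>y. f y * cnj (phase_shift z g y) \<partial>lborel)"

lemma rapid_phase_shift:
  assumes "rapid g"
  shows "rapid (phase_shift z g)"
proof -
  have "rapid (\<lambda>y. cis (y \<bullet> snd z) * g (y + - fst z))"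
    by (rule rapid_mult_cis[where \<beta> = "\<lambda>x v. 0" and \<gamma> = "\<lambda>v. v \<bullet> snd z"])
      (auto intro!: derivative_eq_intros rapid_translate[OF assms, of "- fst z", simplified] simp: linear_iff)
  then show ?thesis by (simp add: phase_shift_cis[abs_def])
qed

lemma rapid_phase_family:
  fixes W :: "'n::finite phase \<Rightarrow> complex"
  assumes "rapid W" "rapid g"
  shows "rapid (\<lambda>u. W (fst u) * phase_shift (fst u) g (snd u))"
proof -
  let ?L = "\<lambda>u::'n phase \<times> (real ^ 'n). (fst u, snd u - fst (fst u))"
  have "linear ?L" "inj ?L" by (auto simp: linear_iff inj_on_def algebra_simps)
  from rapid_linear_compose[OF this rapid_tensor[OF assms]]
  have r: "rapid (\<lambda>u::'n phase \<times> (real ^ 'n). W (fst u) * g (snd u - fst (fst u)))" by simp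
  have "rapid (\<lambda>u::'n phase \<times> (real ^ 'n). cis (snd u \<bullet> snd (fst u)) * (W (fst u) * g (snd u - fst (fst u))))"
  proof (rule rapid_mult_cis[where \<beta> = "\<lambda>x v. snd x \<bullet> snd (fst v) + snd v \<bullet> snd (fst x)" and \<gamma> = "\<lambda>v. 0", OF _ _ r])
    show "((\<lambda>u::'n phase \<times> (real ^ 'n). snd u \<bullet> snd (fst u)) has_derivative
      (\<lambda>v. snd x \<bullet> snd (fst v) + snd v \<bullet> snd (fst x) + 0)) (at x)" for x
      by (auto intro!: derivative_eq_intros)
    show "linear (\<lambda>x::'n phase \<times> (real ^ 'n). snd x \<bullet> snd (fst v) + snd v \<bullet> snd (fst x))" for v
      by (auto simp: linear_iff inner_left_distrib inner_right_distrib algebra_simps)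
  qed
  then show ?thesis by (simp add: phase_shift_cis mult.left_commute)
qed

lemma stft_eq_partial_fourier:
  "stft g f = partial_fourier (\<lambda>u. f (fst u) * cnj (g (fst u - snd u)))"
  by (rule ext) (simp add: stft_def partial_fourier_def phase_shift_cis cis_cnj mult_ac)

lemma rapid_stft:
  assumes "rapid g" "rapid f"
  shows "rapid (stft g f)"
proof -
  let ?L = "\<lambda>u::(real ^ 'a) \<times> (real ^ 'a). (fst u, fst u - snd u)"
  have "linear ?L" "inj ?L" by (auto simp: linear_iff inj_on_def algebra_simps)
  from rapid_linear_compose[OF this rapid_tensor[OF assms(2) rapid_cnj[OF assms(1)]]]
  show ?thesis unfolding stft_eq_partial_fourier by (intro rapid_partial_fourier) simp
qed

text \<open>At a fixed position \<open>p\<close> the transform is the Fourier transform of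
  \<open>y \<mapsto> f(y) cnj (g(y - p))\<close>. Inverting it and integrating over \<open>p\<close> leaves \<open>f\<close> times
  \<open>C \<integral> |g|\<^sup>2\<close>.\<close>

theorem stft_inversion:
  fixes g :: "real ^ 'n::finite \<Rightarrow> complex"
  assumes g: "rapid g" "g a \<noteq> 0"
  obtains K where "K \<noteq> 0" "\<And>f x. rapid f \<Longrightarrow> (\<integral>z. stft g f z * phase_shift z g x \<partial>lborel) = K * f x"
proof -
  obtain C where C: "C \<noteq> 0" "\<And>h x. rapid h \<Longrightarrow> (\<integral>\<xi>. cis (x \<bullet> \<xi>) * fourier h \<xi> \<partial>lborel) = C * (h (x :: real ^ 'n))"
    using fourier_inversion[OF g] by blast
  let ?G = "\<integral>x. g x * cnj (g x) \<partial>lborel"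
  have G: "?G \<noteq> 0" using rapid_integral_norm_square_zero[OF g(1)] g(2) by blast
  have "(\<integral>z. stft g f z * phase_shift z g x \<partial>lborel) = (C * ?G) * f x" if f: "rapid f" for f x
  proof -
    have "rapid (\<lambda>z. stft g f z * phase_shift z g x)"
      using rapid_slice_left[OF rapid_phase_family[OF rapid_stft[OF g(1) f] g(1)], of x] by simp
    then have i: "integrable (lborel \<Otimes>\<^sub>M lborel) (\<lambda>z. stft g f z * phase_shift z g x)"
      unfolding lborel_prod by (rule rapid_integrable)
    have "(\<integral>z. stft g f z * phase_shift z g x \<partial>lborel) = (\<integral>p. \<integral>\<xi>. stft g f (p, \<xi>) * phase_shift (p, \<xi>) g x \<partial>lborel \<partial>lborel)"
      using lborel_pair.integral_fst'[OF i] by (simp add: lborel_prod)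
    also have "\<dots> = (\<integral>p. (C * f x) * (g (x - p) * cnj (g (x - p))) \<partial>lborel)"
    proof (rule Bochner_Integration.integral_cong[OF refl])
      fix p :: "real ^ 'n"
      let ?h = "\<lambda>y. f y * cnj (g (y + - p))"
      have h: "rapid ?h" by (intro rapid_mult f rapid_cnj rapid_translate g)
      have "stft g f (p, \<xi>) * phase_shift (p, \<xi>) g x = g (x - p) * (cis (x \<bullet> \<xi>) * fourier ?h \<xi>)" for \<xi>
        by (simp add: stft_eq_partial_fourier partial_fourier_def fourier_def phase_shift_cis)
      then have "(\<integral>\<xi>. stft g f (p, \<xi>) * phase_shift (p, \<xi>) g x \<partial>lborel) = g (x - p) * (C * ?h x)"
        by (simp only: integral_mult_right_zero C(2)[OF h])
      then show "(\<integral>\<xi>. stft g f (p, \<xi>) * phase_shift (p, \<xi>) g x \<partial>lborel) = (C * f x) * (g (x - p) * cnj (g (x - p)))"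
        by (simp add: mult_ac)
    qed
    also have "\<dots> = (C * f x) * (\<integral>p. g (x - p) * cnj (g (x - p)) \<partial>lborel)" by simp
    also have "(\<integral>p. g (x - p) * cnj (g (x - p)) \<partial>lborel) = ?G"
      using lborel_integral_reflect[OF rapid_borel[OF rapid_mult[OF g(1) rapid_cnj[OF g(1)]]], of x] .
    finally show ?thesis by (simp add: mult_ac)
  qed
  moreover have "C * ?G \<noteq> 0" using C(1) G by simp
  ultimately show ?thesis using that by blast
qed

lemma phase_shift_L2:
  assumes "rapid g"
  shows "phase_shift z g \<in> L2" "L2_norm (phase_shift z g) = L2_norm g"
proof -
  show "phase_shift z g \<in> L2" by (rule rapid_L2[OF rapid_phase_shift[OF assms]])
  have "(\<lambda>x. (norm (g x))\<^sup>2) \<in> borel_measurable borel" using rapid_borel[OF assms] by measurable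
  from lborel_integral_shift[OF this, of "- fst z"] show "L2_norm (phase_shift z g) = L2_norm g"
    by (simp add: L2_norm_def)
qed

lemma stft_integrable:
  assumes "rapid g" "f \<in> L2"
  shows "integrable lborel (\<lambda>y. f y * cnj (phase_shift z g y))"
  by (rule L2_Cauchy_Schwarz(1)[OF assms(2) L2_cnj(1)[OF phase_shift_L2(1)[OF assms(1)]]])

lemma norm_stft_le:
  assumes "rapid g" "f \<in> L2"
  shows "norm (stft g f z) \<le> L2_norm f * L2_norm g"
  unfolding stft_def
  using L2_Cauchy_Schwarz(3)[OF assms(2) L2_cnj(1)[OF phase_shift_L2(1)[OF assms(1), of z]]]
  by (simp add: L2_cnj(2)[OF phase_shift_L2(1)[OF assms(1)]] phase_shift_L2(2)[OF assms(1)])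

lemma stft_diff:
  assumes "rapid g" "f \<in> L2" "h \<in> L2"
  shows "stft g (\<lambda>x. f x - h x) z = stft g f z - stft g h z"
  unfolding stft_def left_diff_distrib
  by (rule Bochner_Integration.integral_diff) (rule stft_integrable[OF assms(1)], fact)+

lemma stft_linear:
  assumes "rapid g" "f \<in> L2" "h \<in> L2"
  shows "stft g (\<lambda>x. p * f x + q * h x) z = p * stft g f z + q * stft g h z"
proof -
  have "stft g (\<lambda>x. p * f x + q * h x) z = (\<integral>y. p * (f y * cnj (phase_shift z g y)) + q * (h y * cnj (phase_shift z g y)) \<partial>lborel)"
    unfolding stft_def by (simp add: distrib_right mult.assoc)
  then show ?thesis
    unfolding stft_def by (simp add: stft_integrable[OF assms(1,2)] stft_integrable[OF assms(1,3)])
qed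

lemma norm_stft_le_integral: "norm (stft g f z) \<le> (\<integral>y. norm (phase_shift z g y * f y) \<partial>lborel)"
  unfolding stft_def by (rule order.trans[OF integral_norm_bound]) (simp add: norm_mult mult.commute)

lemma integral_phase_shift_mult:
  "(\<integral>x. phase_shift z g x * f x \<partial>lborel) = cnj (stft g (\<lambda>x. cnj (f x)) z)"
  unfolding stft_def Bochner_Integration.integral_cnj[symmetric] by (simp add: mult.commute)

lemma borel_measurable_phase_shift_pair:
  fixes g :: "real ^ 'n::finite \<Rightarrow> complex"
  assumes "rapid g"
  shows "(\<lambda>u::'n phase \<times> (real ^ 'n). phase_shift (fst u) g (snd u)) \<in> borel_measurable borel"
proof -
  have "continuous_on UNIV (\<lambda>u::'n phase \<times> (real ^ 'n). cis (snd u \<bullet> snd (fst u)) * g (snd u - fst (fst u)))"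
    by (intro continuous_on_mult continuous_on_cis continuous_on_compose2[OF rapid_continuous_on[OF assms, of UNIV]] continuous_intros) auto
  then show ?thesis by (simp add: phase_shift_cis borel_measurable_continuous_onI)
qed

lemma borel_measurable_superposition:
  fixes W :: "'n::finite phase \<Rightarrow> complex"
  assumes "rapid g" "W \<in> borel_measurable borel"
  shows "(\<lambda>x. \<integral>z. W z * phase_shift z g x \<partial>lborel) \<in> borel_measurable borel"
proof -
  have "(\<lambda>u::'n phase \<times> (real ^ 'n). W (fst u) * phase_shift (fst u) g (snd u)) \<in> borel_measurable (lborel \<Otimes>\<^sub>M lborel)"
    using borel_measurable_times[OF measurable_compose[OF borel_measurable_continuous_onI[OF continuous_on_fst[OF continuous_on_id]] assms(2)]
      borel_measurable_phase_shift_pair[OF assms(1)]]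
    by (simp add: lborel_prod)
  from measurable_compose[OF measurable_pair_swap' this]
  have "(\<lambda>(x, z). W z * phase_shift z g x) \<in> borel_measurable (lborel \<Otimes>\<^sub>M lborel)"
    by (simp add: case_prod_beta')
  then have "(\<lambda>x. \<integral>z. W z * phase_shift z g x \<partial>lborel) \<in> borel_measurable lborel"
    by (rule lborel.borel_measurable_lebesgue_integral)
  then show ?thesis by simp
qed

text \<open>Exchange of the superposition over phase space with integration against \<open>f\<close>.\<close>

lemma phase_space_Fubini:
  fixes W :: "'n::finite phase \<Rightarrow> complex" and f :: "real ^ 'n \<Rightarrow> complex"
  assumes g: "rapid g" and W: "W \<in> borel_measurable borel" and f: "f \<in> borel_measurable borel"
    and i: "\<And>z. integrable lborel (\<lambda>x. phase_shift z g x * f x)"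
    and b: "\<And>z. (\<integral>x. norm (phase_shift z g x * f x) \<partial>lborel) \<le> b z"
    and ib: "integrable lborel (\<lambda>z. norm (W z) * b z)"
  shows "(\<integral>x. (\<integral>z. W z * phase_shift z g x \<partial>lborel) * f x \<partial>lborel) = (\<integral>z. W z * (\<integral>x. phase_shift z g x * f x \<partial>lborel) \<partial>lborel)"
proof -
  let ?F = "\<lambda>z x. W z * (phase_shift z g x * f x)"
  have m: "(\<lambda>u. ?F (fst u) (snd u)) \<in> borel_measurable borel"
  proof (intro borel_measurable_times)
    show "(\<lambda>u::'n phase \<times> (real ^ 'n). W (fst u)) \<in> borel_measurable borel"
      by (rule measurable_compose[OF borel_measurable_continuous_onI W]) (intro continuous_intros)
    show "(\<lambda>u::'n phase \<times> (real ^ 'n). f (snd u)) \<in> borel_measurable borel"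
      by (rule measurable_compose[OF borel_measurable_continuous_onI f]) (intro continuous_intros)
    show "(\<lambda>u::'n phase \<times> (real ^ 'n). phase_shift (fst u) g (snd u)) \<in> borel_measurable borel"
      by (rule borel_measurable_phase_shift_pair[OF g])
  qed
  then have m': "case_prod ?F \<in> borel_measurable (lborel \<Otimes>\<^sub>M lborel)" by (simp add: lborel_prod case_prod_beta')
  have "integrable (lborel \<Otimes>\<^sub>M lborel) (case_prod ?F)"
  proof (rule lborel_pair.Fubini_integrable[OF m'])
    show "AE z in lborel. integrable lborel (\<lambda>x. case_prod ?F (z, x))" using i by simp
    show "integrable lborel (\<lambda>z. \<integral>x. norm (case_prod ?F (z, x)) \<partial>lborel)"
    proof (rule Bochner_Integration.integrable_bound[OF ib])
      have "(\<lambda>u. norm (case_prod ?F u)) \<in> borel_measurable (lborel \<Otimes>\<^sub>M lborel)" using m' by measurable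
      then show "(\<lambda>z. \<integral>x. norm (case_prod ?F (z, x)) \<partial>lborel) \<in> borel_measurable lborel"
        by (intro lborel.borel_measurable_lebesgue_integral) (simp only: case_prod_beta' fst_conv snd_conv)
      show "AE z in lborel. norm (\<integral>x. norm (case_prod ?F (z, x)) \<partial>lborel) \<le> norm (norm (W z) * b z)"
      proof (intro AE_I2)
        fix z
        have nn: "0 \<le> (\<integral>x. norm (phase_shift z g x * f x) \<partial>lborel)" by (simp add: integral_nonneg_AE)
        have "(\<integral>x. norm (case_prod ?F (z, x)) \<partial>lborel) = norm (W z) * (\<integral>x. norm (phase_shift z g x * f x) \<partial>lborel)"
          by (simp add: norm_mult)
        also have "norm \<dots> \<le> norm (norm (W z) * b z)"
          unfolding real_norm_def abs_mult using b[of z] nn by (intro mult_mono) auto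
        finally show "norm (\<integral>x. norm (case_prod ?F (z, x)) \<partial>lborel) \<le> norm (norm (W z) * b z)" .
      qed
    qed
  qed
  from lborel_pair.Fubini_integral[OF this]
  have "(\<integral>x. \<integral>z. ?F z x \<partial>lborel \<partial>lborel) = (\<integral>z. \<integral>x. ?F z x \<partial>lborel \<partial>lborel)" .
  moreover have "(\<integral>z. ?F z x \<partial>lborel) = (\<integral>z. W z * phase_shift z g x \<partial>lborel) * f x" for x
    by (simp flip: integral_mult_left_zero) (simp add: mult.assoc)
  ultimately show ?thesis by simp
qed

lemma phase_space_Fubini_L2:
  fixes W :: "'n::finite phase \<Rightarrow> complex" and f :: "real ^ 'n \<Rightarrow> complex"
  assumes g: "rapid g" and W: "integrable lborel W" and f: "f \<in> L2"
  shows "(\<integral>x. (\<integral>z. W z * phase_shift z g x \<partial>lborel) * f x \<partial>lborel) = (\<integral>z. W z * cnj (stft g (\<lambda>x. cnj (f x)) z) \<partial>lborel)"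
proof -
  have "(\<integral>x. (\<integral>z. W z * phase_shift z g x \<partial>lborel) * f x \<partial>lborel) = (\<integral>z. W z * (\<integral>x. phase_shift z g x * f x \<partial>lborel) \<partial>lborel)"
  proof (rule phase_space_Fubini[OF g _ L2_borel[OF f]])
    show "W \<in> borel_measurable borel" using borel_measurable_integrable[OF W] by simp
    show "integrable lborel (\<lambda>x. phase_shift z g x * f x)" for z by (rule L2_Cauchy_Schwarz(1)[OF phase_shift_L2(1)[OF g] f])
    show "(\<integral>x. norm (phase_shift z g x * f x) \<partial>lborel) \<le> L2_norm g * L2_norm f" for z
      using L2_Cauchy_Schwarz(2)[OF phase_shift_L2(1)[OF g, of z] f] by (simp add: phase_shift_L2(2)[OF g])
    show "integrable lborel (\<lambda>z. norm (W z) * (L2_norm g * L2_norm f))" by (intro integrable_mult_left integrable_norm W)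
  qed
  then show ?thesis by (simp only: integral_phase_shift_mult)
qed

text \<open>Pairing the inversion formula with the conjugate of \<open>f\<close> shows that the transform is an isometry up to
  the factor \<open>|K|\<close> on rapidly decreasing functions. For \<open>f\<close> in \<open>L\<^sup>2\<close>, approximants converge
  pointwise after transformation, and Fatou's lemma preserves the bound.\<close>

theorem stft_bounded:
  fixes g :: "real ^ 'n::finite \<Rightarrow> complex"
  assumes g: "rapid g" "g a \<noteq> 0"
  obtains M where "M > 0" "\<And>f. f \<in> L2 \<Longrightarrow> stft g f \<in> borel_measurable borel"
    "\<And>f. f \<in> L2 \<Longrightarrow> integrable lborel (\<lambda>z. (norm (stft g f z))\<^sup>2)"
    "\<And>f. f \<in> L2 \<Longrightarrow> (\<integral>z. (norm (stft g f z))\<^sup>2 \<partial>lborel) \<le> (M * L2_norm f)\<^sup>2"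
proof -
  obtain K where K: "K \<noteq> 0" "\<And>f x. rapid f \<Longrightarrow> (\<integral>z. stft g f z * phase_shift z g x \<partial>lborel) = K * f x"
    using stft_inversion[OF g] by blast
  define M where "M = sqrt (norm K)"
  have M: "M > 0" using K(1) by (simp add: M_def)
  have rap: "(\<integral>\<^sup>+z. ennreal ((norm (stft g f z))\<^sup>2) \<partial>lborel) = ennreal ((M * L2_norm f)\<^sup>2)" if f: "rapid f" for f
  proof -
    have r: "rapid (stft g f)" by (rule rapid_stft[OF g(1) f])
    have "(\<integral>x. (\<integral>z. stft g f z * phase_shift z g x \<partial>lborel) * cnj (f x) \<partial>lborel) = (\<integral>z. stft g f z * cnj (stft g f z) \<partial>lborel)"
      using phase_space_Fubini_L2[OF g(1) rapid_integrable[OF r] L2_cnj(1)[OF rapid_L2[OF f]]] by simp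
    then have "(\<integral>z. stft g f z * cnj (stft g f z) \<partial>lborel) = K * (\<integral>x. f x * cnj (f x) \<partial>lborel)"
      by (simp add: K(2)[OF f] mult.assoc)
    then have "complex_of_real (\<integral>z. (norm (stft g f z))\<^sup>2 \<partial>lborel) = K * complex_of_real ((L2_norm f)\<^sup>2)"
      unfolding L2_norm_square by (simp only: norm_square_mult_cnj flip: integral_complex_of_real)
    then have "norm (complex_of_real (\<integral>z. (norm (stft g f z))\<^sup>2 \<partial>lborel)) = norm K * (L2_norm f)\<^sup>2"
      by (simp add: norm_mult norm_power)
    then have "(\<integral>z. (norm (stft g f z))\<^sup>2 \<partial>lborel) = (M * L2_norm f)\<^sup>2"
      by (simp add: M_def power_mult_distrib integral_nonneg_AE)
    moreover have "integrable lborel (\<lambda>z. (norm (stft g f z))\<^sup>2)"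
    proof -
      have "integrable lborel (\<lambda>x. Re (stft g f x * cnj (stft g f x)))"
        by (rule integrable_Re[OF rapid_integrable[OF rapid_mult[OF r rapid_cnj[OF r]]]])
      then show ?thesis by (simp only: Re_complex_of_real flip: norm_square_mult_cnj)
    qed
    ultimately show ?thesis by (simp add: nn_integral_eq_integral)
  qed
  have gen: "stft g f \<in> borel_measurable borel \<and> (\<integral>\<^sup>+z. ennreal ((norm (stft g f z))\<^sup>2) \<partial>lborel) \<le> ennreal ((M * L2_norm f)\<^sup>2)"
    if f: "f \<in> L2" for f
  proof -
    have "\<exists>\<phi>. rapid \<phi> \<and> L2_norm (\<lambda>x. f x - \<phi> x) < inverse (real (Suc n))" for n
      using rapid_dense_L2[OF g f] unfolding L2_limit_def by simp
    then obtain \<phi> where \<phi>: "\<And>n. rapid (\<phi> n)" "\<And>n. L2_norm (\<lambda>x. f x - \<phi> n x) < inverse (real (Suc n))" by metis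
    have conv: "(\<lambda>n. stft g (\<phi> n) z) \<longlonglongrightarrow> stft g f z" for z
    proof (rule LIM_zero_cancel[OF Lim_null_comparison[OF always_eventually[OF allI]]])
      show "norm (stft g (\<phi> n) z - stft g f z) \<le> inverse (real (Suc n)) * L2_norm g" for n
      proof -
        have "norm (stft g (\<phi> n) z - stft g f z) = norm (stft g (\<lambda>x. f x - \<phi> n x) z)"
          by (simp add: stft_diff[OF g(1) f rapid_L2[OF \<phi>(1)]] norm_minus_commute)
        also have "\<dots> \<le> L2_norm (\<lambda>x. f x - \<phi> n x) * L2_norm g" by (rule norm_stft_le[OF g(1) L2_diff(1)[OF f rapid_L2[OF \<phi>(1)]]])
        also have "\<dots> \<le> inverse (real (Suc n)) * L2_norm g" by (intro mult_right_mono less_imp_le[OF \<phi>(2)]) simp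
        finally show ?thesis .
      qed
      show "(\<lambda>n. inverse (real (Suc n)) * L2_norm g) \<longlonglongrightarrow> 0"
        using tendsto_mult_left_zero[OF LIMSEQ_inverse_real_of_nat] .
    qed
    have bm: "stft g (\<phi> n) \<in> borel_measurable borel" for n by (rule rapid_borel[OF rapid_stft[OF g(1) \<phi>(1)]])
    have m: "stft g f \<in> borel_measurable borel"
      by (rule borel_measurable_LIMSEQ_metric[OF bm conv])
    have nrm: "L2_norm (\<phi> n) \<le> L2_norm f + inverse (real (Suc n))" for n
      using L2_norm_le_diff[OF rapid_L2[OF \<phi>(1)] f, of n] \<phi>(2)[of n] L2_norm_minus_commute[of f "\<phi> n"] by simp
    have "(\<integral>\<^sup>+z. ennreal ((norm (stft g f z))\<^sup>2) \<partial>lborel) = (\<integral>\<^sup>+z. liminf (\<lambda>n. ennreal ((norm (stft g (\<phi> n) z))\<^sup>2)) \<partial>lborel)"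
    proof (intro nn_integral_cong)
      fix z
      have "(\<lambda>n. ennreal ((norm (stft g (\<phi> n) z))\<^sup>2)) \<longlonglongrightarrow> ennreal ((norm (stft g f z))\<^sup>2)"
        by (intro tendsto_ennrealI tendsto_power tendsto_norm conv)
      then show "ennreal ((norm (stft g f z))\<^sup>2) = liminf (\<lambda>n. ennreal ((norm (stft g (\<phi> n) z))\<^sup>2))"
        by (rule lim_imp_Liminf[OF sequentially_bot, symmetric])
    qed
    also have "\<dots> \<le> liminf (\<lambda>n. \<integral>\<^sup>+z. ennreal ((norm (stft g (\<phi> n) z))\<^sup>2) \<partial>lborel)"
      using bm by (intro nn_integral_liminf) measurable
    also have "\<dots> \<le> liminf (\<lambda>n. ennreal ((M * (L2_norm f + inverse (real (Suc n))))\<^sup>2))"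
      unfolding rap[OF \<phi>(1)] using M nrm
      by (intro Liminf_mono always_eventually allI ennreal_leI power_mono mult_left_mono) auto
    also have "\<dots> = ennreal ((M * (L2_norm f + 0))\<^sup>2)"
      by (intro lim_imp_Liminf sequentially_bot tendsto_ennrealI tendsto_power tendsto_mult tendsto_add tendsto_const LIMSEQ_inverse_real_of_nat)
    finally show ?thesis using m by simp
  qed
  show ?thesis
  proof (rule that[OF M])
    fix f :: "real ^ 'n \<Rightarrow> complex" assume f: "f \<in> L2"
    show m: "stft g f \<in> borel_measurable borel" using gen[OF f] by blast
    have lt: "(\<integral>\<^sup>+z. ennreal ((norm (stft g f z))\<^sup>2) \<partial>lborel) < \<infinity>"
      using gen[OF f] by (auto intro: order.strict_trans1 simp: less_top[symmetric] top_unique)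
    show i: "integrable lborel (\<lambda>z. (norm (stft g f z))\<^sup>2)"
      by (rule integrableI_bounded) (use m lt in auto)
    have "ennreal (\<integral>z. (norm (stft g f z))\<^sup>2 \<partial>lborel) \<le> ennreal ((M * L2_norm f)\<^sup>2)"
      using gen[OF f] nn_integral_eq_integral[OF i] by simp
    then show "(\<integral>z. (norm (stft g f z))\<^sup>2 \<partial>lborel) \<le> (M * L2_norm f)\<^sup>2" by simp
  qed
qed

text \<open>Localization: if \<open>f\<close> vanishes off a bounded set, its transform decays in the position.\<close>

lemma stft_localized:
  fixes g :: "real ^ 'n::finite \<Rightarrow> complex"
  assumes g: "rapid g" and F: "compact F"
  obtains C where "C > 0" "\<And>f z. f \<in> L2 \<Longrightarrow> (\<And>x. x \<notin> F \<Longrightarrow> f x = 0) \<Longrightarrow>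
    (\<integral>y. norm (phase_shift z g y * f y) \<partial>lborel) \<le> C * L2_norm f * wt k (fst z)"
proof -
  obtain R where R: "R \<ge> 0" "\<And>y. y \<in> F \<Longrightarrow> norm y \<le> R" using compact_imp_bounded[OF F] unfolding bounded_pos by (meson less_imp_le)
  obtain C where C: "C > 0" "\<And>x. norm (g x) \<le> C * wt k x" using rapid_bound[OF g] by blast
  let ?I = "\<lambda>x. complex_of_real (indicator F x)"
  have F1: "?I \<in> L2"
  proof (rule L2I)
    have Fm: "F \<in> sets borel" using F by (simp add: borel_compact)
    then show "?I \<in> borel_measurable borel" by measurable
    have "(\<lambda>x. (norm (?I x))\<^sup>2) = indicat_real F" by (auto split: split_indicator)
    then show "integrable lborel (\<lambda>x. (norm (?I x))\<^sup>2)" using emeasure_compact_finite[OF F] Fm by simp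
  qed
  have "(\<integral>y. norm (phase_shift z g y * f y) \<partial>lborel) \<le> (C * (1 + R) ^ k * (L2_norm ?I + 1)) * L2_norm f * wt k (fst z)"
    if f: "f \<in> L2" "\<And>x. x \<notin> F \<Longrightarrow> f x = 0" for f z
  proof -
    have bd: "norm (phase_shift z g y * f y) \<le> (C * (1 + R) ^ k * wt k (fst z)) * norm (f y * ?I y)" for y
    proof (cases "y \<in> F")
      case True
      have "norm (g (y - fst z)) \<le> C * wt k (y - fst z)" by (rule C)
      also have "\<dots> \<le> C * ((1 + norm y) ^ k * wt k (fst z))"
        using wt_shift[of k "y - fst z" "- y"] C(1) by (intro mult_left_mono) auto
      also have "\<dots> \<le> C * ((1 + R) ^ k * wt k (fst z))"
        using R True C(1) by (intro mult_left_mono mult_right_mono power_mono) auto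
      finally have "norm (f y) * norm (g (y - fst z)) \<le> norm (f y) * (C * ((1 + R) ^ k * wt k (fst z)))"
        by (rule mult_left_mono) simp
      then show ?thesis using True by (simp add: norm_mult mult_ac)
    next
      case False
      then show ?thesis using f(2) by simp
    qed
    have i: "integrable lborel (\<lambda>y. norm (f y * ?I y))" by (rule integrable_norm[OF L2_Cauchy_Schwarz(1)[OF f(1) F1]])
    have "(\<integral>y. norm (phase_shift z g y * f y) \<partial>lborel) \<le> (\<integral>y. (C * (1 + R) ^ k * wt k (fst z)) * norm (f y * ?I y) \<partial>lborel)"
      by (rule integral_mono'[OF integrable_mult_right[OF i] bd]) (use C(1) R(1) in simp)
    also have "\<dots> = (C * (1 + R) ^ k * wt k (fst z)) * (\<integral>y. norm (f y * ?I y) \<partial>lborel)" by simp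
    also have "\<dots> \<le> (C * (1 + R) ^ k * wt k (fst z)) * (L2_norm f * (L2_norm ?I + 1))"
    proof (rule mult_left_mono)
      show "(\<integral>y. norm (f y * ?I y) \<partial>lborel) \<le> L2_norm f * (L2_norm ?I + 1)"
        by (rule order.trans[OF L2_Cauchy_Schwarz(2)[OF f(1) F1]]) (intro mult_left_mono, auto)
    qed (use C(1) R(1) in auto)
    finally show ?thesis by (simp add: mult_ac)
  qed
  moreover have "C * (1 + R) ^ k * (L2_norm ?I + 1) > 0" using C(1) R(1) by (intro mult_pos_pos add_nonneg_pos) auto
  ultimately show ?thesis using that by blast
qed

section \<open>Geometry of tame canonical transformations\<close>

lemma frechet_derivative_bound_Basis:
  fixes f :: "'a::euclidean_space \<Rightarrow> 'b::real_normed_vector"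
  assumes "f differentiable (at x)" "\<And>b. b \<in> Basis \<Longrightarrow> norm (frechet_derivative f (at x) b) \<le> C b"
  shows "norm (frechet_derivative f (at x) v) \<le> (\<Sum>b\<in>Basis. C b) * norm v"
proof -
  interpret bounded_linear "frechet_derivative f (at x)"
    using assms(1) frechet_derivative_works has_derivative_bounded_linear by blast
  have "frechet_derivative f (at x) v = frechet_derivative f (at x) (\<Sum>b\<in>Basis. (v \<bullet> b) *\<^sub>R b)" by (simp add: euclidean_representation)
  also have "\<dots> = (\<Sum>b\<in>Basis. (v \<bullet> b) *\<^sub>R frechet_derivative f (at x) b)" by (simp add: sum scaleR)
  also have "norm \<dots> \<le> (\<Sum>b\<in>Basis. norm v * C b)"
    by (intro sum_norm_le) (auto intro!: mult_mono assms Basis_le_norm)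
  finally show ?thesis by (simp add: sum_distrib_left mult.commute)
qed

lemma tame_iter_deriv_bound:
  fixes \<kappa> :: "'n::finite phase \<Rightarrow> 'n phase"
  assumes "tame_canonical \<kappa>" "vs \<in> lists Basis"
  obtains C where "C > 0" "\<And>z v. norm (frechet_derivative (iter_deriv vs \<kappa>) (at z) v) \<le> C * norm v"
proof -
  have "\<exists>C. \<forall>z. norm (iter_deriv (b # vs) \<kappa> z) \<le> C" if "b \<in> Basis" for b
  proof -
    have "b # vs \<in> lists Basis" "length (b # vs) \<ge> 1" using that assms(2) by auto
    then show ?thesis using assms(1) unfolding tame_canonical_def by blast
  qed
  then obtain C where C: "\<And>b z. b \<in> Basis \<Longrightarrow> norm (iter_deriv (b # vs) \<kappa> z) \<le> C b" by metis
  have d: "iter_deriv vs \<kappa> differentiable (at z)" for z using assms unfolding tame_canonical_def smooth_def by blast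
  have "norm (frechet_derivative (iter_deriv vs \<kappa>) (at z) v) \<le> (\<Sum>b\<in>Basis. C b) * norm v" for z v
    by (rule frechet_derivative_bound_Basis[OF d]) (use C in simp)
  then have "norm (frechet_derivative (iter_deriv vs \<kappa>) (at z) v) \<le> max (\<Sum>b\<in>Basis. C b) 1 * norm v" for z v
    by (rule order.trans) (intro mult_right_mono, auto)
  then show ?thesis by (intro that[of "max (\<Sum>b\<in>Basis. C b) 1"]) auto
qed

lemma Lipschitz_from_derivative:
  fixes f :: "'a::euclidean_space \<Rightarrow> 'b::real_normed_vector"
  assumes "\<And>z. (f has_derivative D z) (at z)" "\<And>z v. norm (D z v) \<le> C * norm v"
  shows "norm (f z' - f z) \<le> C * norm (z' - z)"
  by (rule differentiable_bound[of UNIV f D]) (use assms in \<open>auto intro: onorm_le\<close>)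

lemma abs_symplectic_form_le: "\<bar>symplectic_form u v\<bar> \<le> norm u * norm v"
proof -
  have "symplectic_form u v = u \<bullet> (snd v, - fst v)" by (simp add: symplectic_form_def inner_prod_def)
  moreover have "norm (snd v, - fst v) = norm v" by (cases v) (simp add: norm_Pair add.commute)
  ultimately show ?thesis using Cauchy_Schwarz_ineq2[of u "(snd v, - fst v)"] by simp
qed

text \<open>A symplectic map that expands by at most \<open>L\<close> also contracts by at most \<open>L\<close>, because
  \<open>\<omega>(u, Ju) = |u|\<^sup>2\<close> for the rotation \<open>J\<close>.\<close>

lemma symplectic_lower_bound:
  fixes D :: "'n::finite phase \<Rightarrow> 'n phase"
  assumes "\<And>u v. symplectic_form (D u) (D v) = symplectic_form u v" "\<And>v. norm (D v) \<le> L * norm v"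
  shows "norm u \<le> L * norm (D u)"
proof (cases "u = 0")
  case True
  then show ?thesis using assms(2)[of "D u"] assms(2)[of u] by simp
next
  case False
  let ?J = "(- snd u, fst u)"
  have nJ: "norm ?J = norm u" by (cases u) (simp add: norm_Pair add.commute)
  have "norm u * norm u = symplectic_form u ?J"
    by (simp add: symplectic_form_def norm_prod_def dot_square_norm flip: power2_eq_square)
  also have "\<dots> = symplectic_form (D u) (D ?J)" using assms(1) by simp
  also have "\<dots> \<le> norm (D u) * norm (D ?J)" using abs_symplectic_form_le abs_le_D1 by blast
  also have "\<dots> \<le> norm (D u) * (L * norm u)" using assms(2)[of ?J] nJ by (intro mult_left_mono) auto
  finally show ?thesis using False by (simp add: mult.commute mult.left_commute)
qed

text \<open>The bounds do not depend on the base point, so the inverse function theorem holds on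
  balls of one and the same radius. This is what makes the map a covering.\<close>

locale bi_Lipschitz_derivative =
  fixes f :: "'a::euclidean_space \<Rightarrow> 'a" and D L M
  assumes der: "\<And>z. (f has_derivative D z) (at z)"
    and L: "L > 0" "\<And>z v. norm (D z v) \<le> L * norm v" "\<And>z v. norm v \<le> L * norm (D z v)"
    and M: "M > 0" "\<And>z z' v. norm (D z' v - D z v) \<le> M * norm (z' - z) * norm v"
begin

text \<open>On a ball of radius \<open>r\<close> the derivative varies by at most half of its lower bound \<open>1 / L\<close>.\<close>

definition "r = 1 / (2 * L * M)"

lemma r_pos: "r > 0" using L M by (simp add: r_def)

lemma continuous: "continuous_on A f"
  by (intro continuous_at_imp_continuous_on ballI has_derivative_continuous[OF der])

lemma local_expansion:
  assumes "x \<in> ball z r" "y \<in> ball z r"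
  shows "norm (x - y) \<le> 2 * L * norm (f x - f y)"
proof -
  have bl: "bounded_linear (D z)" for z by (rule has_derivative_bounded_linear[OF der])
  have "norm ((f x - D z x) - (f y - D z y)) \<le> (M * r) * norm (x - y)"
  proof (rule differentiable_bound[OF convex_ball _ _ assms])
    fix \<zeta> assume \<zeta>: "\<zeta> \<in> ball z r"
    show "((\<lambda>x. f x - D z x) has_derivative (\<lambda>v. D \<zeta> v - D z v)) (at \<zeta> within ball z r)"
      by (intro has_derivative_diff has_derivative_at_withinI[OF der] bounded_linear_imp_has_derivative bl)
    show "onorm (\<lambda>v. D \<zeta> v - D z v) \<le> M * r"
    proof (rule onorm_le)
      fix v
      have "norm (D \<zeta> v - D z v) \<le> M * norm (\<zeta> - z) * norm v" by (rule M)
      also have "\<dots> \<le> M * r * norm v"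
        using \<zeta> M(1) by (intro mult_right_mono mult_left_mono) (auto simp: dist_norm norm_minus_commute)
      finally show "norm (D \<zeta> v - D z v) \<le> M * r * norm v" .
    qed
  qed
  moreover have "(f x - D z x) - (f y - D z y) = (f x - f y) - D z (x - y)"
    using bl[of z] by (simp add: bounded_linear.linear linear_diff)
  ultimately have "norm (D z (x - y)) \<le> norm (f x - f y) + (M * r) * norm (x - y)"
    using norm_triangle_ineq2[of "D z (x - y)" "f x - f y"] by (simp add: norm_minus_commute)
  then have "norm (x - y) \<le> L * (norm (f x - f y) + (M * r) * norm (x - y))"
    using L(3)[of "x - y" z] L(1) by (meson mult_left_mono less_imp_le order_trans)
  moreover have "L * (M * r * norm (x - y)) = norm (x - y) / 2"
    using L(1) M(1) by (simp add: r_def)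
  ultimately show ?thesis by (simp add: distrib_left)
qed

lemma local_inj: "inj_on f (ball z r)"
proof (rule inj_onI)
  fix x y assume "x \<in> ball z r" "y \<in> ball z r" "f x = f y"
  then show "x = y" using local_expansion[of x z y] by simp
qed

text \<open>The sphere of radius \<open>r / 2\<close> around a point is mapped to distance at least \<open>\<delta>\<close> from its image.\<close>

definition "\<delta> = r / (4 * L)"

lemma \<delta>_pos: "\<delta> > 0" using r_pos L by (simp add: \<delta>_def)

lemma ball_subset_image: "ball (f z) \<delta> \<subseteq> f ` ball z (r / 2)"
proof (rule ball_subset_open_map_image)
  show "continuous_on (closure (ball z (r / 2))) f" by (rule continuous)
  show "open (f ` interior (ball z (r / 2)))"
    unfolding interior_ball
    by (rule invariance_of_domain[OF continuous open_ball inj_on_subset[OF local_inj[of z]]])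
      (use r_pos in auto)
  fix y assume "y \<in> frontier (ball z (r / 2))"
  then have "norm (y - z) = r / 2" using r_pos by (simp add: frontier_ball dist_norm norm_minus_commute)
  then have "r / 2 \<le> 2 * L * norm (f y - f z)"
    using local_expansion[of y z z] r_pos by (simp add: dist_norm norm_minus_commute)
  then show "\<delta> \<le> norm (f y - f z)" using L(1) by (simp add: \<delta>_def field_simps)
qed (use r_pos \<delta>_pos in auto)

lemma surjective: "range f = UNIV"
proof -
  have "open (range f)"
    using ball_subset_image \<delta>_pos unfolding open_contains_ball by (metis image_mono imageE order_trans subset_UNIV)
  moreover have "open (- range f)"
    unfolding open_contains_ball
  proof
    fix w assume w: "w \<in> - range f"
    have "ball w \<delta> \<subseteq> - range f"
    proof
      fix y assume y: "y \<in> ball w \<delta>"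
      show "y \<in> - range f"
      proof
        assume "y \<in> range f"
        then obtain z where "y = f z" by blast
        then have "w \<in> ball (f z) \<delta>" using y by (simp add: dist_commute)
        then show False using ball_subset_image[of z] w by blast
      qed
    qed
    then show "\<exists>e>0. ball w e \<subseteq> - range f" using \<delta>_pos by blast
  qed
  ultimately show ?thesis using clopen[of "range f"] by (auto simp: closed_def)
qed

text \<open>Over a ball of radius \<open>\<delta>\<close> the map is a union of disjoint sheets, one around each preimage of
  the centre: two sheets that meet lie in one ball of radius \<open>r\<close>, where the map is injective.\<close>

lemma covering: "covering_space UNIV f UNIV"
  unfolding covering_space_def
proof (intro conjI ballI continuous surjective)
  fix w :: 'a
  let ?T = "ball w \<delta>"
  let ?U = "\<lambda>z. ball z (r / 2) \<inter> f -` ?T"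
  let ?v = "?U ` (f -` {w})"
  have fT: "open (f -` ?T)" by (rule open_vimage[OF open_ball continuous])
  have union: "\<Union>?v = UNIV \<inter> f -` ?T"
  proof
    show "UNIV \<inter> f -` ?T \<subseteq> \<Union>?v"
    proof
      fix y assume "y \<in> UNIV \<inter> f -` ?T"
      then have y: "f y \<in> ?T" by simp
      then have "w \<in> ball (f y) \<delta>" by (simp add: dist_commute)
      then obtain z where "z \<in> ball y (r / 2)" "f z = w" using ball_subset_image[of y] by blast
      then show "y \<in> \<Union>?v" using y by (auto simp: dist_commute)
    qed
  qed auto
  have disj: "pairwise disjnt ?v"
  proof (rule pairwiseI)
    fix U V assume "U \<in> ?v" "V \<in> ?v" and ne: "U \<noteq> V"
    then obtain z z' where z: "f z = w" "f z' = w" "U = ?U z" "V = ?U z'" by auto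
    show "disjnt U V"
    proof (rule ccontr)
      assume "\<not> disjnt U V"
      then obtain y where y: "y \<in> ball z (r / 2)" "y \<in> ball z' (r / 2)" using z unfolding disjnt_def by blast
      then have "z \<in> ball y r" "z' \<in> ball y r" using r_pos by (auto simp: dist_commute)
      then have "z = z'" using local_inj[of y] z unfolding inj_on_def by metis
      then show False using ne z by simp
    qed
  qed
  have homeo: "\<exists>q. homeomorphism U ?T f q" if "U \<in> ?v" for U
  proof -
    from that obtain z where z: "f z = w" "U = ?U z" by auto
    have "ball z (r / 2) \<subseteq> ball z r" using r_pos by auto
    then have inj: "inj_on f U" using z by (intro inj_on_subset[OF local_inj[of z]]) auto
    have "f ` U = ?T" using ball_subset_image[of z] z by auto
    moreover obtain q where "homeomorphism U (f ` U) f q"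
      using invariance_of_domain_homeomorphism[OF _ continuous _ inj] fT z by auto
    ultimately show ?thesis by auto
  qed
  show "\<exists>T. w \<in> T \<and> openin (top_of_set UNIV) T \<and>
      (\<exists>v. \<Union>v = UNIV \<inter> f -` T \<and> (\<forall>u\<in>v. openin (top_of_set UNIV) u) \<and> pairwise disjnt v \<and> (\<forall>u\<in>v. \<exists>q. homeomorphism u T f q))"
    using \<delta>_pos union disj homeo fT by (intro exI[of _ ?T] conjI exI[of _ ?v]) auto
qed

text \<open>A covering of the simply connected space lifts the identity to a continuous inverse \<open>q\<close>;
  uniqueness of lifts gives \<open>q \<circ> f = id\<close>. The derivative of \<open>q\<close> is the inverse of \<open>D\<close>, which is bounded
  by \<open>L\<close>, and the mean value inequality does the rest.\<close>

theorem global_expansion: "norm (z' - z) \<le> L * norm (f z' - f z)"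
proof -
  obtain a where a: "f a = 0" using surjective by (metis UNIV_I imageE)
  have sc: "simply_connected (UNIV :: 'a set)" "locally path_connected (UNIV :: 'a set)"
    by (simp_all add: convex_imp_simply_connected convex_imp_locally_path_connected)
  obtain q where q: "continuous_on UNIV q" "q 0 = a" "\<And>y. f (q y) = y"
    by (rule covering_space_lift_strong[OF covering _ _ sc, of a "0::'a" "\<lambda>x. x"]) (use a in auto)
  have qf: "q (f x) = x" for x
    by (rule covering_space_lift_unique[OF covering, of "\<lambda>x. q (f x)" a "\<lambda>x. x" UNIV f])
      (use a q in \<open>auto intro: continuous_on_compose2[OF q(1) continuous] continuous\<close>)
  have "\<exists>D'. bounded_linear D' \<and> (q has_derivative D') (at y) \<and> (\<forall>w. norm (D' w) \<le> L * norm w)" for y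
  proof -
    have lin: "linear (D (q y))" by (rule has_derivative_linear[OF der])
    have inj: "inj (D (q y))"
      unfolding linear_injective_0[OF lin]
    proof (intro allI impI)
      fix x assume "D (q y) x = 0"
      then show "x = 0" using L(3)[of x "q y"] by simp
    qed
    obtain D' where D': "linear D'" "D' \<circ> D (q y) = id" using linear_injective_left_inverse[OF lin inj] by blast
    have "norm (D' w) \<le> L * norm w" for w
    proof -
      obtain u where u: "w = D (q y) u" using linear_injective_imp_surjective[OF lin inj] by (metis surjD)
      then have "D' w = u" using D'(2) by (metis comp_apply id_apply)
      then show ?thesis using L(3)[of u "q y"] u by simp
    qed
    moreover have "bounded_linear D'" using D'(1) by (simp add: linear_conv_bounded_linear)
    moreover have "(q has_derivative D') (at y)"
      by (rule has_derivative_inverse_basic[where f = f and T = UNIV and g = q and y = y, OF der[of "q y"] \<open>bounded_linear D'\<close> D'(2) _ open_UNIV])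
        (use q continuous_on_eq_continuous_at[of UNIV q] in auto)
    ultimately show ?thesis by blast
  qed
  then obtain D' where "\<And>y. (q has_derivative D' y) (at y)" "\<And>y w. norm (D' y w) \<le> L * norm w" by metis
  from Lipschitz_from_derivative[OF this, of "f z'" "f z"] show ?thesis by (simp add: qf)
qed

end

theorem tame_canonical_bi_Lipschitz:
  fixes \<kappa> :: "'n::finite phase \<Rightarrow> 'n phase"
  assumes \<kappa>: "tame_canonical \<kappa>"
  obtains L where "L > 0" "\<And>z z'. norm (\<kappa> z' - \<kappa> z) \<le> L * norm (z' - z)" "\<And>z z'. norm (z' - z) \<le> L * norm (\<kappa> z' - \<kappa> z)"
    "continuous_on UNIV \<kappa>" "range \<kappa> = UNIV"
proof -
  let ?D = "\<lambda>z. frechet_derivative \<kappa> (at z)"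
  have diff: "iter_deriv vs \<kappa> differentiable (at z)" if "vs \<in> lists Basis" for vs z
    using \<kappa> that unfolding tame_canonical_def smooth_def by blast
  have der: "(\<kappa> has_derivative ?D z) (at z)" for z
  proof -
    have "\<kappa> differentiable (at z)" using diff[of "[]" z] by simp
    then show ?thesis by (simp only: frechet_derivative_works)
  qed
  obtain L where L: "L > 0" "\<And>z v. norm (?D z v) \<le> L * norm v"
    using tame_iter_deriv_bound[OF \<kappa>, of "[]"] by auto
  have low: "norm v \<le> L * norm (?D z v)" for z v
    by (rule symplectic_lower_bound[OF _ L(2)]) (use \<kappa> in \<open>unfold tame_canonical_def canonical_def, blast\<close>)
  have "\<exists>C>0. \<forall>z v. norm (frechet_derivative (iter_deriv [b] \<kappa>) (at z) v) \<le> C * norm v" if b: "b \<in> Basis" for b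
  proof -
    have "[b] \<in> lists Basis" using b by simp
    then obtain C where "C > 0" "\<And>z v. norm (frechet_derivative (iter_deriv [b] \<kappa>) (at z) v) \<le> C * norm v"
      by (rule tame_iter_deriv_bound[OF \<kappa>]) metis
    then show ?thesis by blast
  qed
  then obtain M where M: "\<And>b. b \<in> Basis \<Longrightarrow> M b > 0"
    "\<And>b z v. b \<in> Basis \<Longrightarrow> norm (frechet_derivative (iter_deriv [b] \<kappa>) (at z) v) \<le> M b * norm v" by metis
  have lipb: "norm (?D z' b - ?D z b) \<le> M b * norm (z' - z)" if "b \<in> Basis" for b z z'
  proof -
    have "norm (iter_deriv [b] \<kappa> z' - iter_deriv [b] \<kappa> z) \<le> M b * norm (z' - z)"
    proof (rule Lipschitz_from_derivative[OF _ M(2)[OF that]])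
      show "(iter_deriv [b] \<kappa> has_derivative frechet_derivative (iter_deriv [b] \<kappa>) (at z)) (at z)" for z
        using diff[of "[b]" z] that by (simp only: frechet_derivative_works lists.Cons lists.Nil)
    qed
    then show ?thesis by simp
  qed
  have lip: "norm (?D z' v - ?D z v) \<le> (\<Sum>b\<in>Basis. M b) * norm (z' - z) * norm v" for z z' v
  proof -
    have bl: "bounded_linear (?D z)" for z by (rule has_derivative_bounded_linear[OF der])
    have e: "?D z v = (\<Sum>b\<in>Basis. (v \<bullet> b) *\<^sub>R ?D z b)" for z
    proof -
      interpret bounded_linear "?D z" by (rule bl)
      have "?D z v = ?D z (\<Sum>b\<in>Basis. (v \<bullet> b) *\<^sub>R b)" by (simp add: euclidean_representation)
      then show ?thesis by (simp add: sum scaleR)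
    qed
    have "?D z' v - ?D z v = (\<Sum>b\<in>Basis. (v \<bullet> b) *\<^sub>R (?D z' b - ?D z b))"
      by (subst e, subst e) (simp add: sum_subtractf scaleR_diff_right)
    also have "norm \<dots> \<le> (\<Sum>b\<in>Basis. norm v * (M b * norm (z' - z)))"
      by (intro sum_norm_le) (auto intro!: mult_mono lipb Basis_le_norm)
    finally show ?thesis by (simp add: sum_distrib_left sum_distrib_right mult_ac)
  qed
  interpret bi_Lipschitz_derivative \<kappa> ?D L "\<Sum>b\<in>Basis. M b"
    by unfold_locales (use der L low lip M(1) in \<open>auto intro: sum_pos\<close>)
  show ?thesis
    by (rule that[OF L(1) Lipschitz_from_derivative[OF der L(2)] global_expansion continuous surjective])
qed

text \<open>By compactness of the sphere, points \<open>(x, \<xi>)\<close> off the cone \<open>\<Gamma>\<close> satisfy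
  \<open>\<epsilon> |\<xi>| \<le> |x|\<close>. Hence the position of \<open>\<kappa>(0, \<eta>)\<close> is at least of the size of \<open>\<kappa>(0, \<eta>)\<close>, which is
  at least of the size of \<open>\<eta>\<close> by expansion. Passing from \<open>\<kappa>(0, \<eta>)\<close> to \<open>w\<close> through \<open>\<kappa> z\<close> costs
  \<open>|w - \<kappa> z|\<close> and, \<open>\<kappa>\<close> being Lipschitz, a multiple of the position of \<open>z\<close>.\<close>

theorem nonrefocusing_bound:
  fixes \<kappa> :: "'n::finite phase \<Rightarrow> 'n phase"
  assumes \<kappa>: "tame_canonical \<kappa>" and v: "vertical_nonrefocusing \<kappa>"
  obtains C where "C > 0" "\<And>z w. 1 + norm (snd z) \<le> C * ((1 + norm (fst z)) * (1 + norm (fst w)) * (1 + norm (w - \<kappa> z)))"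
proof -
  obtain L where L: "L > 0" "\<And>z z'. norm (\<kappa> z' - \<kappa> z) \<le> L * norm (z' - z)" "\<And>z z'. norm (z' - z) \<le> L * norm (\<kappa> z' - \<kappa> z)"
    using tame_canonical_bi_Lipschitz[OF \<kappa>] by metis
  obtain \<Gamma> R where \<Gamma>: "open \<Gamma>" "conic \<Gamma>" "{0} \<times> (UNIV - {0}) \<subseteq> \<Gamma>" and R: "R > 0" "\<And>\<eta>. norm \<eta> > R \<Longrightarrow> \<kappa> (0, \<eta>) \<notin> \<Gamma>"
    using v unfolding vertical_nonrefocusing_def by metis
  let ?S = "{0 :: real ^ 'n} \<times> sphere (0 :: real ^ 'n) 1"
  have "compact ?S" by (intro compact_Times) auto
  moreover have "?S \<subseteq> \<Gamma>" using \<Gamma>(3) by auto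
  ultimately obtain \<epsilon> where \<epsilon>: "\<epsilon> > 0" "(\<Union>x\<in>?S. ball x \<epsilon>) \<subseteq> \<Gamma>"
    using compact_subset_open_imp_ball_epsilon_subset[OF _ \<Gamma>(1)] by metis
  have cone: "\<epsilon> * norm \<xi> \<le> norm x" if "(x, \<xi>) \<notin> \<Gamma>" for x \<xi>
  proof (rule ccontr)
    assume "\<not> \<epsilon> * norm \<xi> \<le> norm x"
    then have lt: "norm x < \<epsilon> * norm \<xi>" by simp
    then have "0 < \<epsilon> * norm \<xi>" using norm_ge_zero[of x] by linarith
    then have n: "norm \<xi> > 0" using \<epsilon>(1) by (simp add: zero_less_mult_iff)
    let ?t = "inverse (norm \<xi>)"
    have "norm (?t *\<^sub>R x) < \<epsilon>" using lt n by (simp add: field_simps)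
    then have "?t *\<^sub>R (x, \<xi>) \<in> ball (0, ?t *\<^sub>R \<xi>) \<epsilon>" by (simp add: dist_norm norm_Pair)
    moreover have "(0, ?t *\<^sub>R \<xi>) \<in> ?S" using n by simp
    ultimately have "?t *\<^sub>R (x, \<xi>) \<in> \<Gamma>" using \<epsilon>(2) by blast
    then have "norm \<xi> *\<^sub>R (?t *\<^sub>R (x, \<xi>)) \<in> \<Gamma>" using \<Gamma>(2) n unfolding conic_def by blast
    then show False using that n by simp
  qed
  define c where "c = norm (\<kappa> 0)"
  define K where "K = L * (1 + inverse \<epsilon>)"
  have K: "K > 0" using L(1) \<epsilon>(1) by (simp add: K_def add_pos_pos)
  have c: "c \<ge> 0" by (simp add: c_def)
  have main: "norm (snd z) \<le> R + L * c + K * (norm (fst w) + norm (w - \<kappa> z) + L * norm (fst z))" for z w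
  proof (cases "norm (snd z) > R")
    case False
    moreover have "0 \<le> L * c" "0 \<le> K * (norm (fst w) + norm (w - \<kappa> z) + L * norm (fst z))"
      using L(1) K c by (auto intro!: mult_nonneg_nonneg add_nonneg_nonneg)
    ultimately show ?thesis by linarith
  next
    case True
    let ?p = "\<kappa> (0, snd z)"
    have "(fst ?p, snd ?p) \<notin> \<Gamma>" using R(2)[OF True] by simp
    from cone[OF this] have "norm (snd ?p) \<le> inverse \<epsilon> * norm (fst ?p)" using \<epsilon>(1) by (simp add: field_simps)
    then have p: "norm ?p \<le> (1 + inverse \<epsilon>) * norm (fst ?p)"
      using norm_Pair_le[of "fst ?p" "snd ?p"] by (simp add: algebra_simps)
    have "norm (snd z) \<le> L * norm (?p - \<kappa> 0)"
      using L(3)[of "(0, snd z)" 0] by (simp add: norm_Pair)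
    also have "\<dots> \<le> L * (norm ?p + c)" unfolding c_def using L(1) by (intro mult_left_mono norm_triangle_ineq4) auto
    also have "\<dots> \<le> L * ((1 + inverse \<epsilon>) * norm (fst ?p) + c)" using p L(1) by (intro mult_left_mono) auto
    also have "\<dots> = K * norm (fst ?p) + L * c" by (simp add: K_def algebra_simps)
    finally have 1: "norm (snd z) \<le> K * norm (fst ?p) + L * c" .
    have "norm (fst ?p) \<le> norm (fst w) + norm (w - \<kappa> z) + L * norm (fst z)"
    proof -
      have "norm (fst ?p) = norm (fst w - fst (w - \<kappa> z) + fst (?p - \<kappa> z))" by simp
      also have "\<dots> \<le> norm (fst w - fst (w - \<kappa> z)) + norm (fst (?p - \<kappa> z))" by (rule norm_triangle_ineq)
      also have "\<dots> \<le> norm (fst w) + norm (fst (w - \<kappa> z)) + norm (fst (?p - \<kappa> z))"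
        by (intro add_right_mono norm_triangle_ineq4)
      finally have "norm (fst ?p) \<le> norm (fst w) + norm (fst (w - \<kappa> z)) + norm (fst (?p - \<kappa> z))" .
      moreover have "norm (fst (w - \<kappa> z)) \<le> norm (w - \<kappa> z)" by (metis norm_fst_le prod.collapse)
      moreover have "norm (fst (?p - \<kappa> z)) \<le> norm (?p - \<kappa> z)" by (metis norm_fst_le prod.collapse)
      moreover have "norm (?p - \<kappa> z) \<le> L * norm ((0, snd z) - z)" by (rule L)
      moreover have "norm ((0, snd z) - z) = norm (fst z)" by (cases z) (simp add: norm_Pair)
      ultimately show ?thesis by simp
    qed
    then have "K * norm (fst ?p) \<le> K * (norm (fst w) + norm (w - \<kappa> z) + L * norm (fst z))"
      using K by (intro mult_left_mono) auto
    with 1 R(1) show ?thesis by linarith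
  qed
  define C where "C = 1 + R + L * c + K * (2 + L)"
  have "C > 0" using R(1) L(1) K c by (simp add: C_def add_pos_nonneg add_pos_pos)
  moreover have "1 + norm (snd z) \<le> C * ((1 + norm (fst z)) * (1 + norm (fst w)) * (1 + norm (w - \<kappa> z)))" for z w
  proof -
    let ?a = "norm (fst z)" and ?b = "norm (fst w)" and ?d = "norm (w - \<kappa> z)"
    let ?P = "(1 + ?a) * (1 + ?b) * (1 + ?d)"
    have "?P = 1 + ?a + ?b + ?d + (?a * ?b + ?a * ?d + ?b * ?d + ?a * ?b * ?d)" by (simp add: algebra_simps)
    moreover have "0 \<le> ?a * ?b + ?a * ?d + ?b * ?d + ?a * ?b * ?d" by simp
    ultimately have P: "1 \<le> ?P" "?a \<le> ?P" "?b \<le> ?P" "?d \<le> ?P"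
      using norm_ge_zero[of "fst z"] norm_ge_zero[of "fst w"] norm_ge_zero[of "w - \<kappa> z"] by linarith+
    have "1 + norm (snd z) \<le> (1 + R + L * c) * 1 + K * (?b + ?d + L * ?a)" using main[of z w] by simp
    also have "\<dots> \<le> (1 + R + L * c) * ?P + K * (?P + ?P + L * ?P)"
      using P K L(1) R(1) c by (intro add_mono mult_left_mono) auto
    also have "\<dots> = C * ?P" by (simp add: C_def algebra_simps)
    finally show ?thesis .
  qed
  ultimately show ?thesis using that by blast
qed

section \<open>The phase space kernel of an operator\<close>

text \<open>Test \<open>u\<close> against rapidly decreasing approximations of its conjugate.\<close>

lemma L2_norm_le_dual:
  fixes u g :: "real ^ 'n::finite \<Rightarrow> complex"
  assumes g: "rapid g" "g a \<noteq> 0" and u: "u \<in> L2" and b: "b \<ge> 0"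
    and dual: "\<And>\<theta>. rapid \<theta> \<Longrightarrow> norm (\<integral>x. u x * \<theta> x \<partial>lborel) \<le> b * L2_norm \<theta>"
  shows "L2_norm u \<le> b"
proof -
  have "(L2_norm u)\<^sup>2 \<le> b * L2_norm u + e" if "e > 0" for e
  proof -
    have c: "(\<lambda>x. cnj (u x)) \<in> L2" "L2_norm (\<lambda>x. cnj (u x)) = L2_norm u" using L2_cnj[OF u] by auto
    \<comment> \<open>The approximation error enters multiplied by at most \<open>b + L2_norm u\<close>.\<close>
    define e' where "e' = e / (b + L2_norm u + 1)"
    have pos: "b + L2_norm u + 1 > 0" using b by (simp add: add_nonneg_pos)
    then have "e' > 0" using that by (simp add: e'_def)
    then obtain \<theta> where \<theta>: "rapid \<theta>" "L2_norm (\<lambda>x. cnj (u x) - \<theta> x) < e'"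
      using rapid_dense_L2[OF g c(1)] unfolding L2_limit_def by blast
    have \<theta>L: "\<theta> \<in> L2" by (rule rapid_L2[OF \<theta>(1)])
    have dL: "(\<lambda>x. cnj (u x) - \<theta> x) \<in> L2" by (rule L2_diff(1)[OF c(1) \<theta>L])
    have "complex_of_real ((L2_norm u)\<^sup>2) = (\<integral>x. u x * cnj (u x) \<partial>lborel)"
      unfolding L2_norm_square by (simp only: norm_square_mult_cnj flip: integral_complex_of_real)
    also have "\<dots> = (\<integral>x. u x * \<theta> x + u x * (cnj (u x) - \<theta> x) \<partial>lborel)" by (simp add: algebra_simps)
    also have "\<dots> = (\<integral>x. u x * \<theta> x \<partial>lborel) + (\<integral>x. u x * (cnj (u x) - \<theta> x) \<partial>lborel)"
      by (rule Bochner_Integration.integral_add[OF L2_Cauchy_Schwarz(1)[OF u \<theta>L] L2_Cauchy_Schwarz(1)[OF u dL]])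
    finally have "norm (complex_of_real ((L2_norm u)\<^sup>2)) \<le> norm (\<integral>x. u x * \<theta> x \<partial>lborel) + norm (\<integral>x. u x * (cnj (u x) - \<theta> x) \<partial>lborel)"
      by (simp add: norm_triangle_ineq)
    then have "(L2_norm u)\<^sup>2 \<le> b * L2_norm \<theta> + L2_norm u * L2_norm (\<lambda>x. cnj (u x) - \<theta> x)"
      unfolding norm_of_real using dual[OF \<theta>(1)] L2_Cauchy_Schwarz(3)[OF u dL] by simp
    also have "\<dots> \<le> b * (L2_norm u + e') + L2_norm u * e'"
      using L2_norm_le_diff[OF \<theta>L c(1)] L2_norm_minus_commute[of \<theta> "\<lambda>x. cnj (u x)"] \<theta>(2) c(2) b
      by (intro add_mono mult_left_mono) auto
    also have "\<dots> = b * L2_norm u + (b + L2_norm u) * e'" by (simp add: algebra_simps)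
    also have "\<dots> \<le> b * L2_norm u + (b + L2_norm u + 1) * e'" using \<open>e' > 0\<close> by (intro add_left_mono mult_right_mono) auto
    also have "\<dots> = b * L2_norm u + e" using pos by (simp add: e'_def)
    finally show ?thesis .
  qed
  then have "(L2_norm u)\<^sup>2 \<le> b * L2_norm u" by (rule field_le_epsilon)
  then show ?thesis
    using L2_norm_nonneg[of u] b by (cases "L2_norm u = 0") (simp_all add: power2_eq_square)
qed

text \<open>An operator whose coefficients against the shifts of one window \<open>g\<close> concentrate along the graph of
  \<open>\<kappa>\<close>. The point \<open>a\<close> witnesses that \<open>g\<close> is not zero, and \<open>d\<close> is an order of decay for which
  weights on phase space are integrable.\<close>

locale gabor_operator =
  fixes \<kappa> :: "'n::finite phase \<Rightarrow> 'n phase" and A :: "'n distr_op"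
    and g :: "real ^ 'n \<Rightarrow> complex" and a :: "real ^ 'n" and d :: nat
  assumes tame: "tame_canonical \<kappa>" and cont: "continuous_linear_S_S' A"
    and g: "rapid g" and ga: "g a \<noteq> 0"
    and decay: "\<And>N::nat. \<exists>C>0. \<forall>z w. norm (pairing (A (phase_shift z g)) (phase_shift w g)) \<le> C * wt N (w - \<kappa> z)"
    and d: "2 * DIM('n phase) \<le> d"
begin

definition kernel :: "'n phase \<Rightarrow> 'n phase \<Rightarrow> complex" where
  "kernel w z = A (phase_shift z g) (\<lambda>x. cnj (phase_shift w g x))"

lemma kernel_bound:
  obtains C where "C > 0" "\<And>w z. norm (kernel w z) \<le> C * wt N (w - \<kappa> z)"
  using decay[of N] unfolding kernel_def pairing_def by metis

text \<open>Continuity of \<open>F\<close> near \<open>z0\<close> follows from that of \<open>W F\<close> for a \<open>W\<close> with \<open>W z0 \<noteq> 0\<close>;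
  a suitable one is a translate of \<open>g(p) g(\<xi>)\<close>. The weight is there because \<open>W(z) \<pi>(z)g\<close> decays in
  \<open>z\<close>, so that results on rapidly decreasing families apply to it.\<close>

lemma continuous_from_weighted:
  fixes F :: "'n phase \<Rightarrow> complex"
  assumes "\<And>W. rapid W \<Longrightarrow> continuous_on UNIV (\<lambda>z. W z * F z)"
  shows "continuous_on UNIV F"
proof (intro continuous_at_imp_continuous_on ballI)
  fix z0 :: "'n phase"
  define W where "W z = g (fst (z + ((a, a) - z0))) * g (snd (z + ((a, a) - z0)))" for z
  have W: "rapid W" unfolding W_def by (rule rapid_translate[OF rapid_tensor[OF g g]])
  have W0: "W z0 \<noteq> 0" using ga by (simp add: W_def)
  have cW: "isCont W z0" by (rule differentiable_imp_continuous_within[OF rapid_differentiable[OF W]])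
  have "isCont (\<lambda>z. W z * F z) z0" 
    by (rule bspec[OF iffD1[OF continuous_on_eq_continuous_at[OF open_UNIV] assms[OF W]] UNIV_I])
  then have "isCont (\<lambda>z. (W z * F z) / W z) z0" using cW W0 by (rule continuous_at_within_divide)
  moreover have "\<forall>\<^sub>F z in nhds z0. (W z * F z) / W z = F z"
  proof -
    have "open {z. W z \<noteq> 0}" by (intro open_Collect_neq rapid_continuous_on W continuous_on_const)
    then have "\<forall>\<^sub>F z in nhds z0. z \<in> {z. W z \<noteq> 0}" by (rule eventually_nhds_in_open) (use W0 in simp)
    then show ?thesis by eventually_elim simp
  qed
  ultimately show "isCont F z0" using isCont_cong by fast
qed

lemma kernel_continuous_right: "continuous_on UNIV (\<lambda>z. kernel w z)"
proof (rule continuous_from_weighted)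
  fix W :: "'n phase \<Rightarrow> complex" assume W: "rapid W"
  have T: "schwartz_functional (\<lambda>\<phi>. A \<phi> (\<lambda>x. cnj (phase_shift w g x)))"
    by (rule operator_functionals(2)[OF cont rapid_cnj[OF rapid_phase_shift[OF g]]])
  have "continuous_on UNIV (\<lambda>z. A (\<lambda>x. W (fst (z, x)) * phase_shift (fst (z, x)) g (snd (z, x))) (\<lambda>x. cnj (phase_shift w g x)))"
    by (rule schwartz_functional_slice_continuous[OF T rapid_phase_family[OF W g]])
  then show "continuous_on UNIV (\<lambda>z. W z * kernel w z)"
    using schwartz_functional_cmult[OF T rapid_phase_shift[OF g]] by (simp add: kernel_def)
qed

lemma functional_continuous:
  assumes T: "schwartz_functional T"
  shows "continuous_on UNIV (\<lambda>w. T (\<lambda>x. cnj (phase_shift w g x)))"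
proof (rule continuous_from_weighted)
  fix W :: "'n phase \<Rightarrow> complex" assume W: "rapid W"
  have "continuous_on UNIV (\<lambda>w. T (\<lambda>x. cnj (cnj (W (fst (w, x))) * phase_shift (fst (w, x)) g (snd (w, x)))))"
    by (rule schwartz_functional_slice_continuous[OF T rapid_cnj[OF rapid_phase_family[OF rapid_cnj[OF W] g]]])
  then show "continuous_on UNIV (\<lambda>w. W w * T (\<lambda>x. cnj (phase_shift w g x)))"
    using schwartz_functional_cmult[OF T rapid_cnj[OF rapid_phase_shift[OF g]]] by simp
qed

lemma kernel_continuous_left: "continuous_on UNIV (\<lambda>w. kernel w z)"
  unfolding kernel_def by (rule functional_continuous[OF operator_functionals(1)[OF cont rapid_phase_shift[OF g]]])

definition K :: complex where
  "K = (SOME K. K \<noteq> 0 \<and> (\<forall>f x. rapid f \<longrightarrow> (\<integral>z. stft g f z * phase_shift z g x \<partial>lborel) = K * f x))"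

lemma K: "K \<noteq> 0" "rapid f \<Longrightarrow> (\<integral>z. stft g f z * phase_shift z g x \<partial>lborel) = K * f x"
proof -
  have "\<exists>K. K \<noteq> 0 \<and> (\<forall>f x. rapid f \<longrightarrow> (\<integral>z. stft g f z * phase_shift z g x \<partial>lborel) = K * f x)"
    using stft_inversion[OF g ga] by metis
  from someI_ex[OF this] show "K \<noteq> 0" "rapid f \<Longrightarrow> (\<integral>z. stft g f z * phase_shift z g x \<partial>lborel) = K * f x"
    unfolding K_def by blast+
qed

lemma synthesis:
  assumes "rapid f"
  shows "f = (\<lambda>x. \<integral>z. (inverse K * stft g f z) * phase_shift z g x \<partial>lborel)"
  using K(1) K(2)[OF assms] by (auto simp: mult.assoc)

text \<open>For rapidly decreasing \<open>f\<close> this is the short-time Fourier transform of \<open>A f\<close>; the integral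
  makes sense for all \<open>f\<close> in \<open>L\<^sup>2\<close>.\<close>

definition H :: "(real ^ 'n \<Rightarrow> complex) \<Rightarrow> 'n phase \<Rightarrow> complex" where
  "H f w = inverse K * (\<integral>z. stft g f z * kernel w z \<partial>lborel)"

text \<open>Expand \<open>f\<close> in shifts of \<open>g\<close> and let the functional \<open>\<phi> \<mapsto> \<langle>A \<phi>, \<pi>(w)g\<rangle>\<close> pass under the integral.\<close>

lemma operator_coefficients:
  assumes f: "rapid f"
  shows "A f (\<lambda>x. cnj (phase_shift w g x)) = H f w"
proof -
  have T: "schwartz_functional (\<lambda>\<phi>. A \<phi> (\<lambda>x. cnj (phase_shift w g x)))"
    by (rule operator_functionals(2)[OF cont rapid_cnj[OF rapid_phase_shift[OF g]]])
  have r: "rapid (\<lambda>u. (inverse K * stft g f (fst u)) * phase_shift (fst u) g (snd u))"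
    by (rule rapid_phase_family[OF rapid_cmult[OF rapid_stft[OF g f]] g])
  have "A f (\<lambda>x. cnj (phase_shift w g x)) =
     A (\<lambda>x. \<integral>z. (inverse K * stft g f z) * phase_shift z g x \<partial>lborel) (\<lambda>x. cnj (phase_shift w g x))"
    using synthesis[OF f] by simp
  also have "\<dots> = (\<integral>z. A (\<lambda>x. (inverse K * stft g f z) * phase_shift z g x) (\<lambda>x. cnj (phase_shift w g x)) \<partial>lborel)"
    using schwartz_functional_integral[OF T r] by simp
  also have "\<dots> = (\<integral>z. (inverse K * stft g f z) * kernel w z \<partial>lborel)"
    by (simp only: schwartz_functional_cmult[OF T rapid_phase_shift[OF g]] kernel_def)
  also have "\<dots> = H f w" by (simp add: H_def mult.assoc)
  finally show ?thesis .
qed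

text \<open>The bilinear form \<open>\<integral> (A f) \<theta>\<close>, expressed through phase space coefficients so that it is defined
  for \<open>f\<close> and \<open>\<theta>\<close> in \<open>L\<^sup>2\<close>.\<close>

definition Lam :: "(real ^ 'n \<Rightarrow> complex) \<Rightarrow> (real ^ 'n \<Rightarrow> complex) \<Rightarrow> complex" where
  "Lam f \<theta> = (\<integral>w. (cnj (inverse K) * H f w) * cnj (stft g (\<lambda>x. cnj (\<theta> x)) w) \<partial>lborel)"

lemma operator_eq_Lam:
  assumes f: "rapid f" and \<theta>: "rapid \<theta>"
  shows "A f \<theta> = Lam f \<theta>"
proof -
  let ?c = "\<lambda>x. cnj (\<theta> x)"
  have c: "rapid ?c" by (rule rapid_cnj[OF \<theta>])
  have T: "schwartz_functional (A f)" by (rule operator_functionals(1)[OF cont f])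
  have r: "rapid (\<lambda>u. cnj ((inverse K * stft g ?c (fst u)) * phase_shift (fst u) g (snd u)))"
    by (rule rapid_cnj[OF rapid_phase_family[OF rapid_cmult[OF rapid_stft[OF g c]] g]])
  have "\<theta> = (\<lambda>x. \<integral>w. cnj ((inverse K * stft g ?c w) * phase_shift w g x) \<partial>lborel)"
  proof
    fix x
    have "cnj (\<theta> x) = (\<integral>z. (inverse K * stft g ?c z) * phase_shift z g x \<partial>lborel)" using synthesis[OF c] by meson
    then show "\<theta> x = (\<integral>w. cnj ((inverse K * stft g ?c w) * phase_shift w g x) \<partial>lborel)"
      unfolding Bochner_Integration.integral_cnj by (metis complex_cnj_cnj)
  qed
  then have "A f \<theta> = A f (\<lambda>x. \<integral>w. cnj ((inverse K * stft g ?c w) * phase_shift w g x) \<partial>lborel)" by simp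
  also have "\<dots> = (\<integral>w. A f (\<lambda>x. cnj ((inverse K * stft g ?c w) * phase_shift w g x)) \<partial>lborel)"
    using schwartz_functional_integral[OF T r] by simp
  also have "\<dots> = Lam f \<theta>"
    unfolding Lam_def
  proof (rule Bochner_Integration.integral_cong[OF refl])
    fix w
    have "A f (\<lambda>x. cnj ((inverse K * stft g ?c w) * phase_shift w g x)) = cnj (inverse K * stft g ?c w) * A f (\<lambda>x. cnj (phase_shift w g x))"
      unfolding complex_cnj_mult by (rule schwartz_functional_cmult[OF T rapid_cnj[OF rapid_phase_shift[OF g]]])
    then show "A f (\<lambda>x. cnj ((inverse K * stft g ?c w) * phase_shift w g x)) = (cnj (inverse K) * H f w) * cnj (stft g ?c w)"
      unfolding operator_coefficients[OF f] by (simp add: mult_ac)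
  qed
  finally show ?thesis .
qed

lemma \<kappa>_continuous: "continuous_on UNIV \<kappa>"
  using tame_canonical_bi_Lipschitz[OF tame] by metis

lemma \<kappa>_borel [measurable]: "\<kappa> \<in> borel_measurable borel"
  by (rule borel_measurable_continuous_onI[OF \<kappa>_continuous])

lemma borel_measurable_wt_\<kappa>: "(\<lambda>z. wt N (w - \<kappa> z)) \<in> borel_measurable borel"
  by measurable

text \<open>The preimage \<open>z0\<close> of \<open>w\<close> is where the kernel concentrates; expansion of \<open>\<kappa>\<close> turns decay
  in \<open>w - \<kappa> z\<close> into decay in \<open>z - z0\<close>.\<close>

lemma kernel_weight_integral:
  obtains I where "I > 0" "\<And>w. integrable lborel (\<lambda>z. wt d (w - \<kappa> z))" "\<And>w. (\<integral>z. wt d (w - \<kappa> z) \<partial>lborel) \<le> I"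
proof -
  obtain L where L: "L > 0" "\<And>z z'. norm (z' - z) \<le> L * norm (\<kappa> z' - \<kappa> z)" and sur: "range \<kappa> = UNIV"
    using tame_canonical_bi_Lipschitz[OF tame] by metis
  have le: "wt d (\<kappa> z0 - \<kappa> z) \<le> (1 + L) ^ d * wt d (z - z0)" for z z0
  proof -
    have "1 + norm (z - z0) \<le> 1 + L * norm (\<kappa> z0 - \<kappa> z)" using L(2)[of z0 z] by (simp add: norm_minus_commute)
    also have "\<dots> \<le> (1 + L) * (1 + norm (\<kappa> z0 - \<kappa> z))"
      using L(1) by (simp add: algebra_simps)
    finally have "(1 + norm (z - z0)) ^ d \<le> (1 + L) ^ d * (1 + norm (\<kappa> z0 - \<kappa> z)) ^ d"
      unfolding power_mult_distrib[symmetric] by (intro power_mono) auto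
    then show ?thesis by (simp add: wt_def field_simps)
  qed
  have sh: "integrable lborel (\<lambda>z::'n phase. wt d (z - z0))" "(\<integral>z. wt d (z - z0) \<partial>lborel) = (\<integral>z. wt d (z :: 'n phase) \<partial>lborel)" for z0 :: "'n phase"
  proof -
    show "integrable lborel (\<lambda>z::'n phase. wt d (z - z0))"
    proof (rule integrable_wt_bound[of _ d "(1 + norm z0) ^ d"])
      show "norm (wt d (z - z0)) \<le> (1 + norm z0) ^ d * wt d z" for z
        using wt_shift[of d "z - z0" z0] by simp
    qed (use d in auto)
    show "(\<integral>z. wt d (z - z0) \<partial>lborel) = (\<integral>z. wt d (z :: 'n phase) \<partial>lborel)"
      using lborel_integral_shift[of "wt d" "- z0"] by simp
  qed
  have main: "integrable lborel (\<lambda>z. wt d (w - \<kappa> z)) \<and> (\<integral>z. wt d (w - \<kappa> z) \<partial>lborel) \<le> (1 + L) ^ d * (\<integral>z. wt d (z :: 'n phase) \<partial>lborel)" for w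
  proof -
    obtain z0 where z0: "w = \<kappa> z0" using sur by (metis UNIV_I imageE)
    have i: "integrable lborel (\<lambda>z. (1 + L) ^ d * wt d (z - z0))" by (rule integrable_mult_right[OF sh(1)])
    have j: "integrable lborel (\<lambda>z. wt d (w - \<kappa> z))"
      by (rule Bochner_Integration.integrable_bound[OF i])
        (use le[of z0] z0 borel_measurable_wt_\<kappa> L(1) in \<open>auto simp: abs_mult\<close>)
    have "(\<integral>z. wt d (w - \<kappa> z) \<partial>lborel) \<le> (\<integral>z. (1 + L) ^ d * wt d (z - z0) \<partial>lborel)"
      by (rule integral_mono[OF j i]) (use le z0 in simp)
    then show ?thesis using j sh(2)[of z0] by simp
  qed
  let ?J = "(1 + L) ^ d * (\<integral>z. wt d (z :: 'n phase) \<partial>lborel)"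
  have "?J \<ge> 0" using L(1) by (simp add: integral_nonneg_AE)
  then have p: "?J + 1 > 0" by linarith
  have "(\<integral>z. wt d (w - \<kappa> z) \<partial>lborel) \<le> ?J + 1" for w using main[of w] by linarith
  then show ?thesis using main by (intro that[OF p]) auto
qed

lemma stft_borel: "f \<in> L2 \<Longrightarrow> stft g f \<in> borel_measurable borel"
  using stft_bounded[OF g ga] by metis

lemma kernel_borel: "(\<lambda>z. kernel w z) \<in> borel_measurable borel"
  by (rule borel_measurable_continuous_onI[OF kernel_continuous_right])

lemma H_integrable:
  assumes f: "f \<in> L2"
  shows "integrable lborel (\<lambda>z. stft g f z * kernel w z)"
proof -
  obtain C where C: "C > 0" "\<And>w z. norm (kernel w z) \<le> C * wt d (w - \<kappa> z)" using kernel_bound by blast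
  obtain I where I: "\<And>w. integrable lborel (\<lambda>z. wt d (w - \<kappa> z))" using kernel_weight_integral by metis
  show ?thesis
  proof (rule Bochner_Integration.integrable_bound[OF integrable_mult_right[OF I[of w], of "L2_norm f * L2_norm g * C"]])
    show "(\<lambda>z. stft g f z * kernel w z) \<in> borel_measurable lborel" using stft_borel[OF f] kernel_borel by simp
    show "AE z in lborel. norm (stft g f z * kernel w z) \<le> norm (L2_norm f * L2_norm g * C * wt d (w - \<kappa> z))"
    proof (intro AE_I2)
      fix z
      have "norm (stft g f z * kernel w z) \<le> (L2_norm f * L2_norm g) * (C * wt d (w - \<kappa> z))"
        unfolding norm_mult by (intro mult_mono norm_stft_le[OF g f] C) auto
      then show "norm (stft g f z * kernel w z) \<le> norm (L2_norm f * L2_norm g * C * wt d (w - \<kappa> z))"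
        using C(1) by (simp add: abs_mult mult_ac)
    qed
  qed
qed

lemma H_continuous:
  assumes f: "f \<in> L2"
  shows "continuous_on UNIV (H f)"
proof (rule continuous_on_sequentiallyI)
  fix u w assume u: "u \<longlonglongrightarrow> (w :: 'n phase)"
  obtain C where C: "C > 0" "\<And>w z. norm (kernel w z) \<le> C * wt d (w - \<kappa> z)" using kernel_bound by blast
  obtain I where I: "\<And>w. integrable lborel (\<lambda>z. wt d (w - \<kappa> z))" using kernel_weight_integral by metis
  have "bounded (range (\<lambda>n. u n - w))"
    by (rule convergent_imp_bounded[OF tendsto_diff[OF u tendsto_const]])
  then obtain b where b: "\<And>n. norm (u n - w) \<le> b" unfolding bounded_iff by auto
  let ?c = "L2_norm f * L2_norm g * (C * (1 + b) ^ d)"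
  have "(\<lambda>n. \<integral>z. stft g f z * kernel (u n) z \<partial>lborel) \<longlonglongrightarrow> (\<integral>z. stft g f z * kernel w z \<partial>lborel)"
  proof (rule integral_dominated_convergence[where w = "\<lambda>z. ?c * wt d (w - \<kappa> z)"])
    show "(\<lambda>z. stft g f z * kernel w z) \<in> borel_measurable lborel" for w using stft_borel[OF f] kernel_borel by simp
    then show "(\<lambda>z. stft g f z * kernel (u n) z) \<in> borel_measurable lborel" for n .
    show "integrable lborel (\<lambda>z. ?c * wt d (w - \<kappa> z))" by (rule integrable_mult_right[OF I])
    show "AE z in lborel. (\<lambda>n. stft g f z * kernel (u n) z) \<longlonglongrightarrow> stft g f z * kernel w z"
      by (intro AE_I2 tendsto_mult tendsto_const continuous_on_tendsto_compose[OF kernel_continuous_left u]) auto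
    show "AE z in lborel. norm (stft g f z * kernel (u n) z) \<le> ?c * wt d (w - \<kappa> z)" for n
    proof (intro AE_I2)
      fix z
      have "wt d (u n - \<kappa> z) \<le> (1 + norm (w - u n)) ^ d * wt d (w - \<kappa> z)" using wt_shift[of d "u n - \<kappa> z" "w - u n"] by simp
      also have "\<dots> \<le> (1 + b) ^ d * wt d (w - \<kappa> z)"
        using b[of n] by (intro mult_right_mono power_mono) (auto simp: norm_minus_commute)
      finally have "norm (kernel (u n) z) \<le> C * ((1 + b) ^ d * wt d (w - \<kappa> z))"
        using C(1) by (intro order.trans[OF C(2)] mult_left_mono) auto
      then have "norm (stft g f z * kernel (u n) z) \<le> (L2_norm f * L2_norm g) * (C * ((1 + b) ^ d * wt d (w - \<kappa> z)))"
        unfolding norm_mult by (intro mult_mono norm_stft_le[OF g f]) auto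
      then show "norm (stft g f z * kernel (u n) z) \<le> ?c * wt d (w - \<kappa> z)" by (simp add: mult_ac)
    qed
  qed
  then show "(\<lambda>n. H f (u n)) \<longlonglongrightarrow> H f w" unfolding H_def by (intro tendsto_mult tendsto_const)
qed

lemma H_borel: "f \<in> L2 \<Longrightarrow> H f \<in> borel_measurable borel"
  by (rule borel_measurable_continuous_onI[OF H_continuous])

lemma H_linear:
  assumes "f \<in> L2" "h \<in> L2"
  shows "H (\<lambda>x. p * f x + q * h x) w = p * H f w + q * H h w"
proof -
  have "(\<integral>z. stft g (\<lambda>x. p * f x + q * h x) z * kernel w z \<partial>lborel) = (\<integral>z. p * (stft g f z * kernel w z) + q * (stft g h z * kernel w z) \<partial>lborel)"
    by (simp add: stft_linear[OF g assms] distrib_right mult.assoc)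
  also have "\<dots> = p * (\<integral>z. stft g f z * kernel w z \<partial>lborel) + q * (\<integral>z. stft g h z * kernel w z \<partial>lborel)"
    by (simp add: H_integrable assms)
  finally show ?thesis by (simp add: H_def algebra_simps)
qed

text \<open>The Schur test: the majorant \<open>wt d (w - \<kappa> z)\<close> of the kernel has bounded integrals in
  \<open>z\<close> (by expansion of \<open>\<kappa>\<close>) and in \<open>w\<close> (by translation invariance).\<close>

lemma H_L2_bound:
  obtains B where "B > 0" "\<And>f. f \<in> L2 \<Longrightarrow> integrable lborel (\<lambda>w. (norm (H f w))\<^sup>2)"
    "\<And>f. f \<in> L2 \<Longrightarrow> (\<integral>w. (norm (H f w))\<^sup>2 \<partial>lborel) \<le> (B * L2_norm f)\<^sup>2"
proof -
  obtain C where C: "C > 0" "\<And>w z. norm (kernel w z) \<le> C * wt d (w - \<kappa> z)" using kernel_bound by blast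
  obtain I where I: "I > 0" "\<And>w. integrable lborel (\<lambda>z. wt d (w - \<kappa> z))" "\<And>w. (\<integral>z. wt d (w - \<kappa> z) \<partial>lborel) \<le> I"
    using kernel_weight_integral by metis
  obtain M where M: "M > 0" "\<And>f. f \<in> L2 \<Longrightarrow> integrable lborel (\<lambda>z. (norm (stft g f z))\<^sup>2)"
    "\<And>f. f \<in> L2 \<Longrightarrow> (\<integral>z. (norm (stft g f z))\<^sup>2 \<partial>lborel) \<le> (M * L2_norm f)\<^sup>2"
    using stft_bounded[OF g ga] by metis
  define J where "J = (\<integral>w. wt d (w :: 'n phase) \<partial>lborel)"
  have J0: "J \<ge> 0" by (simp add: J_def integral_nonneg_AE)
  define D where "D = (norm (inverse K) * C)\<^sup>2 * I"
  have D0: "D \<ge> 0" using I(1) by (simp add: D_def)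
  define B where "B = sqrt (D * J) * M + 1"
  have B: "B > 0" using M(1) D0 J0 by (simp add: B_def add_nonneg_pos)
  have pt: "(norm (H f w))\<^sup>2 \<le> D * (\<integral>z. (norm (stft g f z))\<^sup>2 * wt d (w - \<kappa> z) \<partial>lborel) \<and>
      integrable lborel (\<lambda>z. (norm (stft g f z))\<^sup>2 * wt d (w - \<kappa> z))" if f: "f \<in> L2" for f w
  proof -
    let ?p = "\<lambda>z. norm (stft g f z) * sqrt (wt d (w - \<kappa> z))" and ?q = "\<lambda>z. sqrt (wt d (w - \<kappa> z))"
    have m: "?p \<in> borel_measurable lborel" "?q \<in> borel_measurable lborel" using stft_borel[OF f] by measurable
    have ip: "integrable lborel (\<lambda>z. (norm (stft g f z))\<^sup>2 * wt d (w - \<kappa> z))"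
    proof (rule Bochner_Integration.integrable_bound[OF M(2)[OF f]])
      show "(\<lambda>z. (norm (stft g f z))\<^sup>2 * wt d (w - \<kappa> z)) \<in> borel_measurable lborel" using stft_borel[OF f] by measurable
    qed (auto simp: abs_mult mult_left_le)
    have sq: "(?p z)\<^sup>2 = (norm (stft g f z))\<^sup>2 * wt d (w - \<kappa> z)" "(?q z)\<^sup>2 = wt d (w - \<kappa> z)" "\<bar>?p z * ?q z\<bar> = norm (stft g f z) * wt d (w - \<kappa> z)" for z
      by (simp_all add: power_mult_distrib abs_mult mult.assoc)
    have cs: "integrable lborel (\<lambda>z. ?p z * ?q z)"
       "(\<integral>z. norm (stft g f z) * wt d (w - \<kappa> z) \<partial>lborel) \<le> sqrt (\<integral>z. (norm (stft g f z))\<^sup>2 * wt d (w - \<kappa> z) \<partial>lborel) * sqrt (\<integral>z. wt d (w - \<kappa> z) \<partial>lborel)"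
      using integral_Cauchy_Schwarz[OF m] ip I(2)[of w] unfolding sq by auto
    have i1: "integrable lborel (\<lambda>z. norm (stft g f z) * wt d (w - \<kappa> z))"
      using cs(1) by (simp add: mult.assoc)
    have "norm (H f w) \<le> norm (inverse K) * (\<integral>z. C * (norm (stft g f z) * wt d (w - \<kappa> z)) \<partial>lborel)"
      unfolding H_def norm_mult
    proof (intro mult_left_mono norm_integral_le integrable_mult_right i1)
      show "norm (stft g f z * kernel w z) \<le> C * (norm (stft g f z) * wt d (w - \<kappa> z))" for z
        using mult_left_mono[OF C(2)[of w z] norm_ge_zero[of "stft g f z"]] by (simp add: norm_mult mult_ac)
    qed simp
    also have "\<dots> = (norm (inverse K) * C) * (\<integral>z. norm (stft g f z) * wt d (w - \<kappa> z) \<partial>lborel)" by simp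
    also have "\<dots> \<le> (norm (inverse K) * C) * (sqrt (\<integral>z. (norm (stft g f z))\<^sup>2 * wt d (w - \<kappa> z) \<partial>lborel) * sqrt I)"
      using C(1) I(3)[of w] by (intro mult_left_mono order.trans[OF cs(2)]) (auto simp: integral_nonneg_AE)
    finally have "(norm (H f w))\<^sup>2 \<le> ((norm (inverse K) * C) * (sqrt (\<integral>z. (norm (stft g f z))\<^sup>2 * wt d (w - \<kappa> z) \<partial>lborel) * sqrt I))\<^sup>2"
      by (rule power_mono) simp
    also have "\<dots> = D * (\<integral>z. (norm (stft g f z))\<^sup>2 * wt d (w - \<kappa> z) \<partial>lborel)"
      using I(1) by (simp add: power_mult_distrib D_def integral_nonneg_AE)
    finally show ?thesis using ip by blast
  qed
  have nn: "(\<integral>\<^sup>+w. ennreal ((norm (H f w))\<^sup>2) \<partial>lborel) \<le> ennreal ((B * L2_norm f)\<^sup>2)" if f: "f \<in> L2" for f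
  proof -
    note [measurable] = stft_borel[OF f]
    have "(\<integral>\<^sup>+w. ennreal ((norm (H f w))\<^sup>2) \<partial>lborel) \<le> (\<integral>\<^sup>+w. ennreal D * (\<integral>\<^sup>+z. ennreal ((norm (stft g f z))\<^sup>2 * wt d (w - \<kappa> z)) \<partial>lborel) \<partial>lborel)"
    proof (intro nn_integral_mono)
      fix w
      have "ennreal ((norm (H f w))\<^sup>2) \<le> ennreal (D * (\<integral>z. (norm (stft g f z))\<^sup>2 * wt d (w - \<kappa> z) \<partial>lborel))"
        by (rule ennreal_leI) (use pt[OF f] in blast)
      also have "\<dots> = ennreal D * (\<integral>\<^sup>+z. ennreal ((norm (stft g f z))\<^sup>2 * wt d (w - \<kappa> z)) \<partial>lborel)"
        using pt[OF f, of w] D0 by (subst nn_integral_eq_integral) (auto simp: ennreal_mult integral_nonneg_AE)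
      finally show "ennreal ((norm (H f w))\<^sup>2) \<le> ennreal D * (\<integral>\<^sup>+z. ennreal ((norm (stft g f z))\<^sup>2 * wt d (w - \<kappa> z)) \<partial>lborel)" .
    qed
    also have "\<dots> = ennreal D * (\<integral>\<^sup>+w. \<integral>\<^sup>+z. ennreal ((norm (stft g f z))\<^sup>2 * wt d (w - \<kappa> z)) \<partial>lborel \<partial>lborel)"
      by (intro nn_integral_cmult lborel.borel_measurable_nn_integral) measurable
    also have "(\<integral>\<^sup>+w. \<integral>\<^sup>+z. ennreal ((norm (stft g f z))\<^sup>2 * wt d (w - \<kappa> z)) \<partial>lborel \<partial>lborel) =
       (\<integral>\<^sup>+z. \<integral>\<^sup>+w. ennreal ((norm (stft g f z))\<^sup>2 * wt d (w - \<kappa> z)) \<partial>lborel \<partial>lborel)"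
      by (rule lborel_pair.Fubini'[symmetric]) measurable
    also have "\<dots> = (\<integral>\<^sup>+z. ennreal ((norm (stft g f z))\<^sup>2 * J) \<partial>lborel)"
    proof (intro nn_integral_cong)
      fix z
      have "(\<lambda>w::'n phase. wt d (w + - \<kappa> z)) = (\<lambda>w. wt d (w - \<kappa> z))" by simp
      moreover have "integrable lborel (\<lambda>w::'n phase. wt d (w - \<kappa> z))"
      proof (rule integrable_wt_bound[of _ d "(1 + norm (\<kappa> z)) ^ d"])
        show "norm (wt d (w - \<kappa> z)) \<le> (1 + norm (\<kappa> z)) ^ d * wt d w" for w
          using wt_shift[of d "w - \<kappa> z" "\<kappa> z"] by simp
      qed (use d in auto)
      ultimately have "(\<integral>\<^sup>+w. ennreal (wt d (w - \<kappa> z)) \<partial>lborel) = ennreal J"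
        using lborel_integral_shift[of "wt d" "- \<kappa> z"] by (simp add: nn_integral_eq_integral J_def)
      then show "(\<integral>\<^sup>+w. ennreal ((norm (stft g f z))\<^sup>2 * wt d (w - \<kappa> z)) \<partial>lborel) = ennreal ((norm (stft g f z))\<^sup>2 * J)"
        using J0 by (simp add: ennreal_mult nn_integral_cmult)
    qed
    also have "\<dots> = ennreal ((\<integral>z. (norm (stft g f z))\<^sup>2 \<partial>lborel) * J)"
      using M(2)[OF f] J0 by (subst nn_integral_eq_integral) auto
    also have "ennreal D * \<dots> \<le> ennreal (D * ((M * L2_norm f)\<^sup>2 * J))"
      using D0 J0 M(3)[OF f] by (subst ennreal_mult[symmetric]) (auto simp: integral_nonneg_AE intro!: ennreal_leI mult_left_mono mult_right_mono)
    also have "\<dots> \<le> ennreal ((B * L2_norm f)\<^sup>2)"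
    proof (rule ennreal_leI)
      have "D * ((M * L2_norm f)\<^sup>2 * J) = (sqrt (D * J) * M)\<^sup>2 * (L2_norm f)\<^sup>2"
        using D0 J0 by (simp add: power_mult_distrib mult_ac)
      also have "\<dots> \<le> B\<^sup>2 * (L2_norm f)\<^sup>2"
        using M(1) D0 J0 by (intro mult_right_mono power_mono) (auto simp: B_def)
      finally show "D * ((M * L2_norm f)\<^sup>2 * J) \<le> (B * L2_norm f)\<^sup>2" by (simp add: power_mult_distrib)
    qed
    finally show ?thesis .
  qed
  show ?thesis
  proof (rule that[OF B])
    fix f :: "real ^ 'n \<Rightarrow> complex" assume f: "f \<in> L2"
    show i: "integrable lborel (\<lambda>w. (norm (H f w))\<^sup>2)"
    proof (rule integrableI_bounded)
      show "(\<lambda>w. (norm (H f w))\<^sup>2) \<in> borel_measurable lborel" using H_borel[OF f] by measurable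
      show "(\<integral>\<^sup>+w. ennreal (norm ((norm (H f w))\<^sup>2)) \<partial>lborel) < \<infinity>"
        using nn[OF f] by (auto intro: order.strict_trans1)
    qed
    have "ennreal (\<integral>w. (norm (H f w))\<^sup>2 \<partial>lborel) \<le> ennreal ((B * L2_norm f)\<^sup>2)"
      using nn[OF f] nn_integral_eq_integral[OF i] by simp
    then show "(\<integral>w. (norm (H f w))\<^sup>2 \<partial>lborel) \<le> (B * L2_norm f)\<^sup>2" by simp
  qed
qed

lemma Lam_integrable_bound:
  obtains B where "B > 0"
    "\<And>f \<theta>. f \<in> L2 \<Longrightarrow> \<theta> \<in> L2 \<Longrightarrow> integrable lborel (\<lambda>w. (cnj (inverse K) * H f w) * cnj (stft g (\<lambda>x. cnj (\<theta> x)) w))"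
    "\<And>f \<theta>. f \<in> L2 \<Longrightarrow> \<theta> \<in> L2 \<Longrightarrow> norm (Lam f \<theta>) \<le> B * L2_norm f * L2_norm \<theta>"
proof -
  obtain B where B: "B > 0" "\<And>f. f \<in> L2 \<Longrightarrow> integrable lborel (\<lambda>w. (norm (H f w))\<^sup>2)"
    "\<And>f. f \<in> L2 \<Longrightarrow> (\<integral>w. (norm (H f w))\<^sup>2 \<partial>lborel) \<le> (B * L2_norm f)\<^sup>2" using H_L2_bound by metis
  obtain M where M: "M > 0" "\<And>f. f \<in> L2 \<Longrightarrow> integrable lborel (\<lambda>z. (norm (stft g f z))\<^sup>2)"
    "\<And>f. f \<in> L2 \<Longrightarrow> (\<integral>z. (norm (stft g f z))\<^sup>2 \<partial>lborel) \<le> (M * L2_norm f)\<^sup>2"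
    using stft_bounded[OF g ga] by metis
  have main: "integrable lborel (\<lambda>w. (cnj (inverse K) * H f w) * cnj (stft g (\<lambda>x. cnj (\<theta> x)) w)) \<and>
     norm (Lam f \<theta>) \<le> (norm (inverse K) * B * M) * L2_norm f * L2_norm \<theta>" if f: "f \<in> L2" and \<theta>: "\<theta> \<in> L2" for f \<theta>
  proof -
    let ?c = "\<lambda>x. cnj (\<theta> x)"
    have c: "?c \<in> L2" "L2_norm ?c = L2_norm \<theta>" using L2_cnj[OF \<theta>] by auto
    have m: "(\<lambda>w. norm (H f w)) \<in> borel_measurable lborel" "(\<lambda>w. norm (stft g ?c w)) \<in> borel_measurable lborel"
      using H_borel[OF f] stft_borel[OF c(1)] by measurable
    note cs = integral_Cauchy_Schwarz[OF m B(2)[OF f] M(2)[OF c(1)]]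
    have i: "integrable lborel (\<lambda>w. norm (inverse K) * (norm (H f w) * norm (stft g ?c w)))" by (rule integrable_mult_right[OF cs(1)])
    have i': "integrable lborel (\<lambda>w. (cnj (inverse K) * H f w) * cnj (stft g ?c w))"
    proof (rule Bochner_Integration.integrable_bound[OF i])
      show "(\<lambda>w. (cnj (inverse K) * H f w) * cnj (stft g ?c w)) \<in> borel_measurable lborel"
        using H_borel[OF f] stft_borel[OF c(1)] by measurable
    qed (simp add: norm_mult norm_inverse mult.assoc)
    have "norm (Lam f \<theta>) \<le> (\<integral>w. norm (inverse K) * (norm (H f w) * norm (stft g ?c w)) \<partial>lborel)"
      unfolding Lam_def by (rule norm_integral_le[OF i]) (simp add: norm_mult norm_inverse mult.assoc)
    also have "\<dots> = norm (inverse K) * (\<integral>w. norm (H f w) * norm (stft g ?c w) \<partial>lborel)" by simp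
    also have "\<dots> \<le> norm (inverse K) * ((B * L2_norm f) * (M * L2_norm \<theta>))"
    proof (rule mult_left_mono)
      have "(\<integral>w. norm (H f w) * norm (stft g ?c w) \<partial>lborel) \<le> sqrt (\<integral>w. (norm (H f w))\<^sup>2 \<partial>lborel) * sqrt (\<integral>w. (norm (stft g ?c w))\<^sup>2 \<partial>lborel)"
        using cs(2) by (simp add: abs_mult)
      also have "\<dots> \<le> (B * L2_norm f) * (M * L2_norm \<theta>)"
        using B(1) M(1) B(3)[OF f] M(3)[OF c(1)] c(2)
        by (intro mult_mono real_le_lsqrt) (auto simp: integral_nonneg_AE)
      finally show "(\<integral>w. norm (H f w) * norm (stft g ?c w) \<partial>lborel) \<le> (B * L2_norm f) * (M * L2_norm \<theta>)" .
    qed simp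
    finally show ?thesis using i' by (simp add: mult_ac)
  qed
  have "norm (inverse K) * B * M > 0" using K(1) B(1) M(1) by simp
  then show ?thesis using main by (intro that[of "norm (inverse K) * B * M"]) auto
qed

lemma Lam_integrable:
  assumes "f \<in> L2" "\<theta> \<in> L2"
  shows "integrable lborel (\<lambda>w. (cnj (inverse K) * H f w) * cnj (stft g (\<lambda>x. cnj (\<theta> x)) w))"
  by (rule Lam_integrable_bound) (use assms in blast)

lemma Lam_bound:
  obtains B where "B > 0" "\<And>f \<theta>. f \<in> L2 \<Longrightarrow> \<theta> \<in> L2 \<Longrightarrow> norm (Lam f \<theta>) \<le> B * L2_norm f * L2_norm \<theta>"
proof (rule Lam_integrable_bound)
  fix B :: real
  assume "B > 0" "\<And>f \<theta>. f \<in> L2 \<Longrightarrow> \<theta> \<in> L2 \<Longrightarrow> norm (Lam f \<theta>) \<le> B * L2_norm f * L2_norm \<theta>"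
  then show thesis by (rule that)
qed

lemma Lam_linear:
  assumes "f \<in> L2" "h \<in> L2" "\<theta> \<in> L2"
  shows "Lam (\<lambda>x. p * f x + q * h x) \<theta> = p * Lam f \<theta> + q * Lam h \<theta>"
proof -
  let ?V = "\<lambda>w. cnj (stft g (\<lambda>x. cnj (\<theta> x)) w)"
  have i: "integrable lborel (\<lambda>w. (cnj (inverse K) * H f w) * ?V w)" "integrable lborel (\<lambda>w. (cnj (inverse K) * H h w) * ?V w)"
    by (rule Lam_integrable; fact)+
  have "Lam (\<lambda>x. p * f x + q * h x) \<theta> = (\<integral>w. p * ((cnj (inverse K) * H f w) * ?V w) + q * ((cnj (inverse K) * H h w) * ?V w) \<partial>lborel)"
    unfolding Lam_def H_linear[OF assms(1,2)]
    by (rule Bochner_Integration.integral_cong[OF refl]) (simp add: algebra_simps)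
  also have "\<dots> = p * Lam f \<theta> + q * Lam h \<theta>"
    unfolding Lam_def using i by simp
  finally show ?thesis .
qed

lemma Lam_diff_right:
  assumes "f \<in> L2" "\<theta> \<in> L2" "\<eta> \<in> L2"
  shows "Lam f (\<lambda>x. \<theta> x - \<eta> x) = Lam f \<theta> - Lam f \<eta>"
proof -
  let ?G = "\<lambda>w. cnj (inverse K) * H f w"
  let ?V = "\<lambda>\<theta> w. cnj (stft g (\<lambda>x. cnj (\<theta> x)) w)"
  have i: "integrable lborel (\<lambda>w. ?G w * ?V \<theta> w)" "integrable lborel (\<lambda>w. ?G w * ?V \<eta> w)"
    by (rule Lam_integrable; fact)+
  have "?V (\<lambda>x. \<theta> x - \<eta> x) w = ?V \<theta> w - ?V \<eta> w" for w
    using stft_diff[OF g L2_cnj(1)[OF assms(2)] L2_cnj(1)[OF assms(3)]] by simp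
  then have "Lam f (\<lambda>x. \<theta> x - \<eta> x) = (\<integral>w. ?G w * ?V \<theta> w - ?G w * ?V \<eta> w \<partial>lborel)"
    unfolding Lam_def by (simp add: right_diff_distrib)
  also have "\<dots> = Lam f \<theta> - Lam f \<eta>" unfolding Lam_def by (rule Bochner_Integration.integral_diff[OF i])
  finally show ?thesis .
qed

end

section \<open>The bounded extension\<close>

lemma eq_zero_if_small:
  fixes z :: complex
  assumes "\<And>e. e > 0 \<Longrightarrow> norm z \<le> c * e" "c \<ge> 0"
  shows "z = 0"
proof -
  have "norm z \<le> 0 + e" if "e > 0" for e
  proof -
    have "norm z \<le> c * (e / (c + 1))" using assms(2) that by (intro assms(1) divide_pos_pos) auto
    also have "\<dots> \<le> e" using assms(2) that by (simp add: field_simps)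
    finally show ?thesis by simp
  qed
  then have "norm z \<le> 0" by (rule field_le_epsilon)
  then show ?thesis by simp
qed

context gabor_operator
begin

lemma L2_approx:
  fixes f :: "real ^ 'n \<Rightarrow> complex"
  assumes "f \<in> L2" "e > 0"
  obtains \<phi> where "rapid \<phi>" "\<phi> \<in> L2" "L2_norm (\<lambda>x. f x - \<phi> x) < e"
  using rapid_dense_L2[OF g ga assms(1)] assms(2) unfolding L2_limit_def by (metis rapid_L2)

text \<open>The Lipschitz map \<open>\<kappa>\<close> grows at most linearly.\<close>

lemma phase_growth:
  obtains K1 where "K1 > 0" "\<And>w z. 1 + norm w \<le> K1 * ((1 + norm z) * (1 + norm (w - \<kappa> z)))"
proof -
  obtain L where L: "L > 0" "\<And>z z'. norm (\<kappa> z' - \<kappa> z) \<le> L * norm (z' - z)"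
    using tame_canonical_bi_Lipschitz[OF tame] by metis
  let ?K = "1 + norm (\<kappa> 0) + L"
  have "1 + norm w \<le> ?K * ((1 + norm z) * (1 + norm (w - \<kappa> z)))" for w z
  proof -
    let ?P = "(1 + norm z) * (1 + norm (w - \<kappa> z))"
    have "?P = 1 + norm z + norm (w - \<kappa> z) + norm z * norm (w - \<kappa> z)" by (simp add: algebra_simps)
    moreover have "0 \<le> norm z * norm (w - \<kappa> z)" by simp
    ultimately have P: "1 + norm (w - \<kappa> z) \<le> ?P" "1 \<le> ?P" "norm z \<le> ?P"
      using norm_ge_zero[of z] norm_ge_zero[of "w - \<kappa> z"] by linarith+
    have "norm w \<le> norm (w - \<kappa> z) + norm (\<kappa> z)" using norm_triangle_ineq[of "w - \<kappa> z" "\<kappa> z"] by simp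
    also have "norm (\<kappa> z) \<le> norm (\<kappa> 0) + L * norm z"
      using norm_triangle_ineq[of "\<kappa> z - \<kappa> 0" "\<kappa> 0"] L(2)[of z 0] by simp
    finally have "1 + norm w \<le> (1 + norm (w - \<kappa> z)) + norm (\<kappa> 0) * 1 + L * norm z" by simp
    also have "\<dots> \<le> ?P + norm (\<kappa> 0) * ?P + L * ?P"
      using P L(1) by (intro add_mono mult_left_mono) auto
    also have "\<dots> = ?K * ?P" by (simp add: algebra_simps)
    finally show ?thesis .
  qed
  moreover have "?K > 0" using L(1) norm_ge_zero[of "\<kappa> 0"] by linarith
  ultimately show ?thesis using that by blast
qed

lemma weight_transfer:
  obtains C where "C > 0" "\<And>w z. wt m z * wt m (w - \<kappa> z) \<le> C * wt m w"
proof -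
  obtain K1 where K1: "K1 > 0" "\<And>w z. 1 + norm w \<le> K1 * ((1 + norm z) * (1 + norm (w - \<kappa> z)))"
    using phase_growth by blast
  have "wt m z * wt m (w - \<kappa> z) \<le> K1 ^ m * wt m w" for w z
  proof -
    have "(1 + norm w) ^ m \<le> (K1 * ((1 + norm z) * (1 + norm (w - \<kappa> z)))) ^ m"
      by (intro power_mono K1) auto
    then have "(1 + norm w) ^ m \<le> K1 ^ m * ((1 + norm z) ^ m * (1 + norm (w - \<kappa> z)) ^ m)"
      by (simp only: power_mult_distrib)
    then show ?thesis by (simp add: wt_def divide_simps mult_ac)
  qed
  then show ?thesis using K1(1) by (intro that[of "K1 ^ m"]) auto
qed

lemma norm_H_le_integral: "f \<in> L2 \<Longrightarrow> norm (H f w) \<le> norm (inverse K) * (\<integral>z. norm (stft g f z * kernel w z) \<partial>lborel)"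
  unfolding H_def norm_mult[of "inverse K"] by (intro mult_left_mono integral_norm_bound) simp

text \<open>The kernel and the transform of \<open>\<phi>\<close> decay in \<open>w - \<kappa> z\<close> and in \<open>z\<close>; together this is decay in
  \<open>w\<close>.\<close>

lemma H_decay:
  assumes \<phi>: "rapid \<phi>"
  obtains C where "C > 0" "\<And>w. norm (H \<phi> w) \<le> C * wt m w"
proof -
  obtain C1 where C1: "C1 > 0" "\<And>z. norm (stft g \<phi> z) \<le> C1 * wt (d + m) z" using rapid_bound[OF rapid_stft[OF g \<phi>]] by blast
  obtain C2 where C2: "C2 > 0" "\<And>w z. norm (kernel w z) \<le> C2 * wt m (w - \<kappa> z)" using kernel_bound by blast
  obtain C3 where C3: "C3 > 0" "\<And>w z. wt m z * wt m (w - \<kappa> z) \<le> C3 * wt m w" using weight_transfer by blast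
  \<comment> \<open>The constant is \<open>?C + 1\<close> only to be positive.\<close>
  let ?C = "norm (inverse K) * (C1 * C2 * C3 * (\<integral>z. wt d (z :: 'n phase) \<partial>lborel))"
  have "norm (H \<phi> w) \<le> (?C + 1) * wt m w" for w
  proof -
    have i: "integrable lborel (\<lambda>z. (C1 * C2 * C3 * wt m w) * wt d (z :: 'n phase))" by (intro integrable_mult_right integrable_wt d)
    have "norm (stft g \<phi> z * kernel w z) \<le> (C1 * C2 * C3 * wt m w) * wt d z" for z
    proof -
      have "norm (stft g \<phi> z * kernel w z) \<le> (C1 * wt (d + m) z) * (C2 * wt m (w - \<kappa> z))"
        unfolding norm_mult using C1(1) by (intro mult_mono C1 C2) auto
      also have "\<dots> = (C1 * C2 * wt d z) * (wt m z * wt m (w - \<kappa> z))" by (simp add: wt_add mult_ac)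
      also have "\<dots> \<le> (C1 * C2 * wt d z) * (C3 * wt m w)" using C1(1) C2(1) by (intro mult_left_mono C3) auto
      finally show ?thesis by (simp add: mult_ac)
    qed
    then have "(\<integral>z. norm (stft g \<phi> z * kernel w z) \<partial>lborel) \<le> (\<integral>z. (C1 * C2 * C3 * wt m w) * wt d (z :: 'n phase) \<partial>lborel)"
      using C1(1) C2(1) C3(1) by (intro integral_mono'[OF i]) auto
    then have "norm (H \<phi> w) \<le> norm (inverse K) * (\<integral>z. (C1 * C2 * C3 * wt m w) * wt d (z :: 'n phase) \<partial>lborel)"
      by (rule order.trans[OF norm_H_le_integral[OF rapid_L2[OF \<phi>]] mult_left_mono]) simp
    also have "\<dots> = ?C * wt m w" by (simp add: mult_ac)
    also have "\<dots> \<le> (?C + 1) * wt m w" by (intro mult_right_mono) auto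
    finally show ?thesis .
  qed
  moreover have "?C + 1 > 0" using C1(1) C2(1) C3(1) by (intro add_nonneg_pos mult_nonneg_nonneg integral_nonneg_AE) auto
  ultimately show ?thesis using that by blast
qed

text \<open>Synthesis of a function from the coefficients \<open>H f\<close>. For rapidly decreasing \<open>f\<close> the integral
  converges because the coefficients decay. Under the nonrefocusing condition it also converges for
  \<open>f\<close> in \<open>L\<^sup>2\<close> of compact support, although the coefficients need not decay when the position of
  \<open>w\<close> is large.\<close>

definition kernel_image :: "(real ^ 'n \<Rightarrow> complex) \<Rightarrow> real ^ 'n \<Rightarrow> complex" where
  "kernel_image f x = (\<integral>w. (cnj (inverse K) * H f w) * phase_shift w g x \<partial>lborel)"

lemma kernel_image_borel: "f \<in> L2 \<Longrightarrow> kernel_image f \<in> borel_measurable borel"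
  unfolding kernel_image_def by (rule borel_measurable_superposition[OF g borel_measurable_times[OF _ H_borel]]) auto

lemma coefficient_integrable:
  assumes \<phi>: "rapid \<phi>"
  shows "integrable lborel (\<lambda>w. cnj (inverse K) * H \<phi> w)"
proof (rule integrable_mult_right)
  obtain C where "C > 0" "\<And>w. norm (H \<phi> w) \<le> C * wt d w" using H_decay[OF \<phi>] by blast
  then show "integrable lborel (H \<phi>)" using H_borel[OF rapid_L2[OF \<phi>]] by (intro integrable_wt_bound[OF _ d]) auto
qed

lemma kernel_image_L2:
  assumes \<phi>: "rapid \<phi>"
  shows "kernel_image \<phi> \<in> L2"
proof -
  let ?k = "2 * DIM(real ^ 'n)"
  obtain C where C: "C > 0" "\<And>w. norm (H \<phi> w) \<le> C * wt (d + ?k) w" using H_decay[OF \<phi>] by blast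
  obtain G where G: "G > 0" "\<And>x. norm (g x) \<le> G * wt ?k x" using rapid_bound[OF g] by blast
  define D where "D = (\<integral>w. norm (inverse K) * C * G * wt d (w :: 'n phase) \<partial>lborel)"
  have bd: "norm (kernel_image \<phi> x) \<le> D * wt ?k x" for x
  proof -
    have i: "integrable lborel (\<lambda>w. (norm (inverse K) * C * G * wt d (w :: 'n phase)) * wt ?k x)"
      by (intro integrable_mult_right integrable_mult_left integrable_wt d)
    have "norm (kernel_image \<phi> x) \<le> (\<integral>w. (norm (inverse K) * C * G * wt d (w :: 'n phase)) * wt ?k x \<partial>lborel)"
      unfolding kernel_image_def
    proof (rule norm_integral_le[OF i])
      fix w :: "'n phase"
      have fw: "norm (fst w) \<le> norm w" by (metis norm_fst_le prod.collapse)
      have "wt ?k (x - fst w) \<le> (1 + norm (fst w)) ^ ?k * wt ?k x" using wt_shift[of ?k "x - fst w" "fst w"] by simp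
      also have "\<dots> \<le> (1 + norm w) ^ ?k * wt ?k x" using fw by (intro mult_right_mono power_mono) auto
      finally have s: "norm (g (x - fst w)) \<le> G * ((1 + norm w) ^ ?k * wt ?k x)"
        using G(1) by (intro order.trans[OF G(2)] mult_left_mono) auto
      have "norm ((cnj (inverse K) * H \<phi> w) * phase_shift w g x) = norm (inverse K) * norm (H \<phi> w) * norm (g (x - fst w))"
        by (simp add: norm_mult norm_inverse)
      also have "\<dots> \<le> norm (inverse K) * (C * wt (d + ?k) w) * (G * ((1 + norm w) ^ ?k * wt ?k x))"
        using C(1) by (intro mult_mono s C) auto
      also have "\<dots> = (norm (inverse K) * C * G * wt d w) * wt ?k x * ((1 + norm w) ^ ?k * wt ?k w)"
        unfolding wt_add by (simp only: mult_ac)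
      finally show "norm ((cnj (inverse K) * H \<phi> w) * phase_shift w g x) \<le> (norm (inverse K) * C * G * wt d w) * wt ?k x"
        by simp
    qed
    then show ?thesis by (simp add: D_def)
  qed
  show ?thesis
  proof (rule L2I[OF kernel_image_borel[OF rapid_L2[OF \<phi>]]])
    show "integrable lborel (\<lambda>x. (norm (kernel_image \<phi> x))\<^sup>2)"
    proof (rule integrable_wt_bound[of _ ?k "D\<^sup>2"])
      show "(\<lambda>x. (norm (kernel_image \<phi> x))\<^sup>2) \<in> borel_measurable lborel" using kernel_image_borel[OF rapid_L2[OF \<phi>]] by measurable
      fix x
      have "(norm (kernel_image \<phi> x))\<^sup>2 \<le> (D * wt ?k x)\<^sup>2" using bd by (intro power_mono) auto
      also have "\<dots> = D\<^sup>2 * (wt ?k x * wt ?k x)" by (simp add: power_mult_distrib power2_eq_square)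
      also have "\<dots> \<le> D\<^sup>2 * (wt ?k x * 1)" by (intro mult_left_mono) auto
      finally show "norm ((norm (kernel_image \<phi> x))\<^sup>2) \<le> D\<^sup>2 * wt ?k x" by simp
    qed simp
  qed
qed

lemma kernel_image_pairing:
  assumes "rapid \<phi>" "\<theta> \<in> L2"
  shows "(\<integral>x. kernel_image \<phi> x * \<theta> x \<partial>lborel) = Lam \<phi> \<theta>"
  unfolding kernel_image_def Lam_def by (rule phase_space_Fubini_L2[OF g coefficient_integrable[OF assms(1)] assms(2)])

lemma Lam_diff_left:
  assumes "f \<in> L2" "h \<in> L2" "\<theta> \<in> L2"
  shows "Lam (\<lambda>x. f x - h x) \<theta> = Lam f \<theta> - Lam h \<theta>"
  using Lam_linear[OF assms, of 1 "-1"] by simp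

lemma integral_pair_diff:
  assumes "u \<in> L2" "v \<in> L2" "\<theta> \<in> L2"
  shows "(\<integral>x. (u x - v x) * \<theta> x \<partial>lborel) = (\<integral>x. u x * \<theta> x \<partial>lborel) - (\<integral>x. v x * \<theta> x \<partial>lborel)"
  unfolding left_diff_distrib
  by (rule Bochner_Integration.integral_diff[OF L2_Cauchy_Schwarz(1)[OF assms(1,3)] L2_Cauchy_Schwarz(1)[OF assms(2,3)]])

text \<open>Approximate \<open>f\<close> by rapidly decreasing \<open>\<phi> n\<close> at a geometric rate. Boundedness of \<open>Lam\<close>
  carries the rate over to the functions \<open>kernel_image (\<phi> n)\<close>, which therefore converge in \<open>L\<^sup>2\<close>.\<close>

lemma representing_element:
  assumes f: "f \<in> L2"
  obtains v where "v \<in> L2" "\<And>\<theta>. rapid \<theta> \<Longrightarrow> (\<integral>x. v x * \<theta> x \<partial>lborel) = Lam f \<theta>"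
proof -
  obtain b where b: "b > 0" "\<And>f \<theta>. f \<in> L2 \<Longrightarrow> \<theta> \<in> L2 \<Longrightarrow> norm (Lam f \<theta>) \<le> b * L2_norm f * L2_norm \<theta>"
    using that by (rule Lam_bound)
  have "\<exists>\<phi>. rapid \<phi> \<and> L2_norm (\<lambda>x. f x - \<phi> x) < (1 / 4) ^ n" for n :: nat
    by (rule L2_approx[OF f, of "(1 / 4) ^ n"]) auto
  then obtain \<phi> where \<phi>: "\<And>n. rapid (\<phi> n)" "\<And>n. L2_norm (\<lambda>x. f x - \<phi> n x) < (1 / 4) ^ n" by metis
  have \<phi>L: "\<phi> n \<in> L2" for n by (rule rapid_L2[OF \<phi>(1)])
  have uL: "kernel_image (\<phi> n) \<in> L2" for n by (rule kernel_image_L2[OF \<phi>(1)])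
  have step: "L2_norm (\<lambda>x. kernel_image (\<phi> (Suc n)) x - kernel_image (\<phi> n) x) \<le> (2 * b) / 4 ^ n" for n
  proof (rule L2_norm_le_dual[OF g ga L2_diff(1)[OF uL uL]])
    fix \<theta> :: "real ^ 'n \<Rightarrow> complex" assume \<theta>: "rapid \<theta>"
    have \<theta>L: "\<theta> \<in> L2" by (rule rapid_L2[OF \<theta>])
    have "L2_norm (\<lambda>x. \<phi> (Suc n) x - \<phi> n x) \<le> L2_norm (\<lambda>x. \<phi> (Suc n) x - f x) + L2_norm (\<lambda>x. f x - \<phi> n x)"
      by (rule L2_norm_triangle[OF \<phi>L f \<phi>L])
    also have "\<dots> \<le> (1 / 4) ^ Suc n + (1 / 4) ^ n"
      using \<phi>(2)[of "Suc n"] \<phi>(2)[of n] by (subst L2_norm_minus_commute) (intro add_mono, auto)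
    also have "\<dots> \<le> 2 / 4 ^ n" by (simp add: power_divide field_simps)
    finally have le: "L2_norm (\<lambda>x. \<phi> (Suc n) x - \<phi> n x) \<le> 2 / 4 ^ n" .
    have "(\<integral>x. (kernel_image (\<phi> (Suc n)) x - kernel_image (\<phi> n) x) * \<theta> x \<partial>lborel) = Lam (\<lambda>x. \<phi> (Suc n) x - \<phi> n x) \<theta>"
      by (simp add: integral_pair_diff[OF uL uL \<theta>L] kernel_image_pairing[OF \<phi>(1) \<theta>L] Lam_diff_left[OF \<phi>L \<phi>L \<theta>L])
    also have "norm \<dots> \<le> b * L2_norm (\<lambda>x. \<phi> (Suc n) x - \<phi> n x) * L2_norm \<theta>" by (rule b(2)[OF L2_diff(1)[OF \<phi>L \<phi>L] \<theta>L])
    also have "\<dots> \<le> b * (2 / 4 ^ n) * L2_norm \<theta>" using le b(1) by (intro mult_right_mono mult_left_mono) auto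
    finally show "norm (\<integral>x. (kernel_image (\<phi> (Suc n)) x - kernel_image (\<phi> n) x) * \<theta> x \<partial>lborel) \<le> (2 * b) / 4 ^ n * L2_norm \<theta>" by (simp add: mult_ac)
  qed (use b(1) in auto)
  obtain v where v: "v \<in> L2" "(\<lambda>n. L2_norm (\<lambda>x. kernel_image (\<phi> n) x - v x)) \<longlonglongrightarrow> 0"
    using that by (rule L2_complete[of "\<lambda>n. kernel_image (\<phi> n)", OF uL step])
  have "(\<integral>x. v x * \<theta> x \<partial>lborel) = Lam f \<theta>" if \<theta>: "rapid \<theta>" for \<theta>
  proof -
    have \<theta>L: "\<theta> \<in> L2" by (rule rapid_L2[OF \<theta>])
    have "(\<lambda>n. Lam (\<phi> n) \<theta>) \<longlonglongrightarrow> (\<integral>x. v x * \<theta> x \<partial>lborel)"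
    proof (rule LIM_zero_cancel[OF Lim_null_comparison[OF always_eventually[OF allI]]])
      show "norm (Lam (\<phi> n) \<theta> - (\<integral>x. v x * \<theta> x \<partial>lborel)) \<le> L2_norm (\<lambda>x. kernel_image (\<phi> n) x - v x) * L2_norm \<theta>" for n
        using L2_Cauchy_Schwarz(3)[OF L2_diff(1)[OF uL v(1)] \<theta>L, of n]
        by (simp add: integral_pair_diff[OF uL v(1) \<theta>L] kernel_image_pairing[OF \<phi>(1) \<theta>L])
      show "(\<lambda>n. L2_norm (\<lambda>x. kernel_image (\<phi> n) x - v x) * L2_norm \<theta>) \<longlonglongrightarrow> 0"
        by (rule tendsto_mult_left_zero[OF v(2)])
    qed
    moreover have "(\<lambda>n. Lam (\<phi> n) \<theta>) \<longlonglongrightarrow> Lam f \<theta>"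
    proof (rule LIM_zero_cancel[OF Lim_null_comparison[OF always_eventually[OF allI]]])
      show "norm (Lam (\<phi> n) \<theta> - Lam f \<theta>) \<le> (1 / 4) ^ n * (b * L2_norm \<theta>)" for n
      proof -
        have "norm (Lam (\<phi> n) \<theta> - Lam f \<theta>) = norm (Lam (\<lambda>x. f x - \<phi> n x) \<theta>)"
          by (simp add: Lam_diff_left[OF f \<phi>L \<theta>L] norm_minus_commute)
        also have "\<dots> \<le> b * L2_norm (\<lambda>x. f x - \<phi> n x) * L2_norm \<theta>" by (rule b(2)[OF L2_diff(1)[OF f \<phi>L] \<theta>L])
        also have "\<dots> \<le> b * (1 / 4) ^ n * L2_norm \<theta>" using b(1) \<phi>(2)[of n] by (intro mult_right_mono mult_left_mono) auto
        finally show ?thesis by (simp add: mult_ac)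
      qed
      show "(\<lambda>n. (1 / 4) ^ n * (b * L2_norm \<theta>)) \<longlonglongrightarrow> 0"
        by (rule tendsto_mult_left_zero[OF LIMSEQ_realpow_zero]) auto
    qed
    ultimately show ?thesis by (rule LIMSEQ_unique)
  qed
  with v(1) show ?thesis using that by blast
qed

lemma L2_extension_exists: "\<exists>B. is_L2_extension A B"
proof -
  obtain b where b: "b > 0" "\<And>f \<theta>. f \<in> L2 \<Longrightarrow> \<theta> \<in> L2 \<Longrightarrow> norm (Lam f \<theta>) \<le> b * L2_norm f * L2_norm \<theta>"
    using that by (rule Lam_bound)
  have "\<exists>v. f \<in> L2 \<longrightarrow> v \<in> L2 \<and> (\<forall>\<theta>. rapid \<theta> \<longrightarrow> (\<integral>x. v x * \<theta> x \<partial>lborel) = Lam f \<theta>)" for f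
    using representing_element[of f] by metis
  then obtain B where B: "\<And>f. f \<in> L2 \<Longrightarrow> B f \<in> L2" "\<And>f \<theta>. f \<in> L2 \<Longrightarrow> rapid \<theta> \<Longrightarrow> (\<integral>x. B f x * \<theta> x \<partial>lborel) = Lam f \<theta>" by metis
  have "continuous_linear_L2 B"
    unfolding continuous_linear_L2_def
  proof (intro conjI ballI allI B(1) exI[of _ b])
    show "L2_norm (B f) \<le> b * L2_norm f" if f: "f \<in> L2" for f
      by (rule L2_norm_le_dual[OF g ga B(1)[OF f]]) (use b f B(2)[OF f] rapid_L2 in auto)
    fix f h :: "real ^ 'n \<Rightarrow> complex" and p q assume f: "f \<in> L2" and h: "h \<in> L2"
    let ?s = "\<lambda>x. p * f x + q * h x" and ?t = "\<lambda>x. p * B f x + q * B h x"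
    have s: "?s \<in> L2" "?t \<in> L2" using f h B(1) by (intro L2_add(1) L2_scale(1); simp)+
    have "L2_norm (\<lambda>x. B ?s x - ?t x) \<le> 0"
    proof (rule L2_norm_le_dual[OF g ga L2_diff(1)[OF B(1)[OF s(1)] s(2)]])
      fix \<theta> :: "real ^ 'n \<Rightarrow> complex" assume \<theta>: "rapid \<theta>"
      have \<theta>L: "\<theta> \<in> L2" by (rule rapid_L2[OF \<theta>])
      have "(\<integral>x. ?t x * \<theta> x \<partial>lborel) = (\<integral>x. p * (B f x * \<theta> x) + q * (B h x * \<theta> x) \<partial>lborel)" by (simp add: algebra_simps)
      also have "\<dots> = p * Lam f \<theta> + q * Lam h \<theta>"
        by (simp add: L2_Cauchy_Schwarz(1)[OF B(1)[OF f] \<theta>L] L2_Cauchy_Schwarz(1)[OF B(1)[OF h] \<theta>L] B(2)[OF f \<theta>] B(2)[OF h \<theta>])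
      finally have "(\<integral>x. (B ?s x - ?t x) * \<theta> x \<partial>lborel) = 0"
        by (simp add: integral_pair_diff[OF B(1)[OF s(1)] s(2) \<theta>L] B(2)[OF s(1) \<theta>] Lam_linear[OF f h \<theta>L])
      then show "norm (\<integral>x. (B ?s x - ?t x) * \<theta> x \<partial>lborel) \<le> 0 * L2_norm \<theta>" by simp
    qed simp
    then have "L2_norm (\<lambda>x. B ?s x - ?t x) = 0" using L2_norm_nonneg[of "\<lambda>x. B ?s x - ?t x"] by linarith
    from L2_norm_zero_AE[OF L2_diff(1)[OF B(1)[OF s(1)] s(2)] this]
    show "AE x in lborel. B ?s x = ?t x" by eventually_elim simp
  qed
  moreover have "A \<phi> \<psi> = (\<integral>x. B \<phi> x * \<psi> x \<partial>lborel)" if "\<phi> \<in> schwartz" "\<psi> \<in> schwartz" for \<phi> \<psi>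
    using that B(2)[OF rapid_L2] operator_eq_Lam by (simp add: schwartz_iff_rapid)
  ultimately show ?thesis unfolding is_L2_extension_def by blast
qed

text \<open>Both sides are bounded in \<open>f\<close> and in \<open>\<theta>\<close> and agree on rapidly decreasing functions, which are
  dense. In particular the values of any two bounded extensions agree almost everywhere.\<close>

lemma extension_pairing:
  assumes ext: "is_L2_extension A B" and f: "f \<in> L2" and \<theta>: "\<theta> \<in> L2"
  shows "(\<integral>x. B f x * \<theta> x \<partial>lborel) = Lam f \<theta>"
proof -
  obtain b where b: "b > 0" "\<And>f \<theta>. f \<in> L2 \<Longrightarrow> \<theta> \<in> L2 \<Longrightarrow> norm (Lam f \<theta>) \<le> b * L2_norm f * L2_norm \<theta>"
    using that by (rule Lam_bound)
  have BL: "B f \<in> L2" if "f \<in> L2" for f using ext that unfolding is_L2_extension_def continuous_linear_L2_def by blast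
  have Bl: "AE x in lborel. B (\<lambda>x. p * f x + q * h x) x = p * B f x + q * B h x" if "f \<in> L2" "h \<in> L2" for f h p q
    using ext that unfolding is_L2_extension_def continuous_linear_L2_def by blast
  obtain C0 where C0: "\<And>f. f \<in> L2 \<Longrightarrow> L2_norm (B f) \<le> C0 * L2_norm f"
    using ext unfolding is_L2_extension_def continuous_linear_L2_def by blast
  define C where "C = max C0 0"
  have C: "C \<ge> 0" "L2_norm (B f) \<le> C * L2_norm f" if "f \<in> L2" for f
    using order.trans[OF C0[OF that] mult_right_mono[of C0 C "L2_norm f"]] by (auto simp: C_def)
  have Bdiff: "L2_norm (\<lambda>x. B f x - B h x) \<le> C * L2_norm (\<lambda>x. f x - h x)" if "f \<in> L2" "h \<in> L2" for f h
  proof -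
    have d: "(\<lambda>x. f x - h x) \<in> L2" by (rule L2_diff(1)[OF that])
    have "AE x in lborel. B f x - B h x = B (\<lambda>x. f x - h x) x"
      using Bl[OF that, of 1 "-1"] by (auto elim!: eventually_mono)
    then have "L2_norm (\<lambda>x. B f x - B h x) = L2_norm (B (\<lambda>x. f x - h x))"
      by (rule L2_norm_cong_AE) (intro L2_borel L2_diff(1) BL that d)+
    then show ?thesis using C(2)[OF d] by simp
  qed
  have step1: "(\<integral>x. B f x * \<theta> x \<partial>lborel) - Lam f \<theta> = 0" if f: "f \<in> L2" and r: "rapid \<theta>" for f \<theta>
  proof (rule eq_zero_if_small[where c = "(C + b) * L2_norm \<theta>"])
    have \<theta>: "\<theta> \<in> L2" by (rule rapid_L2[OF r])
    fix e :: real assume "e > 0"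
    then obtain \<phi> where \<phi>: "rapid \<phi>" "\<phi> \<in> L2" "L2_norm (\<lambda>x. f x - \<phi> x) < e" using L2_approx[OF f] by blast
    have dL: "(\<lambda>x. f x - \<phi> x) \<in> L2" by (rule L2_diff(1)[OF f \<phi>(2)])
    have "A \<phi> \<theta> = (\<integral>x. B \<phi> x * \<theta> x \<partial>lborel)"
      using ext \<phi>(1) r unfolding is_L2_extension_def by (simp add: schwartz_iff_rapid)
    then have "(\<integral>x. B f x * \<theta> x \<partial>lborel) - Lam f \<theta> = (\<integral>x. (B f x - B \<phi> x) * \<theta> x \<partial>lborel) - Lam (\<lambda>x. f x - \<phi> x) \<theta>"
      using operator_eq_Lam[OF \<phi>(1) r] by (simp add: integral_pair_diff[OF BL[OF f] BL[OF \<phi>(2)] \<theta>] Lam_diff_left[OF f \<phi>(2) \<theta>])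
    also have "norm \<dots> \<le> L2_norm (\<lambda>x. B f x - B \<phi> x) * L2_norm \<theta> + b * L2_norm (\<lambda>x. f x - \<phi> x) * L2_norm \<theta>"
      by (rule order.trans[OF norm_triangle_ineq4 add_mono[OF L2_Cauchy_Schwarz(3)[OF L2_diff(1)[OF BL[OF f] BL[OF \<phi>(2)]] \<theta>] b(2)[OF dL \<theta>]]])
    also have "\<dots> \<le> (C * L2_norm (\<lambda>x. f x - \<phi> x)) * L2_norm \<theta> + b * L2_norm (\<lambda>x. f x - \<phi> x) * L2_norm \<theta>"
      by (intro add_right_mono mult_right_mono Bdiff f \<phi>) simp
    also have "\<dots> = (C + b) * L2_norm \<theta> * L2_norm (\<lambda>x. f x - \<phi> x)" by (simp add: algebra_simps)
    also have "\<dots> \<le> (C + b) * L2_norm \<theta> * e" using C(1)[OF f] b(1) \<phi>(3) by (intro mult_left_mono) auto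
    finally show "norm ((\<integral>x. B f x * \<theta> x \<partial>lborel) - Lam f \<theta>) \<le> (C + b) * L2_norm \<theta> * e" .
  qed (use C(1)[OF f] b(1) in auto)
  have "(\<integral>x. B f x * \<theta> x \<partial>lborel) - Lam f \<theta> = 0"
  proof (rule eq_zero_if_small[where c = "L2_norm (B f) + b * L2_norm f"])
    fix e :: real assume "e > 0"
    then obtain \<phi> where \<phi>: "rapid \<phi>" "\<phi> \<in> L2" "L2_norm (\<lambda>x. \<theta> x - \<phi> x) < e" using L2_approx[OF \<theta>] by blast
    have dL: "(\<lambda>x. \<theta> x - \<phi> x) \<in> L2" by (rule L2_diff(1)[OF \<theta> \<phi>(2)])
    have "(\<integral>x. B f x * (\<theta> x - \<phi> x) \<partial>lborel) = (\<integral>x. B f x * \<theta> x \<partial>lborel) - (\<integral>x. B f x * \<phi> x \<partial>lborel)"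
      unfolding right_diff_distrib
      by (rule Bochner_Integration.integral_diff[OF L2_Cauchy_Schwarz(1)[OF BL[OF f] \<theta>] L2_Cauchy_Schwarz(1)[OF BL[OF f] \<phi>(2)]])
    then have "(\<integral>x. B f x * \<theta> x \<partial>lborel) - Lam f \<theta> = (\<integral>x. B f x * (\<theta> x - \<phi> x) \<partial>lborel) - Lam f (\<lambda>x. \<theta> x - \<phi> x)"
      using step1[OF f \<phi>(1)] by (simp add: Lam_diff_right[OF f \<theta> \<phi>(2)])
    also have "norm \<dots> \<le> L2_norm (B f) * L2_norm (\<lambda>x. \<theta> x - \<phi> x) + b * L2_norm f * L2_norm (\<lambda>x. \<theta> x - \<phi> x)"
      by (rule order.trans[OF norm_triangle_ineq4 add_mono[OF L2_Cauchy_Schwarz(3)[OF BL[OF f] dL] b(2)[OF f dL]]])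
    also have "\<dots> = (L2_norm (B f) + b * L2_norm f) * L2_norm (\<lambda>x. \<theta> x - \<phi> x)" by (simp add: algebra_simps)
    also have "\<dots> \<le> (L2_norm (B f) + b * L2_norm f) * e" using b(1) \<phi>(3) by (intro mult_left_mono) auto
    finally show "norm ((\<integral>x. B f x * \<theta> x \<partial>lborel) - Lam f \<theta>) \<le> (L2_norm (B f) + b * L2_norm f) * e" .
  qed (use b(1) in auto)
  then show ?thesis by simp
qed

section \<open>Localization and compactness\<close>

text \<open>Let \<open>X\<close> be the product of \<open>1 + |x|\<close>, \<open>1 + |x'|\<close> and \<open>1 + |w - \<kappa> z|\<close>, where \<open>x\<close> and \<open>x'\<close> are
  the positions of \<open>z\<close> and \<open>w\<close>. The nonrefocusing bound controls the frequency of \<open>z\<close> by \<open>X\<close>, hence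
  \<open>z\<close> by \<open>X\<^sup>2\<close>, and then \<open>w\<close> by \<open>X\<^sup>3\<close>. So decay of order \<open>5 m\<close> in the three quantities yields
  decay of order \<open>m\<close> in both phase space variables, in all directions.\<close>

lemma triple_weight:
  assumes "vertical_nonrefocusing \<kappa>"
  obtains C where "C > 0" "\<And>w z. wt (5 * m) (fst z) * wt (5 * m) (fst w) * wt (5 * m) (w - \<kappa> z) \<le> C * (wt m z * wt m w)"
proof -
  obtain C where C: "C > 0" "\<And>z w. 1 + norm (snd z) \<le> C * ((1 + norm (fst z)) * (1 + norm (fst w)) * (1 + norm (w - \<kappa> z)))"
    using nonrefocusing_bound[OF tame assms] by blast
  obtain K1 where K1: "K1 > 0" "\<And>w z. 1 + norm w \<le> K1 * ((1 + norm z) * (1 + norm (w - \<kappa> z)))"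
    using phase_growth by blast
  have "wt (5 * m) (fst z) * wt (5 * m) (fst w) * wt (5 * m) (w - \<kappa> z) \<le> (C * (K1 * C)) ^ m * (wt m z * wt m w)" for w z
  proof -
    let ?a = "1 + norm (fst z)" and ?b = "1 + norm (fst w)" and ?e = "1 + norm (w - \<kappa> z)"
    define X where "X = ?a * ?b * ?e"
    have ab: "1 \<le> ?a * ?b" using mult_mono[of 1 ?a 1 ?b] by simp
    have "?a * 1 \<le> ?a * (?b * ?e)" using mult_mono[of 1 ?b 1 ?e] by (intro mult_left_mono) auto
    then have aX: "?a \<le> X" by (simp add: X_def mult.assoc)
    have "1 * ?e \<le> ?a * ?b * ?e" using ab by (intro mult_right_mono) auto
    then have eX: "?e \<le> X" by (simp add: X_def)
    have X0: "X > 0" by (simp add: X_def)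
    have "1 + norm z \<le> ?a * (1 + norm (snd z))"
    proof -
      have "norm z \<le> norm (fst z) + norm (snd z)" using norm_Pair_le[of "fst z" "snd z"] by simp
      moreover have "0 \<le> norm (fst z) * norm (snd z)" by simp
      ultimately show ?thesis by (simp add: algebra_simps del: mult_nonneg_nonneg)
    qed
    also have "\<dots> \<le> X * (C * X)" using C(2)[of z w] aX X0 by (intro mult_mono) (auto simp: X_def)
    finally have z: "1 + norm z \<le> C * X ^ 2" by (simp add: power2_eq_square mult_ac)
    have "1 + norm w \<le> K1 * ((1 + norm z) * ?e)" by (rule K1)
    also have "\<dots> \<le> K1 * ((C * X ^ 2) * X)" using z eX K1(1) C(1) X0 by (intro mult_left_mono mult_mono) auto
    finally have w: "1 + norm w \<le> (K1 * C) * X ^ 3" by (simp add: power2_eq_square power3_eq_cube mult_ac)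
    have "(1 + norm z) * (1 + norm w) \<le> (C * X ^ 2) * ((K1 * C) * X ^ 3)"
      using z w C(1) X0 by (intro mult_mono) auto
    also have "\<dots> = (C * (K1 * C)) * X ^ 5" by (simp add: eval_nat_numeral mult_ac)
    finally have "((1 + norm z) * (1 + norm w)) ^ m \<le> ((C * (K1 * C)) * X ^ 5) ^ m" by (intro power_mono) auto
    also have "\<dots> = (C * (K1 * C)) ^ m * (?a ^ (5 * m) * ?b ^ (5 * m) * ?e ^ (5 * m))"
      by (simp only: X_def power_mult_distrib power_mult)
    finally have le: "(1 + norm z) ^ m * (1 + norm w) ^ m \<le> (C * (K1 * C)) ^ m * (?a ^ (5 * m) * ?b ^ (5 * m) * ?e ^ (5 * m))"
      by (simp only: power_mult_distrib)
    have "inverse (?a ^ (5 * m) * ?b ^ (5 * m) * ?e ^ (5 * m)) \<le> (C * (K1 * C)) ^ m * inverse ((1 + norm z) ^ m * (1 + norm w) ^ m)"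
    proof -
      have p: "0 < (1 + norm z) ^ m * (1 + norm w) ^ m" "0 < ?a ^ (5 * m) * ?b ^ (5 * m) * ?e ^ (5 * m)" by auto
      show ?thesis using le p by (simp add: divide_simps mult_ac)
    qed
    then show ?thesis by (simp only: wt_def inverse_mult_distrib)
  qed
  then show ?thesis using C(1) K1(1) by (intro that[of "(C * (K1 * C)) ^ m"]) auto
qed

definition supported :: "(real ^ 'n) set \<Rightarrow> (real ^ 'n \<Rightarrow> complex) \<Rightarrow> bool" where
  "supported F f \<longleftrightarrow> f \<in> L2 \<and> (\<forall>x. x \<notin> F \<longrightarrow> f x = 0)"

text \<open>Compact support of \<open>f\<close> gives decay in the position of \<open>z\<close>, the kernel gives decay in
  \<open>w - \<kappa> z\<close>, and the third weight is the one that localization of the output provides. The order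
  \<open>Suc d\<close> leaves one factor \<open>1 + |w|\<close> to spare for a derivative in \<open>kernel_image_regularity\<close>.\<close>

lemma H_localized:
  assumes v: "vertical_nonrefocusing \<kappa>" and F: "compact F"
  obtains C where "C > 0" "\<And>f w. supported F f \<Longrightarrow> norm (H f w) * wt (5 * Suc d) (fst w) \<le> C * L2_norm f * wt (Suc d) w"
proof -
  let ?m = "Suc d"
  obtain C1 where C1: "C1 > 0" "\<And>f z. f \<in> L2 \<Longrightarrow> (\<And>x. x \<notin> F \<Longrightarrow> f x = 0) \<Longrightarrow>
    (\<integral>y. norm (phase_shift z g y * f y) \<partial>lborel) \<le> C1 * L2_norm f * wt (5 * ?m) (fst z)"
    using stft_localized[OF g F] by blast
  obtain C2 where C2: "C2 > 0" "\<And>w z. norm (kernel w z) \<le> C2 * wt (5 * ?m) (w - \<kappa> z)" using kernel_bound by blast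
  obtain C3 where C3: "C3 > 0" "\<And>w z. wt (5 * ?m) (fst z) * wt (5 * ?m) (fst w) * wt (5 * ?m) (w - \<kappa> z) \<le> C3 * (wt ?m z * wt ?m w)"
    using triple_weight[OF v] by blast
  let ?C = "norm (inverse K) * (C1 * C2 * C3 * (\<integral>z. wt ?m (z :: 'n phase) \<partial>lborel))"
  have "norm (H f w) * wt (5 * ?m) (fst w) \<le> (?C + 1) * L2_norm f * wt ?m w" if f: "supported F f" for f w
  proof -
    have fL: "f \<in> L2" using f by (simp add: supported_def)
    have i: "integrable lborel (\<lambda>z. (C1 * C2 * C3 * L2_norm f * wt ?m w) * wt ?m (z :: 'n phase))"
      using d by (intro integrable_mult_right integrable_wt) simp
    have "norm (stft g f z * kernel w z) * wt (5 * ?m) (fst w) \<le> (C1 * C2 * C3 * L2_norm f * wt ?m w) * wt ?m z" for z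
    proof -
      have "norm (stft g f z) \<le> C1 * L2_norm f * wt (5 * ?m) (fst z)"
        using f by (intro order.trans[OF norm_stft_le_integral] C1) (auto simp: supported_def)
      then have "norm (stft g f z * kernel w z) \<le> (C1 * L2_norm f * wt (5 * ?m) (fst z)) * (C2 * wt (5 * ?m) (w - \<kappa> z))"
        unfolding norm_mult using C1(1) by (intro mult_mono C2) auto
      then have "norm (stft g f z * kernel w z) * wt (5 * ?m) (fst w) \<le> (C1 * L2_norm f * wt (5 * ?m) (fst z)) * (C2 * wt (5 * ?m) (w - \<kappa> z)) * wt (5 * ?m) (fst w)"
        by (rule mult_right_mono) simp
      also have "\<dots> = (C1 * C2 * L2_norm f) * (wt (5 * ?m) (fst z) * wt (5 * ?m) (fst w) * wt (5 * ?m) (w - \<kappa> z))" by (simp only: mult_ac)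
      also have "\<dots> \<le> (C1 * C2 * L2_norm f) * (C3 * (wt ?m z * wt ?m w))" using C1(1) C2(1) by (intro mult_left_mono C3) auto
      finally show ?thesis by (simp only: mult_ac)
    qed
    then have "(\<integral>z. norm (stft g f z * kernel w z) * wt (5 * ?m) (fst w) \<partial>lborel) \<le> (\<integral>z. (C1 * C2 * C3 * L2_norm f * wt ?m w) * wt ?m (z :: 'n phase) \<partial>lborel)"
      using C1(1) C2(1) C3(1) by (intro integral_mono'[OF i]) auto
    then have "norm (inverse K) * (\<integral>z. norm (stft g f z * kernel w z) * wt (5 * ?m) (fst w) \<partial>lborel) \<le> ?C * L2_norm f * wt ?m w"
      by (rule order.trans[OF mult_left_mono]) (simp_all add: mult_ac)
    moreover have "norm (H f w) * wt (5 * ?m) (fst w) \<le> norm (inverse K) * (\<integral>z. norm (stft g f z * kernel w z) * wt (5 * ?m) (fst w) \<partial>lborel)"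
      using mult_right_mono[OF norm_H_le_integral[OF fL, of w], of "wt (5 * ?m) (fst w)"] by (simp add: mult.assoc)
    moreover have "?C * L2_norm f * wt ?m w \<le> (?C + 1) * L2_norm f * wt ?m w" by (intro mult_right_mono) auto
    ultimately show ?thesis by linarith
  qed
  moreover have "?C + 1 > 0" using C1(1) C2(1) C3(1) by (intro add_nonneg_pos mult_nonneg_nonneg integral_nonneg_AE) auto
  ultimately show ?thesis using that by blast
qed

lemma kernel_image_pairing_localized:
  assumes v: "vertical_nonrefocusing \<kappa>" and F: "compact F" and E: "compact E"
    and f: "supported F f" and \<theta>: "supported E \<theta>"
  shows "(\<integral>x. kernel_image f x * \<theta> x \<partial>lborel) = Lam f \<theta>"
proof -
  let ?N = "5 * Suc d"
  have L: "f \<in> L2" "\<theta> \<in> L2" using f \<theta> by (auto simp: supported_def)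
  obtain C where C: "C > 0" "\<And>f w. supported F f \<Longrightarrow> norm (H f w) * wt ?N (fst w) \<le> C * L2_norm f * wt (Suc d) w"
    using H_localized[OF v F] by blast
  obtain C1 where C1: "C1 > 0" "\<And>f z. f \<in> L2 \<Longrightarrow> (\<And>x. x \<notin> E \<Longrightarrow> f x = 0) \<Longrightarrow>
    (\<integral>y. norm (phase_shift z g y * f y) \<partial>lborel) \<le> C1 * L2_norm f * wt ?N (fst z)"
    using stft_localized[OF g E] by blast
  have "(\<integral>x. kernel_image f x * \<theta> x \<partial>lborel) = (\<integral>w. (cnj (inverse K) * H f w) * (\<integral>x. phase_shift w g x * \<theta> x \<partial>lborel) \<partial>lborel)"
    unfolding kernel_image_def
  proof (rule phase_space_Fubini[OF g _ L2_borel[OF L(2)], where b = "\<lambda>w. C1 * L2_norm \<theta> * wt ?N (fst w)"])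
    show Wm: "(\<lambda>w. cnj (inverse K) * H f w) \<in> borel_measurable borel" using H_borel[OF L(1)] by measurable
    show "integrable lborel (\<lambda>x. phase_shift w g x * \<theta> x)" for w by (rule L2_Cauchy_Schwarz(1)[OF phase_shift_L2(1)[OF g] L(2)])
    show "(\<integral>x. norm (phase_shift w g x * \<theta> x) \<partial>lborel) \<le> C1 * L2_norm \<theta> * wt ?N (fst w)" for w
      using \<theta> by (intro C1) (auto simp: supported_def)
    show "integrable lborel (\<lambda>w. norm (cnj (inverse K) * H f w) * (C1 * L2_norm \<theta> * wt ?N (fst w)))"
    proof (rule integrable_wt_bound[of _ "Suc d" "norm (inverse K) * C1 * L2_norm \<theta> * (C * L2_norm f)"])
      have "(\<lambda>w::'n phase. wt ?N (fst w)) \<in> borel_measurable borel"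
        by (rule measurable_compose[OF borel_measurable_continuous_onI[OF continuous_on_fst[OF continuous_on_id]] borel_measurable_wt])
      then show "(\<lambda>w. norm (cnj (inverse K) * H f w) * (C1 * L2_norm \<theta> * wt ?N (fst w))) \<in> borel_measurable lborel"
        using Wm by measurable
      fix w
      have "norm (norm (cnj (inverse K) * H f w) * (C1 * L2_norm \<theta> * wt ?N (fst w))) = (norm (inverse K) * C1 * L2_norm \<theta>) * (norm (H f w) * wt ?N (fst w))"
        using C1(1) by (simp add: norm_mult norm_inverse abs_mult mult_ac)
      also have "\<dots> \<le> (norm (inverse K) * C1 * L2_norm \<theta>) * (C * L2_norm f * wt (Suc d) w)"
        using C1(1) by (intro mult_left_mono C f) auto
      finally show "norm (norm (cnj (inverse K) * H f w) * (C1 * L2_norm \<theta> * wt ?N (fst w))) \<le> norm (inverse K) * C1 * L2_norm \<theta> * (C * L2_norm f) * wt (Suc d) w"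
        by (simp only: mult_ac)
    qed (use d in auto)
  qed
  then show ?thesis unfolding Lam_def by (simp only: integral_phase_shift_mult)
qed

text \<open>On a bounded set the shifted window is as small as its distance from the set suggests. A
  derivative of the modulation costs the frequency, hence the factor \<open>1 + |w|\<close>.\<close>

lemma phase_shift_regularity:
  assumes R: "R \<ge> 0"
  obtains C where "C > 0"
    "\<And>w y. norm y \<le> R \<Longrightarrow> norm (phase_shift w g y) \<le> C * wt N (fst w)"
    "\<And>w y y'. norm y \<le> R \<Longrightarrow> norm y' \<le> R \<Longrightarrow> norm (phase_shift w g y - phase_shift w g y') \<le> C * (1 + norm w) * wt N (fst w) * norm (y - y')"
proof -
  obtain C1 where C1: "C1 > 0" "\<And>x. norm (g x) \<le> C1 * wt N x" using rapid_bound[OF g] by blast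
  obtain C2 where C2: "C2 > 0" "\<And>x v. norm (dird v g x) \<le> C2 * wt N x * norm v" using rapid_dird_bound[OF g] by blast
  let ?r = "(1 + R) ^ N"
  have w: "wt N (y - p) \<le> ?r * wt N p" if "norm y \<le> R" for y p :: "real ^ 'n"
  proof -
    have "wt N (y - p) \<le> (1 + norm y) ^ N * wt N p" using wt_shift[of N "y - p" "- y"] by simp
    also have "\<dots> \<le> ?r * wt N p" using that by (intro mult_right_mono power_mono) auto
    finally show ?thesis .
  qed
  have g1: "norm (g (y - p)) \<le> C1 * ?r * wt N p" if "norm y \<le> R" for y p :: "real ^ 'n"
    using order.trans[OF C1(2) mult_left_mono[OF w[OF that]]] C1(1) by (simp add: mult.assoc)
  have r0: "?r \<ge> 0" using R by simp
  have lip: "norm (phase_shift w g y - phase_shift w g y') \<le> ((C1 + C2) * ?r * (1 + norm w) * wt N (fst w)) * norm (y - y')"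
    if y: "norm y \<le> R" "norm y' \<le> R" for w y y'
  proof -
    let ?D = "\<lambda>y v. cis (y \<bullet> snd w) * dird v g (y - fst w) + ((v \<bullet> snd w) *\<^sub>R (\<i> * cis (y \<bullet> snd w))) * g (y - fst w)"
    have der: "(phase_shift w g has_derivative ?D y) (at y within cball 0 R)" for y
    proof -
      have 1: "((\<lambda>y. cis (y \<bullet> snd w)) has_derivative (\<lambda>v. (v \<bullet> snd w) *\<^sub>R (\<i> * cis (y \<bullet> snd w)))) (at y within cball 0 R)"
        by (rule has_derivative_cis) (auto intro!: derivative_eq_intros)
      have "((\<lambda>y. y - fst w) has_derivative (\<lambda>v. v)) (at y within cball 0 R)" by (auto intro!: derivative_eq_intros)
      from has_derivative_compose[OF this rapid_has_derivative[OF g]]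
      have 2: "((\<lambda>y. g (y - fst w)) has_derivative (\<lambda>v. dird v g (y - fst w))) (at y within cball 0 R)" .
      show ?thesis using has_derivative_mult[OF 1 2] by (simp add: phase_shift_cis[abs_def])
    qed
    have on: "onorm (?D y) \<le> (C1 + C2) * ?r * (1 + norm w) * wt N (fst w)" if "y \<in> cball 0 R" for y
    proof (rule onorm_le)
      fix v
      have yR: "norm y \<le> R" using that by simp
      have sw: "norm (snd w) \<le> norm w" by (metis norm_snd_le prod.collapse)
      have "\<bar>v \<bullet> snd w\<bar> \<le> norm v * norm w"
        using Cauchy_Schwarz_ineq2[of v "snd w"] mult_left_mono[OF sw, of "norm v"] by simp
      then have "\<bar>v \<bullet> snd w\<bar> * norm (g (y - fst w)) \<le> (norm v * norm w) * (C1 * ?r * wt N (fst w))"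
        by (intro mult_mono g1 yR) auto
      moreover have "norm (dird v g (y - fst w)) \<le> C2 * (?r * wt N (fst w)) * norm v"
        using C2(1) by (intro order.trans[OF C2(2)] mult_right_mono mult_left_mono w yR) auto
      moreover have "norm (?D y v) \<le> norm (dird v g (y - fst w)) + \<bar>v \<bullet> snd w\<bar> * norm (g (y - fst w))"
        by (rule order.trans[OF norm_triangle_ineq]) (simp add: norm_mult)
      ultimately have "norm (?D y v) \<le> C2 * (?r * wt N (fst w)) * norm v + (norm v * norm w) * (C1 * ?r * wt N (fst w))" by linarith
      also have "\<dots> = (C2 + C1 * norm w) * (?r * wt N (fst w) * norm v)" by (simp add: algebra_simps)
      also have "\<dots> \<le> ((C1 + C2) * (1 + norm w)) * (?r * wt N (fst w) * norm v)"
        using C1(1) C2(1) r0 by (intro mult_right_mono) (auto simp: algebra_simps)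
      finally show "norm (?D y v) \<le> (C1 + C2) * ?r * (1 + norm w) * wt N (fst w) * norm v" by (simp only: mult_ac)
    qed
    show ?thesis
      by (rule differentiable_bound[OF convex_cball der on]) (use y in auto)
  qed
  have sh: "norm (phase_shift w g y) \<le> ((C1 + C2) * ?r) * wt N (fst w)" if "norm y \<le> R" for w y
  proof -
    have "norm (phase_shift w g y) \<le> C1 * ?r * wt N (fst w)" using g1[OF that] by simp
    also have "\<dots> \<le> (C1 + C2) * ?r * wt N (fst w)" using C2(1) r0 by (intro mult_right_mono) auto
    finally show ?thesis .
  qed
  have "(C1 + C2) * ?r > 0" using C1(1) C2(1) R by (intro mult_pos_pos) auto
  then show ?thesis using lip sh by (intro that[of "(C1 + C2) * ?r"]) (auto simp: mult.assoc)
qed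

text \<open>\<open>H_localized\<close> needs a weight in the position of \<open>w\<close>. Evaluation at points of a bounded set
  provides it, since the shifted windows are small there. Together they make the coefficient integral,
  and also the one for increments, converge absolutely.\<close>

lemma kernel_image_regularity:
  assumes v: "vertical_nonrefocusing \<kappa>" and F: "compact F" and R: "R \<ge> 0"
  obtains C where "C > 0" "\<And>f y. supported F f \<Longrightarrow> norm y \<le> R \<Longrightarrow> norm (kernel_image f y) \<le> C * L2_norm f"
    "\<And>f y y'. supported F f \<Longrightarrow> norm y \<le> R \<Longrightarrow> norm y' \<le> R \<Longrightarrow> norm (kernel_image f y - kernel_image f y') \<le> C * L2_norm f * norm (y - y')"
proof -
  let ?N = "5 * Suc d"
  obtain C1 where C1: "C1 > 0" "\<And>f w. supported F f \<Longrightarrow> norm (H f w) * wt ?N (fst w) \<le> C1 * L2_norm f * wt (Suc d) w"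
    using H_localized[OF v F] by blast
  obtain C2 where C2: "C2 > 0" "\<And>w y. norm y \<le> R \<Longrightarrow> norm (phase_shift w g y) \<le> C2 * wt ?N (fst w)"
    "\<And>w y y'. norm y \<le> R \<Longrightarrow> norm y' \<le> R \<Longrightarrow> norm (phase_shift w g y - phase_shift w g y') \<le> C2 * (1 + norm w) * wt ?N (fst w) * norm (y - y')"
    using phase_shift_regularity[OF R] by blast
  let ?J = "\<integral>w. wt d (w :: 'n phase) \<partial>lborel"
  define C where "C = norm (inverse K) * C2 * C1 * ?J + 1"
  have J: "?J \<ge> 0" by (simp add: integral_nonneg_AE)
  have C: "C > 0" using C1(1) C2(1) J unfolding C_def by (intro add_nonneg_pos mult_nonneg_nonneg) auto
  have i: "integrable lborel (\<lambda>w. c * wt d (w :: 'n phase))" for c by (intro integrable_mult_right integrable_wt d)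
  have sw: "(1 + norm w) * wt (Suc d) w = wt d w" for w :: "'n phase" by (simp add: wt_def)
  have key: "norm ((cnj (inverse K) * H f w) * q) \<le> norm (inverse K) * C2 * C1 * L2_norm f * t * wt d w"
    if f: "supported F f" and q: "norm q \<le> C2 * (1 + norm w) * wt ?N (fst w) * t" and t: "t \<ge> 0" for f w q t
  proof -
    have "norm ((cnj (inverse K) * H f w) * q) = norm (inverse K) * norm (H f w) * norm q" by (simp add: norm_mult norm_inverse)
    also have "\<dots> \<le> norm (inverse K) * norm (H f w) * (C2 * (1 + norm w) * wt ?N (fst w) * t)" by (intro mult_left_mono q) auto
    also have "\<dots> = (norm (inverse K) * C2 * t * (1 + norm w)) * (norm (H f w) * wt ?N (fst w))" by (simp only: mult_ac)
    also have "\<dots> \<le> (norm (inverse K) * C2 * t * (1 + norm w)) * (C1 * L2_norm f * wt (Suc d) w)"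
      using C2(1) t by (intro mult_left_mono C1 f) auto
    also have "\<dots> = norm (inverse K) * C2 * C1 * L2_norm f * t * ((1 + norm w) * wt (Suc d) w)" by (simp only: mult_ac)
    finally show ?thesis unfolding sw .
  qed
  have tot: "(\<integral>w. norm (inverse K) * C2 * C1 * L2_norm f * t * wt d (w :: 'n phase) \<partial>lborel) \<le> C * L2_norm f * t" if "t \<ge> 0" for f t
  proof -
    have "(\<integral>w. norm (inverse K) * C2 * C1 * L2_norm f * t * wt d (w :: 'n phase) \<partial>lborel) = (norm (inverse K) * C2 * C1 * ?J) * (L2_norm f * t)"
      by (simp add: mult_ac)
    also have "\<dots> \<le> C * (L2_norm f * t)" using that by (intro mult_right_mono) (auto simp: C_def)
    finally show ?thesis by (simp add: mult.assoc)
  qed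
  have q1: "norm (phase_shift w g y) \<le> C2 * (1 + norm w) * wt ?N (fst w) * 1" if "norm y \<le> R" for w y
  proof -
    have "C2 * 1 * wt ?N (fst w) \<le> C2 * (1 + norm w) * wt ?N (fst w)" using C2(1) by (intro mult_right_mono mult_left_mono) auto
    then show ?thesis using C2(2)[OF that, of w] by simp
  qed
  have int: "integrable lborel (\<lambda>w. (cnj (inverse K) * H f w) * phase_shift w g y)" if f: "supported F f" and y: "norm y \<le> R" for f y
  proof (rule Bochner_Integration.integrable_bound[OF i[of "norm (inverse K) * C2 * C1 * L2_norm f * 1"]])
    have "(\<lambda>w. phase_shift w g y) \<in> borel_measurable borel"
      using measurable_compose[OF borel_measurable_continuous_onI[of "\<lambda>w. (w, y)"] borel_measurable_phase_shift_pair[OF g]]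
      by (simp add: continuous_on_Pair)
    moreover have "H f \<in> borel_measurable borel" using f by (intro H_borel) (simp add: supported_def)
    ultimately show "(\<lambda>w. (cnj (inverse K) * H f w) * phase_shift w g y) \<in> borel_measurable lborel" by measurable
    show "AE w in lborel. norm ((cnj (inverse K) * H f w) * phase_shift w g y) \<le> norm (norm (inverse K) * C2 * C1 * L2_norm f * 1 * wt d w)"
      by (intro AE_I2 order.trans[OF key[OF f q1[OF y]]]) auto
  qed
  show ?thesis
  proof (rule that[OF C])
    fix f and y :: "real ^ 'n" assume f: "supported F f" and y: "norm y \<le> R"
    have "norm (kernel_image f y) \<le> (\<integral>w. norm (inverse K) * C2 * C1 * L2_norm f * 1 * wt d (w :: 'n phase) \<partial>lborel)"
      unfolding kernel_image_def by (rule norm_integral_le[OF i key[OF f q1[OF y]]]) simp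
    then show "norm (kernel_image f y) \<le> C * L2_norm f" using tot[of 1 f] by simp
    fix y' :: "real ^ 'n" assume y': "norm y' \<le> R"
    have "kernel_image f y - kernel_image f y' = (\<integral>w. (cnj (inverse K) * H f w) * (phase_shift w g y - phase_shift w g y') \<partial>lborel)"
      unfolding kernel_image_def right_diff_distrib by (rule Bochner_Integration.integral_diff[symmetric, OF int[OF f y] int[OF f y']])
    also have "norm \<dots> \<le> (\<integral>w. norm (inverse K) * C2 * C1 * L2_norm f * norm (y - y') * wt d (w :: 'n phase) \<partial>lborel)"
      by (rule norm_integral_le[OF i key[OF f C2(3)[OF y y']]]) simp
    also have "\<dots> \<le> C * L2_norm f * norm (y - y')" by (rule tot) simp
    finally show "norm (kernel_image f y - kernel_image f y') \<le> C * L2_norm f * norm (y - y')" .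
  qed
qed

lemma L2_indicator_mult_bounded:
  fixes h :: "real ^ 'n \<Rightarrow> complex"
  assumes E: "compact E" and h: "(\<lambda>x. indicator E x * h x) \<in> borel_measurable borel" and b: "\<And>x. x \<in> E \<Longrightarrow> norm (h x) \<le> b" "b \<ge> 0"
  shows "(\<lambda>x. indicator E x * h x) \<in> L2" "L2_norm (\<lambda>x. indicator E x * h x) \<le> b * L2_norm (indicator E :: real ^ 'n \<Rightarrow> complex)"
proof -
  let ?I = "indicator E :: real ^ 'n \<Rightarrow> complex"
  have Em: "E \<in> sets borel" using E by (simp add: borel_compact)
  have I: "?I \<in> L2"
  proof (rule L2I)
    show "?I \<in> borel_measurable borel" using Em by measurable
    have "(\<lambda>x. (norm (?I x))\<^sup>2) = indicat_real E" by (auto split: split_indicator)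
    then show "integrable lborel (\<lambda>x. (norm (?I x))\<^sup>2)" using emeasure_compact_finite[OF E] Em by simp
  qed
  let ?B = "\<lambda>x. complex_of_real b * ?I x"
  have B: "?B \<in> L2" "L2_norm ?B = b * L2_norm ?I" using L2_scale[OF I, of "complex_of_real b"] b(2) by auto
  have "norm (?I x * h x) \<le> norm (?B x)" for x using b by (cases "x \<in> E") auto
  from L2_dominated[OF h B(1) this] show "(\<lambda>x. ?I x * h x) \<in> L2" "L2_norm (\<lambda>x. ?I x * h x) \<le> b * L2_norm ?I"
    unfolding B(2) by auto
qed

lemma mult_indicator_L2:
  assumes "f \<in> L2" "E \<in> sets borel"
  shows "mult_indicator E f \<in> L2" "L2_norm (mult_indicator E f) \<le> L2_norm f"
proof -
  have m: "mult_indicator E f \<in> borel_measurable borel" using L2_borel[OF assms(1)] assms(2) unfolding mult_indicator_def by measurable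
  have "norm (mult_indicator E f x) \<le> norm (f x)" for x by (simp add: mult_indicator_def norm_mult mult_left_le_one_le indicator_def)
  from L2_dominated[OF m assms(1) this] show "mult_indicator E f \<in> L2" "L2_norm (mult_indicator E f) \<le> L2_norm f" by auto
qed

text \<open>The difference of the two functions on \<open>E\<close>, tested against its own conjugate, is a difference of two
  expressions for \<open>Lam f \<theta>\<close>.\<close>

lemma extension_eq_kernel_image:
  assumes v: "vertical_nonrefocusing \<kappa>" and F: "compact F" and E: "compact E"
    and ext: "is_L2_extension A B" and f: "supported F f"
  shows "AE x in lborel. indicator E x * B f x = indicator E x * kernel_image f x"
proof -
  have fL: "f \<in> L2" using f by (simp add: supported_def)
  have Em: "E \<in> sets borel" using E by (simp add: borel_compact)
  have BL: "B f \<in> L2" using ext fL unfolding is_L2_extension_def continuous_linear_L2_def by blast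
  obtain R where R: "R \<ge> 0" "\<And>y. y \<in> E \<Longrightarrow> norm y \<le> R" using compact_imp_bounded[OF E] unfolding bounded_pos by (meson less_imp_le)
  obtain C where C: "C > 0" "\<And>f y. supported F f \<Longrightarrow> norm y \<le> R \<Longrightarrow> norm (kernel_image f y) \<le> C * L2_norm f"
    "\<And>f y y'. supported F f \<Longrightarrow> norm y \<le> R \<Longrightarrow> norm y' \<le> R \<Longrightarrow> norm (kernel_image f y - kernel_image f y') \<le> C * L2_norm f * norm (y - y')"
    using that by (rule kernel_image_regularity[OF v F R(1)])
  let ?b = "\<lambda>x. indicator E x * B f x" and ?i = "\<lambda>x. indicator E x * kernel_image f x"
  have bL: "?b \<in> L2" using mult_indicator_L2(1)[OF BL Em] by (simp add: mult_indicator_def)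
  have im: "?i \<in> borel_measurable borel" using kernel_image_borel[OF fL] Em by measurable
  have iL: "?i \<in> L2"
    by (rule L2_indicator_mult_bounded(1)[OF E im, of "C * L2_norm f"]) (use C R f in auto)
  let ?h = "\<lambda>x. ?b x - ?i x"
  have hL: "?h \<in> L2" by (rule L2_diff(1)[OF bL iL])
  let ?\<theta> = "\<lambda>x. cnj (?h x)"
  have \<theta>: "supported E ?\<theta>" using L2_cnj(1)[OF hL] by (simp add: supported_def)
  then have \<theta>L: "?\<theta> \<in> L2" by (simp add: supported_def)
  have ind: "?b x * ?\<theta> x = B f x * ?\<theta> x" "?i x * ?\<theta> x = kernel_image f x * ?\<theta> x" for x by (auto simp: indicator_def)
  have "complex_of_real ((L2_norm ?h)\<^sup>2) = (\<integral>x. ?h x * ?\<theta> x \<partial>lborel)"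
    unfolding L2_norm_square by (simp only: norm_square_mult_cnj flip: integral_complex_of_real)
  also have "\<dots> = (\<integral>x. B f x * ?\<theta> x \<partial>lborel) - (\<integral>x. kernel_image f x * ?\<theta> x \<partial>lborel)"
    unfolding integral_pair_diff[OF bL iL \<theta>L] by (simp only: ind)
  also have "\<dots> = 0"
    by (simp only: extension_pairing[OF ext fL \<theta>L] kernel_image_pairing_localized[OF v F E f \<theta>] diff_self)
  finally have "L2_norm ?h = 0" by simp
  from L2_norm_zero_AE[OF hL this] show ?thesis by eventually_elim simp
qed

text \<open>On \<open>E\<close> the images of a bounded sequence are uniformly bounded and equicontinuous. A uniformly convergent
  subsequence, which exists by the Arzela-Ascoli theorem, converges in \<open>L\<^sup>2\<close> because \<open>E\<close> has finite
  measure.\<close>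

theorem compact_localization:
  assumes v: "vertical_nonrefocusing \<kappa>" and F: "compact F" and E: "compact E" and ext: "is_L2_extension A B"
  shows "compact_operator_L2 (mult_indicator E \<circ> B \<circ> mult_indicator F)"
proof -
  let ?T = "mult_indicator E \<circ> B \<circ> mult_indicator F"
  have Em: "E \<in> sets borel" and Fm: "F \<in> sets borel" using E F by (simp_all add: borel_compact)
  have BL: "B f \<in> L2" if "f \<in> L2" for f using ext that unfolding is_L2_extension_def continuous_linear_L2_def by blast
  have Bl: "AE x in lborel. B (\<lambda>x. p * f x + q * h x) x = p * B f x + q * B h x" if "f \<in> L2" "h \<in> L2" for f h p q
    using ext that unfolding is_L2_extension_def continuous_linear_L2_def by blast
  obtain C0 where C0: "\<And>f. f \<in> L2 \<Longrightarrow> L2_norm (B f) \<le> C0 * L2_norm f"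
    using ext unfolding is_L2_extension_def continuous_linear_L2_def by blast
  have TL: "?T f \<in> L2" if "f \<in> L2" for f
    using mult_indicator_L2(1)[OF BL[OF mult_indicator_L2(1)[OF that Fm]] Em] by simp
  have cl: "continuous_linear_L2 ?T"
    unfolding continuous_linear_L2_def
  proof (intro conjI ballI allI TL exI[of _ "max C0 0"])
    fix f :: "real ^ 'n \<Rightarrow> complex" assume f: "f \<in> L2"
    have Ff: "mult_indicator F f \<in> L2" "L2_norm (mult_indicator F f) \<le> L2_norm f" using mult_indicator_L2[OF f Fm] by auto
    have "L2_norm (?T f) \<le> L2_norm (B (mult_indicator F f))" using mult_indicator_L2(2)[OF BL[OF Ff(1)] Em] by simp
    also have "\<dots> \<le> C0 * L2_norm (mult_indicator F f)" by (rule C0[OF Ff(1)])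
    also have "\<dots> \<le> max C0 0 * L2_norm (mult_indicator F f)" by (intro mult_right_mono) auto
    also have "\<dots> \<le> max C0 0 * L2_norm f" by (intro mult_left_mono Ff) auto
    finally show "L2_norm (?T f) \<le> max C0 0 * L2_norm f" .
  next
    fix f h :: "real ^ 'n \<Rightarrow> complex" and p q assume f: "f \<in> L2" and h: "h \<in> L2"
    have "mult_indicator F (\<lambda>x. p * f x + q * h x) = (\<lambda>x. p * mult_indicator F f x + q * mult_indicator F h x)"
      by (auto simp: mult_indicator_def algebra_simps)
    then show "AE x in lborel. ?T (\<lambda>x. p * f x + q * h x) x = p * ?T f x + q * ?T h x"
      using Bl[OF mult_indicator_L2(1)[OF f Fm] mult_indicator_L2(1)[OF h Fm], of p q]
      by (auto simp: mult_indicator_def[of E] algebra_simps elim!: eventually_mono)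
  qed
  have "\<exists>r h. strict_mono r \<and> h \<in> L2 \<and> (\<lambda>n. L2_norm (\<lambda>x. ?T (f (r n)) x - h x)) \<longlonglongrightarrow> 0"
    if fL: "\<And>n::nat. f n \<in> L2" and bf: "bounded (range (\<lambda>n. L2_norm (f n)))" for f
  proof -
    obtain b where b: "b > 0" "\<And>n. L2_norm (f n) \<le> b" using bf unfolding bounded_pos by auto
    let ?f = "\<lambda>n. mult_indicator F (f n)"
    have sf: "supported F (?f n)" for n using mult_indicator_L2(1)[OF fL Fm] by (auto simp: supported_def mult_indicator_def)
    have nf: "L2_norm (?f n) \<le> b" for n by (rule order.trans[OF mult_indicator_L2(2)[OF fL Fm] b(2)])
    obtain R where R: "R \<ge> 0" "\<And>y. y \<in> E \<Longrightarrow> norm y \<le> R" using compact_imp_bounded[OF E] unfolding bounded_pos by (meson less_imp_le)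
    obtain C where C: "C > 0" "\<And>f y. supported F f \<Longrightarrow> norm y \<le> R \<Longrightarrow> norm (kernel_image f y) \<le> C * L2_norm f"
      "\<And>f y y'. supported F f \<Longrightarrow> norm y \<le> R \<Longrightarrow> norm y' \<le> R \<Longrightarrow> norm (kernel_image f y - kernel_image f y') \<le> C * L2_norm f * norm (y - y')"
      using that by (rule kernel_image_regularity[OF v F R(1)])
    have bd: "norm (kernel_image (?f n) x) \<le> C * b" if "x \<in> E" for n x
      using order.trans[OF C(2)[OF sf R(2)[OF that]] mult_left_mono[OF nf]] C(1) by simp
    have eq: "\<exists>e'>0. \<forall>n y. y \<in> E \<and> norm (x - y) < e' \<longrightarrow> norm (kernel_image (?f n) x - kernel_image (?f n) y) < e" if "x \<in> E" "e > 0" for x e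
    proof (intro exI[of _ "e / (C * b)"] conjI allI impI)
      have Cb: "C * b > 0" using C(1) b(1) by simp
      show "e / (C * b) > 0" using that(2) Cb by simp
      fix n y assume y: "y \<in> E \<and> norm (x - y) < e / (C * b)"
      have "norm (kernel_image (?f n) x - kernel_image (?f n) y) \<le> C * L2_norm (?f n) * norm (x - y)" using y by (intro C(3) sf R(2) that) auto
      also have "\<dots> \<le> C * b * norm (x - y)" using C(1) nf by (intro mult_right_mono mult_left_mono) auto
      also have "\<dots> < C * b * (e / (C * b))" using y Cb by (intro mult_strict_left_mono) auto
      also have "\<dots> = e" using C(1) b(1) by simp
      finally show "norm (kernel_image (?f n) x - kernel_image (?f n) y) < e" .
    qed
    obtain l r where l: "continuous_on E l" and r: "strict_mono (r :: nat \<Rightarrow> nat)"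
      and u: "\<And>e. 0 < e \<Longrightarrow> \<exists>N. \<forall>n x. n \<ge> N \<and> x \<in> E \<longrightarrow> norm (kernel_image (?f (r n)) x - l x) < e"
      by (rule Arzela_Ascoli[of E "\<lambda>n. kernel_image (?f n)" "C * b", OF E bd eq]) blast+
    define h where "h x = indicator E x * l x" for x
    have hm: "h \<in> borel_measurable borel"
      using borel_measurable_continuous_on_indicator[OF Em l]
      by (rule arg_cong2[where f = "(\<in>)", THEN iffD1, rotated 2]) (auto simp: h_def indicator_def)
    obtain bl where bl: "\<And>x. x \<in> E \<Longrightarrow> norm (l x) \<le> bl" "bl \<ge> 0"
      using compact_imp_bounded[OF compact_continuous_image[OF l E]] unfolding bounded_pos by (metis imageI less_imp_le)
    have hL: "h \<in> L2"
      unfolding h_def by (rule L2_indicator_mult_bounded(1)[OF E _ bl]) (use hm in \<open>simp_all add: h_def[abs_def]\<close>)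
    have "(\<lambda>n. L2_norm (\<lambda>x. ?T (f (r n)) x - h x)) \<longlonglongrightarrow> 0"
    proof (rule LIMSEQ_I)
      fix e :: real assume e: "e > 0"
      let ?I = "L2_norm (indicator E :: real ^ 'n \<Rightarrow> complex)"
      define e' where "e' = e / (?I + 1)"
      have pos: "?I + 1 > 0" by (simp add: add_nonneg_pos)
      then have e': "e' > 0" using e by (simp add: e'_def)
      obtain N where N: "\<And>n x. n \<ge> N \<Longrightarrow> x \<in> E \<Longrightarrow> norm (kernel_image (?f (r n)) x - l x) < e'" using u[OF e'] by blast
      have "norm (L2_norm (\<lambda>x. ?T (f (r n)) x - h x) - 0) < e" if n: "n \<ge> N" for n
      proof -
        let ?q = "\<lambda>x. indicator E x * (kernel_image (?f (r n)) x - l x)"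
        have fr: "?f (r n) \<in> L2" using sf by (simp add: supported_def)
        have qe: "?q = (\<lambda>x. indicator E x * kernel_image (?f (r n)) x - h x)" by (auto simp: h_def algebra_simps)
        have qm: "?q \<in> borel_measurable borel" unfolding qe using kernel_image_borel[OF fr] Em hm by measurable
        have "AE x in lborel. ?T (f (r n)) x - h x = ?q x"
          using extension_eq_kernel_image[OF v F E ext sf[of "r n"]]
          by eventually_elim (simp add: mult_indicator_def[of E] h_def algebra_simps)
        then have "L2_norm (\<lambda>x. ?T (f (r n)) x - h x) = L2_norm ?q"
          by (rule L2_norm_cong_AE) (rule L2_borel[OF L2_diff(1)[OF TL[OF fL] hL]], rule qm)
        also have "\<dots> \<le> e' * ?I"
          by (rule L2_indicator_mult_bounded(2)[OF E qm]) (use N[OF n] e' in \<open>auto intro: less_imp_le\<close>)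
        also have "\<dots> < e' * (?I + 1)" using e' by (intro mult_strict_left_mono) auto
        also have "\<dots> = e" using pos by (simp add: e'_def)
        finally show ?thesis by simp
      qed
      then show "\<exists>N. \<forall>n\<ge>N. norm (L2_norm (\<lambda>x. ?T (f (r n)) x - h x) - 0) < e" by blast
    qed
    with r hL show ?thesis by blast
  qed
  with cl show ?thesis unfolding compact_operator_L2_def by blast
qed

end

theorem theorem3p4:
  fixes \<kappa> :: "'n::finite phase \<Rightarrow> 'n phase"
    and A :: "'n distr_op"
    and E F :: "(real ^ 'n) set"
  assumes "tame_canonical \<kappa>"
    and "vertical_nonrefocusing \<kappa>"
    and "A \<in> FIO \<kappa>"
    and "compact E"
    and "compact F"
  shows "compact_operator_L2 (mult_indicator E \<circ> L2_extension A \<circ> mult_indicator F)"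
proof -
  obtain g where cont: "continuous_linear_S_S' A" and g: "g \<in> schwartz - {\<lambda>x. 0}"
    and dec: "\<And>N::real. N > 0 \<Longrightarrow> \<exists>C>0. \<forall>z w. norm (pairing (A (phase_shift z g)) (phase_shift w g)) \<le> C * (1 + norm (w - \<kappa> z)) powr (- N)"
    using assms(3) unfolding FIO_def by blast
  have "g \<noteq> (\<lambda>x. 0)" using g by simp
  then obtain a where a: "g a \<noteq> 0" by auto
  have decay: "\<exists>C>0. \<forall>z w. norm (pairing (A (phase_shift z g)) (phase_shift w g)) \<le> C * wt N (w - \<kappa> z)" for N :: nat
  proof -
    \<comment> \<open>The hypothesis provides positive exponents only, hence \<open>Suc N\<close> to include \<open>N = 0\<close>.\<close>
    obtain C where C: "C > 0" "\<And>z w. norm (pairing (A (phase_shift z g)) (phase_shift w g)) \<le> C * (1 + norm (w - \<kappa> z)) powr (- real (Suc N))"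
      using dec[of "real (Suc N)"] by auto
    have "(1 + norm v) powr (- real (Suc N)) \<le> wt N v" for v :: "'n phase"
    proof -
      have "(1 + norm v) powr (- real (Suc N)) = wt (Suc N) v"
        unfolding powr_minus by (subst powr_realpow) (simp_all add: wt_def)
      then show ?thesis using wt_antimono[of N "Suc N" v] by simp
    qed
    then have "norm (pairing (A (phase_shift z g)) (phase_shift w g)) \<le> C * wt N (w - \<kappa> z)" for z w
      by (rule order.trans[OF C(2) mult_left_mono]) (use C(1) in simp)
    then show ?thesis using C(1) by blast
  qed
  interpret gabor_operator \<kappa> A g a "2 * DIM('n phase)"
    by unfold_locales (use assms(1) cont g a decay in \<open>auto simp: schwartz_iff_rapid\<close>)
  have "is_L2_extension A (L2_extension A)"
    unfolding L2_extension_def by (rule someI_ex[OF L2_extension_exists])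
  then show ?thesis by (rule compact_localization[OF assms(2,5,4)])
qed

end
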